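(* Let $\mathbb{F}$ be a finite field, $X=\mathbb{P}^1$ the projective line over $\mathbb{F}$, and $K=\mathbb{F}(t)$ its function field. For an effective divisor $D$ on $X$, the following are equivalent: (1) every Eichler $X$-order of level $D$ in $\mathbb{M}_2(K)$ is split; (2) $D\le P_1+P_2$ for some closed points $P_1\neq P_2$ of $X$ with $\deg(P_1)=\deg(P_2)=1$.
   Context: For a divisor $B$ on $X$, $\mathfrak{L}^B$ denotes the invertible sheaf with $\mathfrak{L}^B(U)=\{f\in K : (\mathrm{div}(f)+B)|_U\ge 0\}$. An $X$-order in $\mathbb{M}_2(K)$ is a locally free sheaf $\mathfrak{R}$ of $\mathcal{O}_X$-modules with generic fiber $\mathbb{M}_2(K)$ such that each $\mathfrak{R}(U)$ is a ring and a full-rank $\mathcal{O}_X(U)$-lattice in $\mathbb{M}_2(K)$. Maximal $X$-orders are the sheaves $\mathfrak{D}_\Lambda(U)=\{a\in\mathbb{M}_2(K): a\Lambda(U)\subseteq \Lambda(U)\}$ for rank-2 vector bundles $\Lambda$ in $K^2$. An Eichler order is an intersection of two maximal orders. For a closed point $P$ (completion $K_P$, integers $\mathcal{O}_P$, uniformizer $\pi_P$), two maximal orders of $\mathbb{M}_2(K_P)$ are at distance $d$ if in some basis they are $\mathbb{M}_2(\mathcal{O}_P)$ and $\begin{pmatrix}\mathcal{O}_P&\pi_P^d\mathcal{O}_P\\ \pi_P^{-d}\mathcal{O}_P&\mathcal{O}_P\end{pmatrix}$; the level of the Eichler order $\mathfrak{D}\cap\mathfrak{D}'$ is the effective divisor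 $\sum_P d_P(\mathfrak{D}_P,\mathfrak{D}'_P)P$ of local distances between completions. An order $\mathfrak{E}$ is split if it is conjugate (by $\mathrm{GL}_2(K)$) to $\begin{pmatrix}\mathcal{O}_X&\mathfrak{L}_1\\ \mathfrak{L}_2&\mathcal{O}_X\end{pmatrix}$ for invertible bundles $\mathfrak{L}_1,\mathfrak{L}_2$, equivalently if $\mathfrak{E}(X)$ contains a non-trivial idempotent. *)

theory Defs
  imports
    "HOL-Analysis.Analysis"
    "HOL-Computational_Algebra.Polynomial"
    "HOL-Computational_Algebra.Fraction_Field"
    "HOL-Library.Poly_Mapping"
    "HOL-Algebra.QuotRing"
begin

section \<open>The projective line\<close>

text \<open>The function field \<open>K = F(t)\<close> is the fraction field of the polynomial ring. The closed points
  of the projective line are the closed points of the affine line, given by the monic irreducible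
  polynomials, and the point at infinity.\<close>

type_synonym 'a ratfun = "'a poly fract"

typedef (overloaded) ('a::field) closed_point =
  "insert None (Some ` {p :: 'a poly. irreducible p \<and> lead_coeff p = 1})"
  morphisms equation_of Abs_closed_point
  by blast

text \<open>\<^term>\<open>equation_of P\<close> is \<open>Some p\<close> for the point of the affine line given by \<open>p\<close>,
  and \<open>None\<close> for the point at infinity.\<close>

definition point_degree :: "('a::field) closed_point \<Rightarrow> nat" where
  "point_degree P = (case equation_of P of None \<Rightarrow> 1 | Some p \<Rightarrow> degree p)"

text \<open>The order of vanishing at \<open>P\<close> of a nonzero polynomial. The library's \<open>multiplicity\<close> is
  not available here, because it needs a \<open>gcd\<close> structure on the coefficient field.\<close>

definition ord_poly :: "('a::field) closed_point \<Rightarrow> 'a poly \<Rightarrow> int" where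
  "ord_poly P a =
     (case equation_of P of None \<Rightarrow> - int (degree a) | Some p \<Rightarrow> int (Max {k. p ^ k dvd a}))"

text \<open>The normalized discrete valuation at \<open>P\<close>. Its value at \<open>0\<close> is unspecified;
  \<open>val_ge P n f\<close> says that \<open>f\<close> has valuation at least \<open>n\<close>, the valuation of \<open>0\<close> being infinite.\<close>

definition ord :: "('a::field) closed_point \<Rightarrow> 'a ratfun \<Rightarrow> int" where
  "ord P f = (THE n. \<exists>a b. a \<noteq> 0 \<and> b \<noteq> 0 \<and> f = Fract a b \<and> n = ord_poly P a - ord_poly P b)"

definition val_ge :: "('a::field) closed_point \<Rightarrow> int \<Rightarrow> 'a ratfun \<Rightarrow> bool" where
  "val_ge P n f \<longleftrightarrow> f = 0 \<or> n \<le> ord P f"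

text \<open>The nonempty Zariski open sets, seen as sets of closed points, are the cofinite ones
  (there are infinitely many closed points, so a cofinite set is nonempty).\<close>

definition zopen :: "('a::field) closed_point set \<Rightarrow> bool" where
  "zopen U \<longleftrightarrow> finite (- U)"


section \<open>Divisors\<close>

type_synonym 'a divisor = "'a closed_point \<Rightarrow>\<^sub>0 int"

text \<open>The order instance of \<^typ>\<open>'b \<Rightarrow>\<^sub>0 int\<close> in the library is lexicographic, so the
  pointwise order gets its own name.\<close>

definition div_le :: "('a::field) divisor \<Rightarrow> 'a divisor \<Rightarrow> bool" where
  "div_le D E \<longleftrightarrow> (\<forall>P. Poly_Mapping.lookup D P \<le> Poly_Mapping.lookup E P)"

definition effective :: "('a::field) divisor \<Rightarrow> bool" where
  "effective D \<longleftrightarrow> div_le 0 D"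

definition div_sheaf :: "('a::field) divisor \<Rightarrow> 'a closed_point set \<Rightarrow> 'a ratfun set" where
  "div_sheaf B U = {f. \<forall>P\<in>U. val_ge P (- Poly_Mapping.lookup B P) f}"

abbreviation structure_sheaf :: "('a::field) closed_point set \<Rightarrow> 'a ratfun set" where
  "structure_sheaf \<equiv> div_sheaf 0"


section \<open>Vector bundles inside a constant sheaf\<close>

text \<open>All sheaves in question are subsheaves of the constant sheaf on a \<open>K\<close>-vector space \<open>V\<close>
  (\<open>V\<close> being \<open>K\<close>, \<open>K\<^sup>2\<close> or \<open>M\<^sub>2(K)\<close>), with inclusions as restriction maps. Such a sheaf is a function
  from open sets to subsets of \<open>V\<close>. Only its values at nonempty open sets are meaningful. As the
  line is irreducible, the sheaf axiom for an open cover says that the sections on the union are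
  the elements of \<open>V\<close> that are sections on every member of the cover.\<close>

definition subsheaf :: "(('a::field) closed_point set \<Rightarrow> 'v set) \<Rightarrow> bool" where
  "subsheaf F \<longleftrightarrow> (\<forall>\<U>. \<U> \<noteq> {} \<and> (\<forall>U\<in>\<U>. zopen U) \<longrightarrow> F (\<Union>\<U>) = (\<Inter>U\<in>\<U>. F U))"

definition module_sheaf ::
  "('a::field ratfun \<Rightarrow> 'v \<Rightarrow> 'v::ab_group_add) \<Rightarrow> ('a closed_point set \<Rightarrow> 'v set) \<Rightarrow> bool" where
  "module_sheaf smul F \<longleftrightarrow> subsheaf F \<and>
     (\<forall>U. zopen U \<longrightarrow> 0 \<in> F U \<and> (\<forall>x\<in>F U. \<forall>y\<in>F U. x + y \<in> F U) \<and>
        (\<forall>c\<in>structure_sheaf U. \<forall>x\<in>F U. smul c x \<in> F U))"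

text \<open>A rank \<open>n\<close> vector bundle in \<open>V\<close>: around every point the sheaf is free over the structure
  sheaf, on \<open>n\<close> sections that are linearly independent over \<open>K\<close>.\<close>

definition vector_bundle ::
  "('a::field ratfun \<Rightarrow> 'v \<Rightarrow> 'v::ab_group_add) \<Rightarrow> nat \<Rightarrow> ('a closed_point set \<Rightarrow> 'v set) \<Rightarrow> bool"
  where
  "vector_bundle smul n F \<longleftrightarrow> module_sheaf smul F \<and>
     (\<forall>P. \<exists>U e. zopen U \<and> P \<in> U \<and>
        (\<forall>c. (\<Sum>i<n. smul (c i) (e i)) = 0 \<longrightarrow> (\<forall>i<n. c i = 0)) \<and>
        (\<forall>V. zopen V \<and> V \<subseteq> U \<longrightarrow>
           F V = {\<Sum>i<n. smul (c i) (e i) | c. \<forall>i<n. c i \<in> structure_sheaf V}))"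

definition invertible_bundle :: "(('a::field) closed_point set \<Rightarrow> 'a ratfun set) \<Rightarrow> bool" where
  "invertible_bundle L \<longleftrightarrow> vector_bundle (*) 1 L"

definition plane_bundle :: "(('a::field) closed_point set \<Rightarrow> ('a ratfun ^ 2) set) \<Rightarrow> bool" where
  "plane_bundle \<Lambda> \<longleftrightarrow> vector_bundle (*s) 2 \<Lambda>"


section \<open>Maximal orders\<close>

type_synonym 'a order_sheaf = "'a closed_point set \<Rightarrow> ('a ratfun ^ 2 ^ 2) set"

text \<open>The endomorphism sheaf of a rank 2 bundle. On an affine open set, the condition for \<open>V = U\<close>
  implies the others, so that the sections on \<open>U\<close> are the \<open>a\<close> with \<open>a \<Lambda>(U) \<subseteq> \<Lambda>(U)\<close>. On the
  whole line, the condition for \<open>V = U\<close> alone would not define a sheaf (the bundle may have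
  no nonzero global sections), whence the quantification over \<open>V\<close>.\<close>

definition End_sheaf ::
  "(('a::field) closed_point set \<Rightarrow> ('a ratfun ^ 2) set) \<Rightarrow> 'a order_sheaf" where
  "End_sheaf \<Lambda> U = {a. \<forall>V. zopen V \<and> V \<subseteq> U \<longrightarrow> (\<forall>x\<in>\<Lambda> V. a *v x \<in> \<Lambda> V)}"

definition maximal_order :: "('a::field) order_sheaf \<Rightarrow> bool" where
  "maximal_order R \<longleftrightarrow> (\<exists>\<Lambda>. plane_bundle \<Lambda> \<and> (\<forall>U. zopen U \<longrightarrow> R U = End_sheaf \<Lambda> U))"


section \<open>Completions\<close>

text \<open>The completion \<open>K\<^sub>P\<close> is the ring of Cauchy sequences for the valuation at \<open>P\<close> modulo the
  ideal of null sequences. Its elements are cosets, that is, sets of sequences.\<close>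

type_synonym 'a completed = "(nat \<Rightarrow> 'a ratfun) set"

definition cauchy_seqs :: "('a::field) closed_point \<Rightarrow> (nat \<Rightarrow> 'a ratfun) set" where
  "cauchy_seqs P = {s. \<forall>N. \<exists>M. \<forall>m\<ge>M. \<forall>n\<ge>M. val_ge P N (s m - s n)}"

definition null_seqs :: "('a::field) closed_point \<Rightarrow> (nat \<Rightarrow> 'a ratfun) set" where
  "null_seqs P = {s. \<forall>N. \<exists>M. \<forall>n\<ge>M. val_ge P N (s n)}"

definition cauchy_ring :: "('a::field) closed_point \<Rightarrow> (nat \<Rightarrow> 'a ratfun) ring" where
  "cauchy_ring P = \<lparr>carrier = cauchy_seqs P,
     mult = (\<lambda>s s' n. s n * s' n), one = (\<lambda>n. 1),
     zero = (\<lambda>n. 0), add = (\<lambda>s s' n. s n + s' n)\<rparr>"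

definition completion :: "('a::field) closed_point \<Rightarrow> 'a completed ring" where
  "completion P = cauchy_ring P Quot null_seqs P"

definition limit_at :: "('a::field) closed_point \<Rightarrow> (nat \<Rightarrow> 'a ratfun) \<Rightarrow> 'a completed" where
  "limit_at P s = null_seqs P +>\<^bsub>cauchy_ring P\<^esub> s"

abbreviation embed :: "('a::field) closed_point \<Rightarrow> 'a ratfun \<Rightarrow> 'a completed" where
  "embed P f \<equiv> limit_at P (\<lambda>n. f)"

definition integers_at :: "('a::field) closed_point \<Rightarrow> 'a completed set" where
  "integers_at P = {limit_at P s | s. s \<in> cauchy_seqs P \<and> (\<forall>n. val_ge P 0 (s n))}"

text \<open>The ring \<open>M\<^sub>2(K\<^sub>P)\<close>. As \<open>K\<^sub>P\<close> depends on \<open>P\<close>, it is not a type, and the matrix operations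
  of the library do not apply.\<close>

definition mats_at :: "('a::field) closed_point \<Rightarrow> ('a completed ^ 2 ^ 2) set" where
  "mats_at P = {A. \<forall>i j. A $ i $ j \<in> carrier (completion P)}"

definition mat_mult_at ::
  "('a::field) closed_point \<Rightarrow> 'a completed ^ 2 ^ 2 \<Rightarrow> 'a completed ^ 2 ^ 2 \<Rightarrow> 'a completed ^ 2 ^ 2"
  where
  "mat_mult_at P A B = (\<chi> i j.
     (A $ i $ 1 \<otimes>\<^bsub>completion P\<^esub> B $ 1 $ j) \<oplus>\<^bsub>completion P\<^esub> (A $ i $ 2 \<otimes>\<^bsub>completion P\<^esub> B $ 2 $ j))"

definition mat_one_at :: "('a::field) closed_point \<Rightarrow> 'a completed ^ 2 ^ 2" where
  "mat_one_at P = (\<chi> i j. if i = j then \<one>\<^bsub>completion P\<^esub> else \<zero>\<^bsub>completion P\<^esub>)"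

text \<open>The completion at \<open>P\<close> of a sheaf in \<open>M\<^sub>2(K)\<close>: the limits in \<open>M\<^sub>2(K\<^sub>P)\<close> of the Cauchy sequences
  in the stalk at \<open>P\<close>.\<close>

definition stalk :: "('a::field) order_sheaf \<Rightarrow> 'a closed_point \<Rightarrow> ('a ratfun ^ 2 ^ 2) set" where
  "stalk R P = (\<Union>U\<in>{U. zopen U \<and> P \<in> U}. R U)"

definition complete_at ::
  "('a::field) closed_point \<Rightarrow> 'a order_sheaf \<Rightarrow> ('a completed ^ 2 ^ 2) set" where
  "complete_at P R = {(\<chi> i j. limit_at P (\<lambda>n. A n $ i $ j)) | A.
     (\<forall>i j. (\<lambda>n. A n $ i $ j) \<in> cauchy_seqs P) \<and> (\<forall>n. A n \<in> stalk R P)}"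


section \<open>Local distance and level\<close>

text \<open>The order with rows \<open>O\<^sub>P, \<pi>\<^sup>d O\<^sub>P\<close> and \<open>\<pi>\<^sup>-\<^sup>d O\<^sub>P, O\<^sub>P\<close>; for \<open>d = 0\<close> it is \<open>M\<^sub>2(O\<^sub>P)\<close>.\<close>

definition standard_order ::
  "('a::field) closed_point \<Rightarrow> 'a ratfun \<Rightarrow> nat \<Rightarrow> ('a completed ^ 2 ^ 2) set" where
  "standard_order P \<pi> d = {A.
     A $ 1 $ 1 \<in> integers_at P \<and>
     A $ 1 $ 2 \<in> (\<lambda>x. embed P (\<pi> powi int d) \<otimes>\<^bsub>completion P\<^esub> x) ` integers_at P \<and>
     A $ 2 $ 1 \<in> (\<lambda>x. embed P (\<pi> powi (- int d)) \<otimes>\<^bsub>completion P\<^esub> x) ` integers_at P \<and>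
     A $ 2 $ 2 \<in> integers_at P}"

definition at_distance ::
  "('a::field) closed_point \<Rightarrow> nat \<Rightarrow> ('a completed ^ 2 ^ 2) set \<Rightarrow> ('a completed ^ 2 ^ 2) set \<Rightarrow> bool"
  where
  "at_distance P d M M' \<longleftrightarrow> (\<exists>\<pi> g h. \<pi> \<noteq> 0 \<and> ord P \<pi> = 1 \<and> g \<in> mats_at P \<and> h \<in> mats_at P \<and>
     mat_mult_at P g h = mat_one_at P \<and> mat_mult_at P h g = mat_one_at P \<and>
     M = (\<lambda>A. mat_mult_at P (mat_mult_at P g A) h) ` {A. \<forall>i j. A $ i $ j \<in> integers_at P} \<and>
     M' = (\<lambda>A. mat_mult_at P (mat_mult_at P g A) h) ` standard_order P \<pi> d)"

definition eichler_order_of_level :: "('a::field) divisor \<Rightarrow> 'a order_sheaf \<Rightarrow> bool" where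
  "eichler_order_of_level D E \<longleftrightarrow> (\<exists>R R'. maximal_order R \<and> maximal_order R' \<and>
     (\<forall>U. zopen U \<longrightarrow> E U = R U \<inter> R' U) \<and>
     (\<forall>P. \<exists>d. Poly_Mapping.lookup D P = int d \<and> at_distance P d (complete_at P R) (complete_at P R')))"


section \<open>Split orders\<close>

definition split_order :: "('a::field) order_sheaf \<Rightarrow> bool" where
  "split_order E \<longleftrightarrow> (\<exists>(g :: 'a ratfun ^ 2 ^ 2) L\<^sub>1 L\<^sub>2. invertible g \<and> invertible_bundle L\<^sub>1 \<and> invertible_bundle L\<^sub>2 \<and>
     (\<forall>U. zopen U \<longrightarrow> E U = (\<lambda>A. g ** A ** matrix_inv g) `
        {A. A $ 1 $ 1 \<in> structure_sheaf U \<and> A $ 1 $ 2 \<in> L\<^sub>1 U \<and>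
            A $ 2 $ 1 \<in> L\<^sub>2 U \<and> A $ 2 $ 2 \<in> structure_sheaf U}))"

end

theory Submission
  imports Defs "HOL-Computational_Algebra.Polynomial_Factorial"
begin

text \<open>A maximal order is a compatible family of local lattices up to scaling, and a neighbour of
  a lattice at \<open>P\<close> is a line in its fibre at \<open>P\<close>. By Grothendieck's theorem, proved here with
  successive minima, every plane bundle is a direct sum of two line bundles, with basis \<open>v\<^sub>1\<close>,
  \<open>v\<^sub>2\<close> and degrees differing by \<open>n \<ge> 0\<close>; one may replace \<open>v\<^sub>2\<close> by \<open>v\<^sub>2 + f v\<^sub>1\<close> with
  \<open>deg f \<le> n\<close>. For \<open>n \<ge> 1\<close>, interpolation by such an \<open>f\<close> makes the given lines in the fibres at two
  rational points coordinate lines; for \<open>n = 0\<close>, a constant change of basis does. Conversely, for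
  the trivial bundle a splitting is given by a pair of lines over the constant field. It is
  excluded by a line that is not constant modulo \<open>D\<close> at a single point, which exists if the
  point has degree at least two or multiplicity at least two, and by three distinct
  constant lines at three rational points.\<close>

section \<open>Valuations\<close>

lemma equation_of_cases:
  obtains "equation_of P = None" | p where "equation_of P = Some p" "irreducible p" "lead_coeff p = 1"
  using equation_of[of P] by auto

lemma equation_of_SomeD:
  assumes "equation_of P = Some p"
  shows "irreducible p" "lead_coeff p = 1" "p \<noteq> 0" "prime_elem p" "degree p > 0"
proof -
  show 1: "irreducible p" and "lead_coeff p = 1"
    using equation_of[of P] assms by auto
  then show "p \<noteq> 0" "prime_elem p" by (auto intro: field_poly_irreducible_imp_prime)
  show "degree p > 0"
    using 1 is_unit_iff_degree[of p] \<open>p \<noteq> 0\<close> by (auto simp: irreducible_def)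
qed

lemma prime_power_decomposition:
  fixes p a :: "'a::field poly"
  assumes "degree p > 0" "a \<noteq> 0"
  obtains k b where "a = p ^ k * b" "\<not> p dvd b"
proof -
  have "\<exists>k b. a = p ^ k * b \<and> \<not> p dvd b"
    using assms(2)
  proof (induction "degree a" arbitrary: a rule: less_induct)
    case less
    show ?case
    proof (cases "p dvd a")
      case True
      then obtain c where c: "a = p * c" by blast
      with less.prems have "c \<noteq> 0" "p \<noteq> 0" by auto
      then have "degree c < degree a" using assms(1) c by (simp add: degree_mult_eq)
      from less.hyps[OF this \<open>c \<noteq> 0\<close>] obtain k b where "c = p ^ k * b" "\<not> p dvd b" by blast
      then have "a = p ^ Suc k * b \<and> \<not> p dvd b" using c by (simp add: mult_ac)
      then show ?thesis by blast
    next
      case False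
      then have "a = p ^ 0 * a \<and> \<not> p dvd a" by simp
      then show ?thesis by blast
    qed
  qed
  then show ?thesis using that by blast
qed

lemma ex_monic_irreducible_dvd:
  fixes b :: "'a::field poly"
  assumes "degree b \<noteq> 0"
  obtains q where "irreducible q" "lead_coeff q = 1" "q dvd b"
proof -
  have "\<exists>q. irreducible q \<and> lead_coeff q = 1 \<and> q dvd b"
    using assms
  proof (induction "degree b" arbitrary: b rule: less_induct)
    case less
    have b0: "b \<noteq> 0" using less.prems by auto
    then have bu: "\<not> b dvd 1" using less.prems is_unit_iff_degree[of b] by auto
    show ?case
    proof (cases "irreducible b")
      case True
      define q where "q = smult (inverse (lead_coeff b)) b"
      have "b = smult (lead_coeff b) q" using b0 by (simp add: q_def)
      then have eq: "b = q * [:lead_coeff b:]" by (metis mult_smult_right mult.right_neutral smult_one smult_eq_0_iff mult.commute mult_smult_left one_pCons)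
      have u: "[:lead_coeff b:] dvd 1" using b0 by (simp add: is_unit_pCons_iff)
      have "irreducible q"
      proof (rule irreducibleI)
        show "q \<noteq> 0" using eq b0 by auto
        show "\<not> q dvd 1" using eq bu u by (metis is_unit_mult_iff)
        fix x y assume "q = x * y"
        then have "b = x * (y * [:lead_coeff b:])" using eq by (simp only: mult.assoc)
        then have "x dvd 1 \<or> y * [:lead_coeff b:] dvd 1" using irreducibleD[OF True] by blast
        then show "x dvd 1 \<or> y dvd 1" using is_unit_mult_iff by blast
      qed
      moreover have "lead_coeff q = 1" using b0 by (simp add: q_def)
      ultimately show ?thesis using eq dvd_triv_left by metis
    next
      case False
      then obtain c d where cd: "b = c * d" "\<not> c dvd 1" "\<not> d dvd 1"
        using b0 bu unfolding irreducible_def by blast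
      have nz: "c \<noteq> 0" "d \<noteq> 0" using cd b0 by auto
      then have "degree c \<noteq> 0" "degree d \<noteq> 0" using cd by (auto simp: is_unit_iff_degree)
      moreover have "degree c < degree b" using calculation nz cd by (simp add: degree_mult_eq)
      ultimately obtain q where "irreducible q" "lead_coeff q = 1" "q dvd c" using less.hyps by blast
      then show ?thesis using cd by auto
    qed
  qed
  then show ?thesis using that by blast
qed

lemma ord_poly_infinity: "equation_of P = None \<Longrightarrow> ord_poly P a = - int (degree a)"
  by (simp add: ord_poly_def)

lemma ord_poly_eqI:
  assumes P: "equation_of P = Some p" and a: "a = p ^ k * b" "\<not> p dvd b"
  shows "ord_poly P a = int k"
proof -
  note p = equation_of_SomeD[OF P]
  have "{j. p ^ j dvd a} = {..k}"
  proof (intro equalityI subsetI)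
    fix j assume "j \<in> {j. p ^ j dvd a}"
    then have j: "p ^ j dvd p ^ k * b" using a by simp
    show "j \<in> {..k}"
    proof (rule ccontr)
      assume "j \<notin> {..k}"
      then have "p ^ Suc k dvd p ^ j" by (intro le_imp_power_dvd) auto
      then have "p ^ k * p dvd p ^ k * b" using j dvd_trans by (metis power_Suc2)
      then show False using a p by simp
    qed
  qed (auto simp: a le_imp_power_dvd)
  moreover have "Max {..k} = k" by (rule Max_eqI) auto
  ultimately show ?thesis using P by (simp add: ord_poly_def)
qed

lemma ord_poly_mult:
  assumes "a \<noteq> 0" "b \<noteq> 0"
  shows "ord_poly P (a * b) = ord_poly P a + ord_poly P b"
proof (cases P rule: equation_of_cases)
  case 1
  then show ?thesis using assms by (simp add: ord_poly_infinity degree_mult_eq)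
next
  case (2 p)
  note p = equation_of_SomeD[OF 2(1)]
  obtain k a' where a: "a = p ^ k * a'" "\<not> p dvd a'" by (rule prime_power_decomposition[OF p(5) assms(1)])
  obtain l b' where b: "b = p ^ l * b'" "\<not> p dvd b'" by (rule prime_power_decomposition[OF p(5) assms(2)])
  have "a * b = p ^ (k + l) * (a' * b')" using a b by (simp add: power_add mult_ac)
  moreover have "\<not> p dvd a' * b'" using a b p(4) by (simp add: prime_elem_dvd_mult_iff)
  ultimately show ?thesis using ord_poly_eqI[OF 2(1)] a b by (metis of_nat_add)
qed

lemma ord_poly_add:
  assumes "a \<noteq> 0" "b \<noteq> 0" "a + b \<noteq> 0"
  shows "min (ord_poly P a) (ord_poly P b) \<le> ord_poly P (a + b)"
proof (cases P rule: equation_of_cases)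
  case 1
  then show ?thesis using degree_add_le_max[of a b] by (simp add: ord_poly_infinity)
next
  case (2 p)
  note p = equation_of_SomeD[OF 2(1)]
  obtain k a' where a: "a = p ^ k * a'" "\<not> p dvd a'" by (rule prime_power_decomposition[OF p(5) assms(1)])
  obtain l b' where b: "b = p ^ l * b'" "\<not> p dvd b'" by (rule prime_power_decomposition[OF p(5) assms(2)])
  obtain m c' where c: "a + b = p ^ m * c'" "\<not> p dvd c'" by (rule prime_power_decomposition[OF p(5) assms(3)])
  have "p ^ min k l dvd a" "p ^ min k l dvd b"
    by (auto simp: a b intro!: dvd_mult2 le_imp_power_dvd)
  then have d: "p ^ min k l dvd p ^ m * c'" using c by (metis dvd_add)
  have "min k l \<le> m"
  proof (rule ccontr)
    assume "\<not> min k l \<le> m"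
    then have "p ^ Suc m dvd p ^ min k l" by (intro le_imp_power_dvd) auto
    then have "p ^ m * p dvd p ^ m * c'" using d dvd_trans by (metis power_Suc2)
    then show False using c p by simp
  qed
  then show ?thesis using ord_poly_eqI[OF 2(1)] a b c by (metis of_nat_min of_nat_le_iff)
qed

lemma ord_poly_const: "c \<noteq> 0 \<Longrightarrow> ord_poly P [:c:] = 0"
proof (cases P rule: equation_of_cases)
  case (2 p)
  assume c: "c \<noteq> 0"
  note p = equation_of_SomeD[OF 2(1)]
  have "\<not> p dvd [:c:]"
  proof
    assume "p dvd [:c:]"
    then have "degree p \<le> degree [:c:]" using c by (intro dvd_imp_degree_le) auto
    then show False using p(5) by simp
  qed
  then show ?thesis using ord_poly_eqI[OF 2(1), of "[:c:]" 0] by simp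
qed (simp add: ord_poly_infinity)

lemma ord_Fract:
  assumes "a \<noteq> 0" "b \<noteq> 0"
  shows "ord P (Fract a b) = ord_poly P a - ord_poly P b"
  unfolding ord_def
proof (rule the_equality)
  show "\<exists>a' b'. a' \<noteq> 0 \<and> b' \<noteq> 0 \<and> Fract a b = Fract a' b' \<and>
          ord_poly P a - ord_poly P b = ord_poly P a' - ord_poly P b'"
    using assms by blast
next
  fix n assume "\<exists>a' b'. a' \<noteq> 0 \<and> b' \<noteq> 0 \<and> Fract a b = Fract a' b' \<and> n = ord_poly P a' - ord_poly P b'"
  then obtain a' b' where *: "a' \<noteq> 0" "b' \<noteq> 0" "Fract a b = Fract a' b'" "n = ord_poly P a' - ord_poly P b'" by blast
  then have "a * b' = a' * b" using assms by (simp add: eq_fract)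
  then have "ord_poly P a + ord_poly P b' = ord_poly P a' + ord_poly P b"
    using assms * by (metis ord_poly_mult)
  then show "n = ord_poly P a - ord_poly P b" using * by simp
qed

lemma nonzero_Fract:
  fixes f :: "'a::field ratfun"
  assumes "f \<noteq> 0"
  obtains a b where "f = Fract a b" "a \<noteq> 0" "b \<noteq> 0"
  using assms by (metis Fract_cases_nonzero)

lemma ord_mult:
  fixes f g :: "'a::field ratfun"
  assumes "f \<noteq> 0" "g \<noteq> 0" shows "ord P (f * g) = ord P f + ord P g"
proof -
  obtain a b where 1: "f = Fract a b" "a \<noteq> 0" "b \<noteq> 0" by (rule nonzero_Fract[OF assms(1)])
  obtain c d where 2: "g = Fract c d" "c \<noteq> 0" "d \<noteq> 0" by (rule nonzero_Fract[OF assms(2)])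
  show ?thesis using 1 2 by (simp add: ord_Fract ord_poly_mult)
qed

lemma ord_to_fract: "a \<noteq> 0 \<Longrightarrow> ord P (to_fract a) = ord_poly P a"
  using ord_poly_const[of 1 P] by (simp add: to_fract_def ord_Fract one_pCons)

lemma ord_const [simp]: "c \<noteq> 0 \<Longrightarrow> ord P (to_fract [:c:]) = 0"
  by (simp add: ord_to_fract ord_poly_const)

lemma ord_one [simp]: "ord P 1 = 0"
  using ord_const[of 1 P] by (simp add: one_pCons[symmetric])

lemma ord_inverse:
  fixes f :: "'a::field ratfun"
  assumes "f \<noteq> 0" shows "ord P (inverse f) = - ord P f"
  using ord_mult[of f "inverse f" P] assms by simp

lemma ord_divide:
  fixes f g :: "'a::field ratfun"
  assumes "f \<noteq> 0" "g \<noteq> 0" shows "ord P (f / g) = ord P f - ord P g"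
  using assms by (simp add: divide_inverse ord_mult ord_inverse)

lemma ord_uminus [simp]:
  fixes f :: "'a::field ratfun"
  shows "ord P (- f) = ord P f"
proof (cases "f = 0")
  case False
  have "- f = to_fract [:-1:] * f"
    by (metis minus_pCons minus_zero one_pCons to_fract_1 to_fract_uminus mult_minus1)
  moreover have "to_fract [:-1::'a:] \<noteq> 0" by simp
  ultimately show ?thesis using False by (metis ord_mult ord_const add_0 neg_equal_0_iff_equal zero_neq_one)
qed auto

lemma ord_power:
  fixes f :: "'a::field ratfun"
  assumes "f \<noteq> 0" shows "ord P (f ^ n) = int n * ord P f"
  by (induction n) (auto simp: ord_mult assms algebra_simps)

lemma ord_powi:
  fixes f :: "'a::field ratfun"
  assumes "f \<noteq> 0" shows "ord P (f powi n) = n * ord P f"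
  using assms by (simp add: power_int_def ord_power ord_inverse)

lemma ord_add:
  fixes f g :: "'a::field ratfun"
  assumes "f \<noteq> 0" "g \<noteq> 0" "f + g \<noteq> 0"
  shows "min (ord P f) (ord P g) \<le> ord P (f + g)"
proof -
  obtain a b where 1: "f = Fract a b" "a \<noteq> 0" "b \<noteq> 0" by (rule nonzero_Fract[OF assms(1)])
  obtain c d where 2: "g = Fract c d" "c \<noteq> 0" "d \<noteq> 0" by (rule nonzero_Fract[OF assms(2)])
  have s: "f + g = Fract (a * d + c * b) (b * d)" using 1 2 by simp
  then have "a * d + c * b \<noteq> 0" using assms(3) by (metis eq_fract(2) mult_zero_left fract_collapse(1))
  then show ?thesis
    using s 1 2 ord_poly_add[of "a * d" "c * b" P] by (simp add: ord_Fract ord_poly_mult)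
qed

lemma val_ge_0 [simp]: "val_ge P n 0"
  by (simp add: val_ge_def)

lemma val_ge_iff: "f \<noteq> 0 \<Longrightarrow> val_ge P n f \<longleftrightarrow> n \<le> ord P f"
  by (simp add: val_ge_def)

lemma val_ge_mono: "val_ge P n f \<Longrightarrow> m \<le> n \<Longrightarrow> val_ge P m f"
  by (auto simp: val_ge_def)

lemma val_ge_add: "val_ge P n f \<Longrightarrow> val_ge P n g \<Longrightarrow> val_ge P n (f + g)"
  using ord_add[of f g P] by (cases "f = 0 \<or> g = 0 \<or> f + g = 0") (auto simp: val_ge_def)

lemma val_ge_uminus [simp]: "val_ge P n (- f) \<longleftrightarrow> val_ge P n f"
  by (simp add: val_ge_def)

lemma val_ge_diff: "val_ge P n f \<Longrightarrow> val_ge P n g \<Longrightarrow> val_ge P n (f - g)"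
  using val_ge_add[of P n f "- g"] by simp

lemma val_ge_mult: "val_ge P m f \<Longrightarrow> val_ge P n g \<Longrightarrow> val_ge P (m + n) (f * g)"
  by (cases "f = 0 \<or> g = 0") (auto simp: val_ge_def ord_mult)

lemma val_ge_mult_iff: "f \<noteq> 0 \<Longrightarrow> val_ge P n (f * g) \<longleftrightarrow> val_ge P (n - ord P f) g"
  by (cases "g = 0") (auto simp: val_ge_def ord_mult)

lemma val_ge_mult0: "val_ge P 0 f \<Longrightarrow> val_ge P n g \<Longrightarrow> val_ge P n (f * g)"
  using val_ge_mult[of P 0 f n g] by simp

lemma val_ge_mult0': "val_ge P n f \<Longrightarrow> val_ge P 0 g \<Longrightarrow> val_ge P n (f * g)"
  using val_ge_mult[of P n f 0 g] by simp

lemma val_ge_sum: "(\<And>i. i \<in> I \<Longrightarrow> val_ge P n (f i)) \<Longrightarrow> val_ge P n (sum f I)"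
  by (induction I rule: infinite_finite_induct) (auto intro: val_ge_add)

lemma val_ge_one [simp]: "val_ge P 0 1"
  by (simp add: val_ge_iff)

lemma val_ge_const [simp]: "val_ge P 0 (to_fract [:c:])"
  by (cases "c = 0") (auto simp: val_ge_iff)

lemma val_ge_poly: "equation_of P \<noteq> None \<Longrightarrow> val_ge P 0 (to_fract a)"
  by (cases "a = 0") (auto simp: val_ge_iff ord_to_fract ord_poly_def)

lemma val_ge_poly_infinity:
  "equation_of P = None \<Longrightarrow> val_ge P n (to_fract a) \<longleftrightarrow> a = 0 \<or> n \<le> - int (degree a)"
  by (cases "a = 0") (auto simp: val_ge_iff ord_to_fract ord_poly_infinity)

section \<open>Closed points\<close>

lemma ex_infinity: "\<exists>P. equation_of P = None"
  using Abs_closed_point_inverse[of None] by blast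

lemma equation_of_inject2: "equation_of P = equation_of Q \<Longrightarrow> P = Q"
  by (simp add: equation_of_inject)

lemma ex_finite_point:
  assumes "irreducible p" "lead_coeff p = 1"
  shows "\<exists>P. equation_of P = Some p"
  using Abs_closed_point_inverse[of "Some p"] assms by blast

lemma irreducible_linear_monic: "irreducible [:-a, 1::'a::field:]"
  by (rule irreducible_linear_field_poly) simp

lemma ex_linear_point: "\<exists>P. equation_of P = Some [:-a, 1::'a::field:]"
  by (rule ex_finite_point) (auto simp: irreducible_linear_monic)

lemma ord_poly_eq_0_iff:
  assumes "equation_of P = Some p" "a \<noteq> 0"
  shows "ord_poly P a = 0 \<longleftrightarrow> \<not> p dvd a"
proof
  assume 0: "ord_poly P a = 0"
  obtain k b where a: "a = p ^ k * b" "\<not> p dvd b"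
    by (rule prime_power_decomposition[OF equation_of_SomeD(5)[OF assms(1)] assms(2)])
  with 0 show "\<not> p dvd a" using ord_poly_eqI[OF assms(1) a] by simp
next
  assume "\<not> p dvd a"
  then show "ord_poly P a = 0" using ord_poly_eqI[OF assms(1), of a 0 a] by simp
qed

lemma irreducible_monic_dvd_eq:
  fixes p q :: "'a::field poly"
  assumes "irreducible p" "irreducible q" "lead_coeff p = 1" "lead_coeff q = 1" "p dvd q"
  shows "p = q"
proof -
  obtain c where c: "q = p * c" using assms(5) by blast
  then have "c dvd 1" using assms(1,2) irreducible_def by (metis irreducibleD)
  then obtain d where d: "c = [:d:]" using is_unit_polyE by blast
  have "lead_coeff q = lead_coeff p * lead_coeff c" using c by (simp add: lead_coeff_mult)
  then have "d = 1" using d assms by simp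
  then show ?thesis using c d by simp
qed

lemma ord_equation_self:
  assumes "equation_of P = Some p" shows "ord P (to_fract p) = 1"
proof -
  note p = equation_of_SomeD[OF assms]
  have "\<not> p dvd 1" using p(1) by (simp add: irreducible_def)
  then show ?thesis using ord_poly_eqI[OF assms, of p 1 1] p by (simp add: ord_to_fract)
qed

lemma ord_equation_other:
  assumes "equation_of P = Some p" "equation_of Q = Some q" "P \<noteq> Q" shows "ord Q (to_fract p) = 0"
proof -
  note p = equation_of_SomeD[OF assms(1)] and q = equation_of_SomeD[OF assms(2)]
  have "\<not> q dvd p" using irreducible_monic_dvd_eq[of q p] p q assms equation_of_inject2 by metis
  then show ?thesis using ord_poly_eq_0_iff[OF assms(2)] p by (simp add: ord_to_fract)
qed

lemma ord_variable_infinity: "equation_of P = None \<Longrightarrow> ord P (to_fract [:0,1::'a::field:]) = -1"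
  by (simp add: ord_to_fract ord_poly_infinity)

lemma ex_uniformizer: "\<exists>f::'a::field ratfun. f \<noteq> 0 \<and> ord P f = 1"
proof (cases P rule: equation_of_cases)
  case 1
  have "inverse (to_fract [:0,1::'a:]) \<noteq> 0 \<and> ord P (inverse (to_fract [:0,1::'a:])) = 1"
    using ord_variable_infinity[OF 1] by (simp add: ord_inverse)
  then show ?thesis by blast
next
  case (2 p)
  then show ?thesis using ord_equation_self equation_of_SomeD(3)[OF 2(1)] by (metis to_fract_eq_0_iff)
qed

definition uniformizer :: "'a::field closed_point \<Rightarrow> 'a ratfun" where
  "uniformizer P = (SOME f. f \<noteq> 0 \<and> ord P f = 1)"

lemma uniformizer [simp]: "uniformizer P \<noteq> 0" "ord P (uniformizer P) = 1"
  using someI_ex[OF ex_uniformizer[of P]] by (auto simp: uniformizer_def)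

lemma finite_ord_poly_support: "a \<noteq> 0 \<Longrightarrow> finite {P. ord_poly P (a::'a::field poly) \<noteq> 0}"
proof (induction "degree a" arbitrary: a rule: less_induct)
  case less
  show ?case
  proof (cases "\<exists>P p. equation_of P = Some p \<and> p dvd a")
    case True
    then obtain P p b where P: "equation_of P = Some p" and a: "a = p * b" by blast
    note p = equation_of_SomeD[OF P]
    have b: "b \<noteq> 0" using a less.prems by auto
    then have "degree b < degree a" using a p by (simp add: degree_mult_eq)
    then have 1: "finite {P. ord_poly P b \<noteq> 0}" using less.hyps b by blast
    obtain P0 :: "'a closed_point" where P0: "equation_of P0 = None" using ex_infinity by blast
    have "{P. ord_poly P a \<noteq> 0} \<subseteq> {P. ord_poly P b \<noteq> 0} \<union> {P, P0}"
    proof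
      fix Q assume "Q \<in> {P. ord_poly P a \<noteq> 0}"
      then have s: "ord_poly Q p + ord_poly Q b \<noteq> 0" using a b p by (simp add: ord_poly_mult)
      have "ord_poly Q p = 0" if Q: "Q \<noteq> P" "Q \<noteq> P0"
      proof -
        obtain q where "equation_of Q = Some q"
          using Q P0 equation_of_inject2 by (metis option.exhaust)
        then show ?thesis using ord_equation_other[OF P] Q p(3) by (metis ord_to_fract)
      qed
      then show "Q \<in> {P. ord_poly P b \<noteq> 0} \<union> {P, P0}" using s by fastforce
    qed
    then show ?thesis using 1 finite_subset by (metis finite.emptyI finite_UnI finite_insert)
  next
    case False
    obtain P0 :: "'a closed_point" where P0: "equation_of P0 = None" using ex_infinity by blast
    have "{P. ord_poly P a \<noteq> 0} \<subseteq> {P0}"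
    proof
      fix Q assume Q: "Q \<in> {P. ord_poly P a \<noteq> 0}"
      then show "Q \<in> {P0}" using False ord_poly_eq_0_iff less.prems P0 equation_of_inject2
        by (metis (mono_tags, lifting) insertI1 mem_Collect_eq option.exhaust)
    qed
    then show ?thesis using finite_subset by blast
  qed
qed

lemma finite_ord_support:
  fixes f :: "'a::field ratfun"
  assumes "f \<noteq> 0" shows "finite {P. ord P f \<noteq> 0}"
proof -
  obtain a b where 1: "f = Fract a b" "a \<noteq> 0" "b \<noteq> 0" by (rule nonzero_Fract[OF assms(1)])
  have "{P. ord P f \<noteq> 0} \<subseteq> {P. ord_poly P a \<noteq> 0} \<union> {P. ord_poly P b \<noteq> 0}"
    using 1 by (auto simp: ord_Fract)
  then show ?thesis using finite_ord_poly_support 1 finite_subset by blast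
qed

lemma finite_not_integral: "finite {P. \<not> val_ge P 0 (f::'a::field ratfun)}"
proof (cases "f = 0")
  case False
  have "{P. \<not> val_ge P 0 f} \<subseteq> {P. ord P f \<noteq> 0}" using False by (auto simp: val_ge_iff)
  then show ?thesis using finite_ord_support[OF False] finite_subset by blast
qed auto

lemma integral_finite_imp_poly:
  fixes f :: "'a::field ratfun"
  assumes "\<And>P. equation_of P \<noteq> None \<Longrightarrow> val_ge P 0 f"
  obtains a where "f = to_fract a"
proof -
  have main: "\<exists>c. a = b * c"
    if "b \<noteq> 0" "a \<noteq> 0" "\<And>P. equation_of P \<noteq> None \<Longrightarrow> ord_poly P b \<le> ord_poly P a" for a b :: "'a poly"
    using that
  proof (induction "degree b" arbitrary: a b rule: less_induct)
    case less
    show ?case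
    proof (cases "\<exists>P p. equation_of P = Some p \<and> p dvd b")
      case True
      then obtain P p b' where P: "equation_of P = Some p" and b: "b = p * b'" by blast
      note p = equation_of_SomeD[OF P]
      have "ord_poly P b > 0"
        using less.prems ord_poly_eq_0_iff[OF P, of b] True b P by (auto simp: ord_poly_def)
      then have "ord_poly P a \<noteq> 0" using less.prems(3)[of P] P by auto
      then obtain a' where a: "a = p * a'" using ord_poly_eq_0_iff[OF P, of a] less.prems(2) by blast
      have nz: "a' \<noteq> 0" "b' \<noteq> 0" using a b less.prems by auto
      then have "degree b' < degree b" using b p by (simp add: degree_mult_eq)
      moreover have "ord_poly Q b' \<le> ord_poly Q a'" if "equation_of Q \<noteq> None" for Q
        using less.prems(3)[OF that] a b nz p(3) by (simp add: ord_poly_mult)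
      ultimately obtain c where "a' = b' * c" using less.hyps nz by blast
      then show ?thesis using a b by (metis mult.assoc)
    next
      case False
      have "degree b = 0"
      proof (rule ccontr)
        assume "degree b \<noteq> 0"
        then obtain q where "irreducible q" "lead_coeff q = 1" "q dvd b"
          using ex_monic_irreducible_dvd by blast
        then show False using False ex_finite_point by blast
      qed
      then obtain d where d: "b = [:d:]" by (metis degree_eq_zeroE)
      then have "a = b * smult (inverse d) a" using less.prems by simp
      then show ?thesis by blast
    qed
  qed
  show ?thesis
  proof (cases "f = 0")
    case True
    then show ?thesis using that[of 0] by simp
  next
    case False
    obtain a b where f: "f = Fract a b" "a \<noteq> 0" "b \<noteq> 0" by (rule nonzero_Fract[OF False])
    have "\<exists>c. a = b * c"
    proof (rule main)
      fix P :: "'a closed_point" assume "equation_of P \<noteq> None"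
      from assms[OF this] show "ord_poly P b \<le> ord_poly P a" using f False by (simp add: val_ge_iff ord_Fract)
    qed (use f in auto)
    then obtain c where "a = b * c" by blast
    then have "f = to_fract c" using f by (simp add: to_fract_def eq_fract)
    then show ?thesis using that by blast
  qed
qed

lemma polynomial_part:
  fixes f :: "'a::field ratfun"
  assumes P: "equation_of P = None"
  obtains a where "val_ge P 1 (f - to_fract a)"
proof (cases "f = 0")
  case True
  then show ?thesis using that[of 0] by simp
next
  case False
  then obtain a b where f: "f = Fract a b" "a \<noteq> 0" "b \<noteq> 0" by (rule nonzero_Fract)
  have eq: "f - to_fract (a div b) = Fract (a mod b) b"
    using f by (simp add: to_fract_def eq_fract algebra_simps minus_div_mult_eq_mod[symmetric])
  have "val_ge P 1 (Fract (a mod b) b)"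
  proof (cases "a mod b = 0")
    case True
    then show ?thesis by (simp add: fract_collapse)
  next
    case nz: False
    then have "degree (a mod b) < degree b" using degree_mod_less' f(3) by blast
    moreover have "Fract (a mod b) b \<noteq> 0" using nz f(3) by (simp add: Zero_fract_def eq_fract)
    ultimately show ?thesis using nz f(3) P by (simp add: val_ge_iff ord_Fract ord_poly_infinity)
  qed
  then show ?thesis using eq that by metis
qed

lemma global_function_constant:
  fixes f :: "'a::field ratfun"
  assumes "\<And>P. val_ge P 0 f"
  obtains c where "f = to_fract [:c:]"
proof -
  obtain a where a: "f = to_fract a" using integral_finite_imp_poly assms by blast
  obtain P :: "'a closed_point" where P: "equation_of P = None" using ex_infinity by blast
  have "degree a = 0" using assms[of P] a val_ge_poly_infinity[OF P, of 0 a] by auto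
  then show ?thesis using that a by (metis degree_eq_zeroE)
qed

lemma val_ge_1_const_iff [simp]: "val_ge P 1 (to_fract [:c:]) \<longleftrightarrow> c = 0"
  by (cases "c = 0") (auto simp: val_ge_iff)

lemma rational_point_cases:
  assumes "point_degree P = 1"
  obtains "equation_of P = None" | a where "equation_of P = Some [:- a, 1:]"
proof (cases P rule: equation_of_cases)
  case 1
  then show ?thesis using that by blast
next
  case (2 p)
  then have "degree p = 1" using assms by (simp add: point_degree_def)
  then obtain b c where "p = [:b, c:]" by (metis degree_eq_zeroE degree_pCons_eq_if One_nat_def nat.inject pCons_cases zero_neq_one)
  then have "p = [:- (- b), 1:]" using 2 \<open>degree p = 1\<close> by (auto split: if_splits)
  then show ?thesis using that(2) 2 by blast
qed

lemma val_ge_linear_point: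
  assumes "equation_of P = Some [:- a, 1:]" "poly f a = c"
  shows "val_ge P 1 (to_fract f - to_fract [:c:])"
proof -
  have "poly (f - [:c:]) a = 0" using assms by simp
  then obtain g where "f - [:c:] = [:- a, 1:] * g" using poly_eq_0_iff_dvd by blast
  then have eq: "to_fract f - to_fract [:c:] = to_fract [:- a, 1:] * to_fract g"
    by (metis to_fract_diff to_fract_mult)
  have "val_ge P 1 (to_fract [:- a, 1:])" using ord_equation_self[OF assms(1)] by (simp add: val_ge_iff)
  then show ?thesis unfolding eq using val_ge_poly assms by (intro val_ge_mult0') auto
qed

lemma residue_at_rational_point:
  assumes "point_degree P = 1" "val_ge P 0 f"
  obtains c where "val_ge P 1 (f - to_fract [:c:])"
proof (cases "val_ge P 1 f")
  case True
  then show ?thesis using that[of 0] by simp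
next
  case False
  then have f0: "f \<noteq> 0" and o: "ord P f = 0" using assms by (auto simp: val_ge_def)
  from f0 obtain a b where f: "f = Fract a b" "a \<noteq> 0" "b \<noteq> 0" by (rule nonzero_Fract)
  have nz: "to_fract b \<noteq> 0" using f by simp
  have fb: "f = to_fract a / to_fract b" using f by (simp add: to_fract_def)
  show ?thesis
    using assms(1)
  proof (cases P rule: rational_point_cases)
    case 1
    then have deg: "degree a = degree b" using o f by (simp add: ord_Fract ord_poly_infinity)
    define c where "c = lead_coeff a / lead_coeff b"
    define r where "r = a - smult c b"
    have "f - to_fract [:c:] = to_fract r / to_fract b"
      using nz fb by (simp add: r_def field_simps to_fract_mult[symmetric] del: to_fract_mult)
    moreover have "val_ge P 1 (to_fract r / to_fract b)"
    proof (cases "r = 0")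
      case False
      have "coeff r (degree b) = 0" using f by (simp add: r_def c_def deg)
      moreover have "degree r \<le> degree b" using deg unfolding r_def
        by (metis degree_diff_le degree_smult_le order_refl)
      ultimately have "degree r < degree b" using False
        by (metis le_neq_implies_less leading_coeff_0_iff)
      then show ?thesis using False f 1 by (simp add: val_ge_iff ord_divide ord_to_fract ord_poly_infinity)
    qed auto
    ultimately show ?thesis using that by metis
  next
    case (2 \<alpha>)
    have "ord_poly P a = ord_poly P b" using o f by (simp add: ord_Fract)
    obtain k b' where b: "b = [:- \<alpha>, 1:] ^ k * b'" "\<not> [:- \<alpha>, 1:] dvd b'"
      by (rule prime_power_decomposition[OF equation_of_SomeD(5)[OF 2] f(3)])
    obtain l a' where a: "a = [:- \<alpha>, 1:] ^ l * a'" "\<not> [:- \<alpha>, 1:] dvd a'"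
      by (rule prime_power_decomposition[OF equation_of_SomeD(5)[OF 2] f(2)])
    have "l = k" using ord_poly_eqI[OF 2 a] ord_poly_eqI[OF 2 b] \<open>ord_poly P a = ord_poly P b\<close> by simp
    have b'0: "b' \<noteq> 0" "poly b' \<alpha> \<noteq> 0" using b by (auto simp: poly_eq_0_iff_dvd)
    have fa: "f = to_fract a' / to_fract b'"
      using fb a b \<open>l = k\<close> f by (simp add: to_fract_mult)
    define c where "c = poly a' \<alpha> / poly b' \<alpha>"
    define r where "r = a' - smult c b'"
    have "poly r \<alpha> = 0" using b'0 by (simp add: r_def c_def)
    then have "val_ge P 1 (to_fract r)" using val_ge_linear_point[OF 2, of r 0] by simp
    moreover have "f - to_fract [:c:] = inverse (to_fract b') * to_fract r"
      using b'0 fa by (simp add: r_def field_simps to_fract_mult[symmetric] del: to_fract_mult)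
    moreover have "val_ge P 0 (inverse (to_fract b'))"
      using b'0 b ord_poly_eq_0_iff[OF 2, of b'] by (simp add: val_ge_iff ord_inverse ord_to_fract)
    ultimately show ?thesis using that val_ge_mult0 by metis
  qed
qed

section \<open>Lattices in the plane over the local rings\<close>

lemma matrix_inv_inverse:
  fixes g :: "'b::semiring_1^'n^'n"
  assumes "invertible g"
  shows "matrix_inv g ** g = mat 1" "g ** matrix_inv g = mat 1"
proof -
  have "g ** matrix_inv g = mat 1 \<and> matrix_inv g ** g = mat 1"
    unfolding matrix_inv_def by (rule someI_ex) (use assms in \<open>simp add: invertible_def\<close>)
  then show "matrix_inv g ** g = mat 1" "g ** matrix_inv g = mat 1" by auto
qed

lemma matrix_inv_unique:
  fixes g h :: "'b::semiring_1^'n^'n"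
  assumes "g ** h = mat 1" "h ** g = mat 1"
  shows "matrix_inv g = h" "invertible g"
proof -
  show i: "invertible g" using assms invertible_def by blast
  have "matrix_inv g = matrix_inv g ** (g ** h)" using assms by simp
  also have "\<dots> = h" using matrix_inv_inverse[OF i] by (simp add: matrix_mul_assoc)
  finally show "matrix_inv g = h" .
qed

lemma invertible_matrix_inv:
  fixes g :: "'b::semiring_1^'n^'n"
  assumes "invertible g" shows "invertible (matrix_inv g)" "matrix_inv (matrix_inv g) = g"
  using matrix_inv_unique[OF matrix_inv_inverse[OF assms]] by auto

lemma matrix_inv_mult:
  fixes g h :: "'b::semiring_1^'n^'n"
  assumes "invertible g" "invertible h"
  shows "matrix_inv (g ** h) = matrix_inv h ** matrix_inv g" "invertible (g ** h)"
proof -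
  have "(g ** h) ** (matrix_inv h ** matrix_inv g) = g ** (h ** matrix_inv h) ** matrix_inv g"
    "(matrix_inv h ** matrix_inv g) ** (g ** h) = matrix_inv h ** (matrix_inv g ** g) ** h"
    by (simp_all only: matrix_mul_assoc)
  then have "(g ** h) ** (matrix_inv h ** matrix_inv g) = mat 1" "(matrix_inv h ** matrix_inv g) ** (g ** h) = mat 1"
    using assms by (simp_all add: matrix_inv_inverse)
  then show "matrix_inv (g ** h) = matrix_inv h ** matrix_inv g" "invertible (g ** h)"
    using matrix_inv_unique by blast+
qed

lemma invertible_mat_1 [simp]: "invertible (mat 1 :: 'b::semiring_1^'n^'n)"
  and matrix_inv_mat_1 [simp]: "matrix_inv (mat 1 :: 'b::semiring_1^'n^'n) = mat 1"
  using matrix_inv_unique[of "mat 1" "mat 1"] by auto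

definition mat2 :: "'b \<Rightarrow> 'b \<Rightarrow> 'b \<Rightarrow> 'b \<Rightarrow> 'b^2^2" where
  "mat2 a b c d = (\<chi> i j. if i = 1 then (if j = 1 then a else b) else (if j = 1 then c else d))"

lemma mat2_nth [simp]:
  "mat2 a b c d $ 1 $ 1 = a" "mat2 a b c d $ 1 $ 2 = b" "mat2 a b c d $ 2 $ 1 = c" "mat2 a b c d $ 2 $ 2 = d"
  by (simp_all add: mat2_def)

lemma mat2_eqI:
  "A $ 1 $ 1 = B $ 1 $ 1 \<Longrightarrow> A $ 1 $ 2 = B $ 1 $ 2 \<Longrightarrow> A $ 2 $ 1 = B $ 2 $ 1 \<Longrightarrow> A $ 2 $ 2 = B $ 2 $ 2 \<Longrightarrow> A = (B :: 'b^2^2)"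
  by (simp add: vec_eq_iff forall_2)

lemma mat2_collapse: "A = mat2 (A $ 1 $ 1) (A $ 1 $ 2) (A $ 2 $ 1) (A $ 2 $ 2)"
  by (rule mat2_eqI) auto

lemma matrix_mult_nth_2: "(A ** B) $ i $ j = A $ i $ 1 * B $ 1 $ j + A $ i $ 2 * B $ 2 $ j"
  for A B :: "'b::semiring_1^2^2"
  by (simp add: matrix_matrix_mult_def sum_2)

lemma matrix_vector_mult_nth_2: "(A *v x) $ i = A $ i $ 1 * x $ 1 + A $ i $ 2 * x $ 2"
  for A :: "'b::semiring_1^2^2"
  by (simp add: matrix_vector_mult_def sum_2)

lemma mat_1_nth_2 [simp]: "(mat 1 :: 'b::semiring_1^2^2) $ 1 $ 1 = 1" "(mat 1 :: 'b^2^2) $ 1 $ 2 = 0"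
   "(mat 1 :: 'b^2^2) $ 2 $ 1 = 0" "(mat 1 :: 'b^2^2) $ 2 $ 2 = 1"
  by (simp_all add: mat_def)

lemma matrix_inv_mat2:
  fixes a b c d :: "'b::field"
  assumes "a * d - b * c \<noteq> 0"
  shows "matrix_inv (mat2 a b c d) = mat2 (d / (a * d - b * c)) (- b / (a * d - b * c)) (- c / (a * d - b * c)) (a / (a * d - b * c))"
    and "invertible (mat2 a b c d)"
proof -
  define D where "D = a * d - b * c"
  let ?h = "mat2 (d / D) (- b / D) (- c / D) (a / D)"
  have e: "x / D - y / D = 1" if "x - y = D" for x y
    using that assms by (metis D_def diff_divide_distrib divide_self)
  have "mat2 a b c d ** ?h = mat 1"
    by (rule mat2_eqI) (use e[of "a * d" "b * c"] in \<open>simp_all add: D_def matrix_mult_nth_2 mult.commute\<close>)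
  moreover have "?h ** mat2 a b c d = mat 1"
    by (rule mat2_eqI) (use e[of "a * d" "b * c"] in \<open>simp_all add: D_def matrix_mult_nth_2 mult.commute\<close>)
  ultimately show "matrix_inv (mat2 a b c d) = mat2 (d / (a * d - b * c)) (- b / (a * d - b * c)) (- c / (a * d - b * c)) (a / (a * d - b * c))"
    "invertible (mat2 a b c d)"
    using matrix_inv_unique unfolding D_def by blast+
qed

definition matrix_conj :: "'b::semiring_1^'n^'n \<Rightarrow> 'b^'n^'n \<Rightarrow> 'b^'n^'n" where
  "matrix_conj g a = matrix_inv g ** a ** g"

lemma conj_mult: "invertible g \<Longrightarrow> invertible k \<Longrightarrow> matrix_conj (g ** k) a = matrix_conj k (matrix_conj g a)"
  by (simp add: matrix_conj_def matrix_inv_mult matrix_mul_assoc)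

lemma conj_mat_1 [simp]: "matrix_conj (mat 1) a = a"
  by (simp add: matrix_conj_def)

lemma conj_matrix_inv: "invertible g \<Longrightarrow> matrix_conj (matrix_inv g) (matrix_conj g a) = a"
  "invertible g \<Longrightarrow> matrix_conj g (matrix_conj (matrix_inv g) a) = a"
  using conj_mult[of g "matrix_inv g" a] conj_mult[of "matrix_inv g" g a]
  by (auto simp: invertible_matrix_inv matrix_inv_inverse)

lemma conj_product: "invertible g \<Longrightarrow> matrix_conj g (a ** b) = matrix_conj g a ** matrix_conj g b"
proof -
  assume g: "invertible g"
  have "matrix_conj g a ** matrix_conj g b = matrix_inv g ** a ** (g ** matrix_inv g) ** b ** g"
    by (simp only: matrix_conj_def matrix_mul_assoc)
  then show ?thesis using g by (simp add: matrix_conj_def matrix_inv_inverse matrix_mul_assoc)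
qed

definition intvec :: "'a::field closed_point \<Rightarrow> 'a ratfun^'n \<Rightarrow> bool" where
  "intvec P x \<longleftrightarrow> (\<forall>i. val_ge P 0 (x $ i))"

definition intmat :: "'a::field closed_point \<Rightarrow> 'a ratfun^'n^'m \<Rightarrow> bool" where
  "intmat P A \<longleftrightarrow> (\<forall>i j. val_ge P 0 (A $ i $ j))"

definition unimod :: "'a::field closed_point \<Rightarrow> 'a ratfun^'n^'n \<Rightarrow> bool" where
  "unimod P k \<longleftrightarrow> invertible k \<and> intmat P k \<and> intmat P (matrix_inv k)"

lemma intmat_2: "intmat P (A::'a::field ratfun^2^2) \<longleftrightarrow> val_ge P 0 (A $ 1 $ 1) \<and> val_ge P 0 (A $ 1 $ 2)
    \<and> val_ge P 0 (A $ 2 $ 1) \<and> val_ge P 0 (A $ 2 $ 2)"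
  by (auto simp: intmat_def forall_2)

lemma intvec_2: "intvec P (x::'a::field ratfun^2) \<longleftrightarrow> val_ge P 0 (x $ 1) \<and> val_ge P 0 (x $ 2)"
  by (simp add: intvec_def forall_2)

lemma intmat_mult: "intmat P A \<Longrightarrow> intmat P B \<Longrightarrow> intmat P (A ** B)"
  by (auto simp: intmat_def matrix_matrix_mult_def intro!: val_ge_sum val_ge_mult0)

lemma intmat_vector: "intmat P A \<Longrightarrow> intvec P x \<Longrightarrow> intvec P (A *v x)"
  by (auto simp: intmat_def intvec_def matrix_vector_mult_def intro!: val_ge_sum val_ge_mult0)

lemma intmat_mat_1 [simp]: "intmat P (mat 1)"
  by (simp add: intmat_def mat_def)

lemma unimodD: "unimod P k \<Longrightarrow> invertible k" "unimod P k \<Longrightarrow> intmat P k" "unimod P k \<Longrightarrow> intmat P (matrix_inv k)"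
  by (auto simp: unimod_def)

lemma unimod_mat_1 [simp]: "unimod P (mat 1)"
  by (simp add: unimod_def)

lemma unimod_mult: "unimod P k \<Longrightarrow> unimod P l \<Longrightarrow> unimod P (k ** l)"
  by (auto simp: unimod_def matrix_inv_mult intmat_mult)

lemma unimod_matrix_inv: "unimod P k \<Longrightarrow> unimod P (matrix_inv k)"
  by (auto simp: unimod_def invertible_matrix_inv)

lemma intmat_conj: "unimod P k \<Longrightarrow> intmat P (matrix_conj k a) \<longleftrightarrow> intmat P a"
proof -
  have 1: "intmat P (matrix_conj k a)" if "unimod P k" "intmat P a" for k a
    using that by (auto simp: matrix_conj_def unimod_def intro!: intmat_mult)
  assume "unimod P k"
  then show ?thesis using 1 by (metis conj_matrix_inv(1) unimodD(1) unimod_matrix_inv)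
qed

lemma unimod_mat2:
  assumes "val_ge P 0 a" "val_ge P 0 b" "val_ge P 0 c" "val_ge P 0 d"
    "a * d - b * c \<noteq> 0" "ord P (a * d - b * c) = 0"
  shows "unimod P (mat2 a b c d)"
proof -
  have "val_ge P 0 (x / (a * d - b * c))" if "val_ge P 0 x" for x
    using that assms by (simp add: divide_inverse val_ge_mult0' val_ge_iff ord_inverse)
  then show ?thesis using assms by (simp add: unimod_def matrix_inv_mat2 intmat_2)
qed

definition lat :: "'a::field closed_point \<Rightarrow> 'a ratfun^'n^'n \<Rightarrow> ('a ratfun^'n) set" where
  "lat P g = {x. intvec P (matrix_inv g *v x)}"

lemma intmat_columns: "intmat P A \<longleftrightarrow> (\<forall>j. intvec P (column j A))"
  by (auto simp: intmat_def intvec_def column_def)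

lemma matrix_mult_column: "A *v column j B = column j (A ** B)"
  by (simp add: column_def matrix_vector_mult_def matrix_matrix_mult_def vec_eq_iff)

lemma column_in_lat:
  fixes g :: "'a::field ratfun^'n^'n"
  shows "invertible g \<Longrightarrow> column j g \<in> lat P g"
  unfolding lat_def using intmat_columns[of P "mat 1 :: 'a ratfun^'n^'n"] by (simp add: matrix_mult_column matrix_inv_inverse)

lemma lat_subset_iff:
  assumes "invertible g" "invertible h"
  shows "lat P g \<subseteq> lat P h \<longleftrightarrow> intmat P (matrix_inv h ** g)"
proof
  assume "lat P g \<subseteq> lat P h"
  then have "column j g \<in> lat P h" for j using column_in_lat[OF assms(1)] by blast
  then show "intmat P (matrix_inv h ** g)"
    by (simp add: intmat_columns lat_def matrix_mult_column)
next
  assume i: "intmat P (matrix_inv h ** g)"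
  show "lat P g \<subseteq> lat P h"
  proof
    fix x assume "x \<in> lat P g"
    then have "intvec P (matrix_inv g *v x)" by (simp add: lat_def)
    then have "intvec P ((matrix_inv h ** g) *v (matrix_inv g *v x))" using intmat_vector i by blast
    moreover have "(matrix_inv h ** g) *v (matrix_inv g *v x) = matrix_inv h *v x"
    proof -
      have "(matrix_inv h ** g) *v (matrix_inv g *v x) = (matrix_inv h ** (g ** matrix_inv g)) *v x"
        by (simp only: matrix_vector_mul_assoc matrix_mul_assoc)
      then show ?thesis using assms by (simp add: matrix_inv_inverse)
    qed
    ultimately show "x \<in> lat P h" by (simp add: lat_def)
  qed
qed

lemma lat_eq_iff:
  assumes "invertible g" "invertible h"
  shows "lat P g = lat P h \<longleftrightarrow> unimod P (matrix_inv g ** h)"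
proof -
  have "matrix_inv (matrix_inv g ** h) = matrix_inv h ** g" "invertible (matrix_inv g ** h)"
    using assms by (simp_all add: matrix_inv_mult invertible_matrix_inv)
  then show ?thesis using lat_subset_iff assms by (metis set_eq_subset unimod_def)
qed

lemma lat_stable_iff:
  assumes g: "invertible g"
  shows "(\<forall>x\<in>lat P g. a *v x \<in> lat P g) \<longleftrightarrow> intmat P (matrix_conj g a)"
proof
  assume "\<forall>x\<in>lat P g. a *v x \<in> lat P g"
  then have "a *v column j g \<in> lat P g" for j using column_in_lat[OF g] by blast
  then show "intmat P (matrix_conj g a)"
    by (simp add: intmat_columns lat_def matrix_mult_column matrix_conj_def matrix_mul_assoc)
next
  assume i: "intmat P (matrix_conj g a)"
  show "\<forall>x\<in>lat P g. a *v x \<in> lat P g"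
  proof
    fix x assume "x \<in> lat P g"
    then have "intvec P (matrix_conj g a *v (matrix_inv g *v x))" using i by (simp add: lat_def intmat_vector)
    moreover have "matrix_conj g a *v (matrix_inv g *v x) = matrix_inv g *v (a *v x)"
    proof -
      have "matrix_conj g a *v (matrix_inv g *v x) = (matrix_inv g ** a ** (g ** matrix_inv g)) *v x"
        by (simp only: matrix_conj_def matrix_vector_mul_assoc matrix_mul_assoc)
      then show ?thesis using g by (simp add: matrix_inv_inverse matrix_vector_mul_assoc)
    qed
    ultimately show "a *v x \<in> lat P g" by (simp add: lat_def)
  qed
qed

lemma finite_not_intmat: "finite {P. \<not> intmat P A}"
proof -
  have "{P. \<not> intmat P A} = (\<Union>i\<in>UNIV. \<Union>j\<in>UNIV. {P. \<not> val_ge P 0 (A $ i $ j)})"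
    by (auto simp: intmat_def)
  then show ?thesis by (simp add: finite_not_integral)
qed

lemma finite_not_unimod: "invertible g \<Longrightarrow> finite {P. \<not> unimod P g}"
proof -
  assume "invertible g"
  then have "{P. \<not> unimod P g} = {P. \<not> intmat P g} \<union> {P. \<not> intmat P (matrix_inv g)}" by (auto simp: unimod_def)
  then show ?thesis by (simp add: finite_not_intmat)
qed

lemma finite_lat_neq_1:
  assumes "invertible g" shows "finite {P. lat P g \<noteq> lat P (mat 1)}"
proof -
  have "{P. lat P g \<noteq> lat P (mat 1)} \<subseteq> {P. \<not> unimod P g}"
    using lat_eq_iff[of "mat 1" g] assms by auto
  then show ?thesis using finite_not_unimod[OF assms] finite_subset by blast
qed

lemma finite_not_in_lat:
  assumes "finite {P. g P \<noteq> mat 1}" shows "finite {P. x \<notin> lat P (g P)}"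
proof -
  have "{P. x \<notin> lat P (g P)} \<subseteq> {P. g P \<noteq> mat 1} \<union> (\<Union>i. {P. \<not> val_ge P 0 (x $ i)})"
    by (auto simp: lat_def intvec_def)
  moreover have "finite (\<Union>i. {P. \<not> val_ge P 0 (x $ i)})" by (simp add: finite_not_integral)
  ultimately show ?thesis using assms finite_subset by blast
qed

section \<open>Bundles and orders from local data\<close>

definition lattice_sheaf :: "('a::field closed_point \<Rightarrow> 'a ratfun^2^2) \<Rightarrow> 'a closed_point set \<Rightarrow> ('a ratfun^2) set" where
  "lattice_sheaf g U = {x. \<forall>P\<in>U. x \<in> lat P (g P)}"

definition local_family :: "('a::field closed_point \<Rightarrow> 'a ratfun^2^2) \<Rightarrow> bool" where
  "local_family g \<longleftrightarrow> (\<forall>P. invertible (g P)) \<and> finite {P. g P \<noteq> mat 1}"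

definition vec2 :: "'b \<Rightarrow> 'b \<Rightarrow> 'b^2" where
  "vec2 a b = (\<chi> i. if i = 1 then a else b)"

lemma vec2_nth [simp]: "vec2 a b $ 1 = a" "vec2 a b $ 2 = b"
  by (simp_all add: vec2_def)

lemma vec2_eqI: "x $ 1 = y $ 1 \<Longrightarrow> x $ 2 = y $ 2 \<Longrightarrow> x = (y :: 'b^2)"
  by (simp add: vec_eq_iff forall_2)

lemma lessThan_2: "{..<2::nat} = {0, 1}"
  by auto

definition basis_mat :: "(nat \<Rightarrow> 'b^2) \<Rightarrow> 'b^2^2" where
  "basis_mat e = mat2 (e 0 $ 1) (e 1 $ 1) (e 0 $ 2) (e 1 $ 2)"

lemma basis_mat_vec2:
  fixes e :: "nat \<Rightarrow> 'b::comm_ring_1^2"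
  shows "(\<Sum>i<2. c i *s e i) = basis_mat e *v vec2 (c 0) (c 1)"
  by (rule vec2_eqI) (simp_all add: lessThan_2 basis_mat_def matrix_vector_mult_nth_2 mult.commute)

lemma structure_sheaf_iff: "f \<in> structure_sheaf U \<longleftrightarrow> (\<forall>P\<in>U. val_ge P 0 f)"
  by (simp add: div_sheaf_def)

lemma basis_mat_invertible_iff:
  fixes e :: "nat \<Rightarrow> 'b::field^2"
  shows "(\<forall>c. (\<Sum>i<2. c i *s e i) = 0 \<longrightarrow> (\<forall>i<2. c i = 0)) \<longleftrightarrow> invertible (basis_mat e)"
proof -
  have "(\<forall>c. (\<Sum>i<2. c i *s e i) = 0 \<longrightarrow> (\<forall>i<2. c i = 0)) \<longleftrightarrow> (\<forall>x. basis_mat e *v x = 0 \<longrightarrow> x = 0)"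
  proof (intro iffI allI impI)
    fix x assume *: "\<forall>c. (\<Sum>i<2. c i *s e i) = 0 \<longrightarrow> (\<forall>i<2. c i = 0)" "basis_mat e *v x = 0"
    have "x = vec2 (x $ 1) (x $ 2)" by (rule vec2_eqI) auto
    then have "(\<Sum>i<2. (if i = 0 then x $ 1 else x $ 2) *s e i) = 0"
      unfolding basis_mat_vec2 using * by simp
    then have "\<forall>i<2. (if i = (0::nat) then x $ 1 else x $ 2) = 0"
      using spec[OF *(1), of "\<lambda>i. if i = 0 then x $ 1 else x $ 2"] by blast
    from this[rule_format, of 0] this[rule_format, of 1] show "x = 0" by (intro vec2_eqI) auto
  next
    fix c :: "nat \<Rightarrow> 'b" and i :: nat
    assume *: "\<forall>x. basis_mat e *v x = 0 \<longrightarrow> x = 0" "(\<Sum>i<2. c i *s e i) = 0" "i < 2"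
    then have "vec2 (c 0) (c 1) = 0" unfolding basis_mat_vec2 by blast
    then have "c 0 = 0" "c 1 = 0" by (metis vec2_nth zero_index)+
    then show "c i = 0" using *(3) by (cases "i = 0") (auto simp: less_2_cases_iff)
  qed
  also have "\<dots> \<longleftrightarrow> invertible (basis_mat e)"
    by (simp add: invertible_left_inverse matrix_left_invertible_ker)
  finally show ?thesis .
qed

lemma span_basis_mat:
  fixes e :: "nat \<Rightarrow> 'a::field ratfun^2"
  assumes inv: "invertible (basis_mat e)"
  shows "{\<Sum>i<2. c i *s e i | c. \<forall>i<2. c i \<in> structure_sheaf V} = {x. \<forall>P\<in>V. x \<in> lat P (basis_mat e)}"
    (is "?L = ?R")
proof (intro equalityI subsetI)
  fix x assume "x \<in> ?L"
  then obtain c where c: "x = (\<Sum>i<2. c i *s e i)" "\<forall>i<2. c i \<in> structure_sheaf V" by blast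
  have "matrix_inv (basis_mat e) *v x = vec2 (c 0) (c 1)"
    unfolding c(1) basis_mat_vec2 using inv by (simp add: matrix_vector_mul_assoc matrix_inv_inverse)
  then show "x \<in> ?R" using c(2) by (auto simp: lat_def intvec_2 structure_sheaf_iff)
next
  fix x assume x: "x \<in> ?R"
  define y where "y = matrix_inv (basis_mat e) *v x"
  define c where "c = (\<lambda>i::nat. if i = 0 then y $ 1 else y $ 2)"
  have "vec2 (c 0) (c 1) = y" by (rule vec2_eqI) (auto simp: c_def)
  then have "(\<Sum>i<2. c i *s e i) = x"
    unfolding basis_mat_vec2 y_def using inv by (simp add: matrix_vector_mul_assoc matrix_inv_inverse)
  moreover have "\<forall>i<2. c i \<in> structure_sheaf V"
    using x by (auto simp: c_def structure_sheaf_iff lat_def intvec_2 y_def)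
  ultimately show "x \<in> ?L" by blast
qed

lemma lat_zero: "0 \<in> lat P (g :: 'a::field ratfun^2^2)"
  by (simp add: lat_def intvec_def)

lemma lat_add: "x \<in> lat P g \<Longrightarrow> y \<in> lat P g \<Longrightarrow> x + y \<in> lat P (g :: 'a::field ratfun^2^2)"
  by (auto simp: lat_def intvec_def matrix_vector_right_distrib intro: val_ge_add)

lemma matrix_vector_smult_2: "A *v (c *s x) = c *s (A *v x)" for A :: "'b::comm_ring_1^2^2"
  by (rule vec2_eqI) (simp_all add: matrix_vector_mult_nth_2 algebra_simps)

lemma lat_smult: "val_ge P 0 c \<Longrightarrow> x \<in> lat P g \<Longrightarrow> c *s x \<in> lat P (g :: 'a::field ratfun^2^2)"
  by (auto simp: lat_def intvec_def matrix_vector_smult_2 intro: val_ge_mult0)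

lemma module_sheaf_lattice_sheaf: "module_sheaf (*s) (lattice_sheaf g)"
  unfolding module_sheaf_def subsheaf_def
  by (auto simp: lattice_sheaf_def structure_sheaf_iff lat_zero lat_add lat_smult)

lemma zopen_UNIV [simp]: "zopen UNIV"
  by (simp add: zopen_def)

lemma zopen_Int: "zopen U \<Longrightarrow> zopen V \<Longrightarrow> zopen (U \<inter> V)"
  by (simp add: zopen_def Compl_Int)

lemma zopen_mono: "zopen U \<Longrightarrow> U \<subseteq> V \<Longrightarrow> zopen V"
  unfolding zopen_def by (meson Compl_anti_mono finite_subset)

lemma zopen_Collect: "finite {P. \<not> Q P} \<Longrightarrow> zopen {P. Q P}"
  by (simp add: zopen_def Collect_neg_eq)

lemma zopen_insert: "zopen U \<Longrightarrow> zopen (insert P U)"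
  by (rule zopen_mono) auto

lemma plane_bundle_lattice_sheaf:
  fixes g :: "'a::field closed_point \<Rightarrow> 'a ratfun^2^2"
  assumes g: "local_family g"
  shows "plane_bundle (lattice_sheaf g)"
proof -
  have inv: "invertible (g P)" for P using g by (auto simp: local_family_def)
  have fin: "finite {Q. g Q \<noteq> mat 1}" using g by (auto simp: local_family_def)
  have "\<exists>U e. zopen U \<and> P \<in> U \<and> (\<forall>c. (\<Sum>i<2::nat. c i *s e i) = 0 \<longrightarrow> (\<forall>i<2. c i = 0)) \<and>
     (\<forall>V. zopen V \<and> V \<subseteq> U \<longrightarrow> lattice_sheaf g V = {\<Sum>i<2::nat. c i *s e i |c. \<forall>i<2. c i \<in> structure_sheaf V})" for P
  proof -
    define U where "U = insert P ({Q. g Q = mat 1} \<inter> {Q. lat Q (g P) = lat Q (mat 1)})"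
    define e where "e = (\<lambda>i::nat. column (if i = 0 then 1 else 2) (g P))"
    have b: "basis_mat e = g P" by (rule mat2_eqI) (simp_all add: basis_mat_def e_def column_def)
    have "zopen {Q. g Q = mat 1}" using fin by (rule zopen_Collect)
    moreover have "zopen {Q. lat Q (g P) = lat Q (mat 1)}" by (rule zopen_Collect) (rule finite_lat_neq_1[OF inv])
    ultimately have U: "zopen U" "P \<in> U" unfolding U_def by (auto intro!: zopen_insert zopen_Int)
    have e: "lat Q (g Q) = lat Q (g P)" if "Q \<in> U" for Q
    proof (cases "Q = P")
      case False
      then have "g Q = mat 1" "lat Q (g P) = lat Q (mat 1)" using that by (simp_all add: U_def)
      then show ?thesis by (simp only:)
    qed (simp only:)
    have "lattice_sheaf g V = {\<Sum>i<2::nat. c i *s e i |c. \<forall>i<2. c i \<in> structure_sheaf V}" if V: "V \<subseteq> U" for V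
    proof -
      have "lattice_sheaf g V = {x. \<forall>P'\<in>V. x \<in> lat P' (g P)}"
        unfolding lattice_sheaf_def using V e by blast
      also have "\<dots> = {\<Sum>i<2::nat. c i *s e i |c. \<forall>i<2. c i \<in> structure_sheaf V}"
        using span_basis_mat[of e V] inv b by simp
      finally show ?thesis .
    qed
    then have L: "\<forall>V. zopen V \<and> V \<subseteq> U \<longrightarrow> lattice_sheaf g V = {\<Sum>i<2::nat. c i *s e i |c. \<forall>i<2. c i \<in> structure_sheaf V}"
      by blast
    have "\<forall>c. (\<Sum>i<2::nat. c i *s e i) = 0 \<longrightarrow> (\<forall>i<2. c i = 0)"
      using basis_mat_invertible_iff[of e] inv[of P] b by metis
    then show ?thesis by (intro exI[of _ U] exI[of _ e] conjI U L)
  qed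
  note ex = this
  show ?thesis
    unfolding plane_bundle_def vector_bundle_def by (intro conjI allI module_sheaf_lattice_sheaf ex)
qed

lemma plane_bundleE:
  assumes "plane_bundle \<Lambda>"
  obtains g where "local_family g" "\<And>U. zopen U \<Longrightarrow> \<Lambda> U = lattice_sheaf g U"
proof -
  have "\<forall>P. \<exists>U h. zopen U \<and> P \<in> U \<and> invertible h \<and>
      (\<forall>V. zopen V \<and> V \<subseteq> U \<longrightarrow> \<Lambda> V = {x. \<forall>Q\<in>V. x \<in> lat Q h})"
  proof
    fix P
    have "\<forall>P. \<exists>U e. zopen U \<and> P \<in> U \<and> (\<forall>c. (\<Sum>i<2::nat. c i *s e i) = 0 \<longrightarrow> (\<forall>i<2. c i = 0)) \<and>
      (\<forall>V. zopen V \<and> V \<subseteq> U \<longrightarrow> \<Lambda> V = {\<Sum>i<2::nat. c i *s e i | c. \<forall>i<2. c i \<in> structure_sheaf V})"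
      using assms unfolding plane_bundle_def vector_bundle_def by (rule conjunct2)
    from spec[OF this, of P]
    obtain U e where U: "zopen U" "P \<in> U" "\<forall>c. (\<Sum>i<2::nat. c i *s e i) = 0 \<longrightarrow> (\<forall>i<2. c i = 0)"
      "\<forall>V. zopen V \<and> V \<subseteq> U \<longrightarrow> \<Lambda> V = {\<Sum>i<2::nat. c i *s e i | c. \<forall>i<2. c i \<in> structure_sheaf V}"
      by (elim exE conjE) (rule that)
    have inv: "invertible (basis_mat e)" using U(3) unfolding basis_mat_invertible_iff .
    show "\<exists>U h. zopen U \<and> P \<in> U \<and> invertible h \<and>
      (\<forall>V. zopen V \<and> V \<subseteq> U \<longrightarrow> \<Lambda> V = {x. \<forall>Q\<in>V. x \<in> lat Q h})"
    proof (intro exI[of _ U] exI[of _ "basis_mat e"] conjI U(1,2) inv)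
      show "\<forall>V. zopen V \<and> V \<subseteq> U \<longrightarrow> \<Lambda> V = {x. \<forall>Q\<in>V. x \<in> lat Q (basis_mat e)}"
        using U(4) unfolding span_basis_mat[OF inv] .
    qed
  qed
  from choice[OF this] obtain W where "\<forall>P. \<exists>h. zopen (W P) \<and> P \<in> W P \<and> invertible h \<and>
      (\<forall>V. zopen V \<and> V \<subseteq> W P \<longrightarrow> \<Lambda> V = {x. \<forall>Q\<in>V. x \<in> lat Q h})" ..
  from choice[OF this] obtain h where Wh: "\<forall>P. zopen (W P) \<and> P \<in> W P \<and> invertible (h P) \<and>
      (\<forall>V. zopen V \<and> V \<subseteq> W P \<longrightarrow> \<Lambda> V = {x. \<forall>Q\<in>V. x \<in> lat Q (h P)})" ..
  have W: "zopen (W P)" "P \<in> W P" "invertible (h P)"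
    "zopen V \<Longrightarrow> V \<subseteq> W P \<Longrightarrow> \<Lambda> V = {x. \<forall>Q\<in>V. x \<in> lat Q (h P)}" for P V
    using spec[OF Wh, of P] by simp_all
  have sub: "lat Q (h P) \<subseteq> lat Q (h P')" if "Q \<in> W P" "Q \<in> W P'" for P P' Q
  proof
    fix x assume x: "x \<in> lat Q (h P)"
    define V where "V = insert Q (W P \<inter> W P' \<inter> {R. intvec R (matrix_inv (h P) *v x)})"
    have "finite {R. \<not> intvec R (matrix_inv (h P) *v x)}"
      using finite_not_in_lat[of "\<lambda>_. mat 1" "matrix_inv (h P) *v x"] by (simp add: lat_def)
    then have z: "zopen V" unfolding V_def by (intro zopen_insert zopen_Int zopen_Collect W(1))
    have "V \<subseteq> W P" "V \<subseteq> W P'" using that by (auto simp: V_def)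
    then have "{x. \<forall>Q\<in>V. x \<in> lat Q (h P)} = {x. \<forall>Q\<in>V. x \<in> lat Q (h P')}"
      using W(4)[OF z, of P] W(4)[OF z, of P'] by simp
    moreover have "x \<in> {x. \<forall>Q\<in>V. x \<in> lat Q (h P)}" using x by (auto simp: V_def lat_def)
    ultimately have "x \<in> {x. \<forall>Q\<in>V. x \<in> lat Q (h P')}" by (simp only:)
    then show "x \<in> lat Q (h P')" by (simp add: V_def)
  qed
  define g where "g = (\<lambda>P. if lat P (h P) = lat P (mat 1) then mat 1 else h P)"
  have latg: "lat P (g P) = lat P (h P)" for P by (simp add: g_def)
  have "\<Lambda> U = lattice_sheaf g U" if U: "zopen U" for U
  proof -
    have "subsheaf \<Lambda>" using assms by (simp add: plane_bundle_def vector_bundle_def module_sheaf_def)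
    moreover have "range (\<lambda>P. U \<inter> W P) \<noteq> {}" "\<forall>V\<in>range (\<lambda>P. U \<inter> W P). zopen V"
      using U W(1) by (auto intro: zopen_Int)
    ultimately have "\<Lambda> (\<Union>(range (\<lambda>P. U \<inter> W P))) = (\<Inter>V\<in>range (\<lambda>P. U \<inter> W P). \<Lambda> V)"
      unfolding subsheaf_def by blast
    moreover have "\<Union>(range (\<lambda>P. U \<inter> W P)) = U" using W(2) by auto
    ultimately have "\<Lambda> U = (\<Inter>P. \<Lambda> (U \<inter> W P))" by simp
    also have "\<dots> = (\<Inter>P. {x. \<forall>Q\<in>U \<inter> W P. x \<in> lat Q (h P)})"
      by (intro INF_cong refl W(4) zopen_Int U W(1)) auto
    also have "\<dots> = lattice_sheaf g U"
      unfolding lattice_sheaf_def latg using sub W(2) by blast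
    finally show ?thesis .
  qed
  moreover have "local_family g"
  proof -
    obtain P0 :: "'a closed_point" where True by blast
    have "g P = mat 1" if "P \<in> W P0" "lat P (h P0) = lat P (mat 1)" for P
    proof -
      have "lat P (h P) = lat P (h P0)"
        using sub[of P P P0] sub[of P P0 P] W(2)[of P] that by (intro equalityI) simp_all
      then show ?thesis using that by (simp add: g_def)
    qed
    then have "{P. g P \<noteq> mat 1} \<subseteq> {P. lat P (h P0) \<noteq> lat P (mat 1)} \<union> - W P0" by auto
    moreover have "finite ({P. lat P (h P0) \<noteq> lat P (mat 1)} \<union> - W P0)"
      using finite_lat_neq_1[OF W(3)] W(1) by (simp add: zopen_def)
    ultimately have "finite {P. g P \<noteq> mat 1}" using finite_subset by blast
    then show ?thesis using W(3) by (auto simp: local_family_def g_def)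
  qed
  ultimately show ?thesis using that by blast
qed

definition order_at :: "('a::field closed_point \<Rightarrow> 'a ratfun^2^2) \<Rightarrow> 'a order_sheaf" where
  "order_at g U = {a. \<forall>P\<in>U. intmat P (matrix_conj (g P) a)}"

lemma End_sheaf_lattice_sheaf:
  assumes g: "local_family g" and U: "zopen U" and L: "\<And>U. zopen U \<Longrightarrow> \<Lambda> U = lattice_sheaf g U"
  shows "End_sheaf \<Lambda> U = order_at g U"
proof -
  have inv: "invertible (g P)" and fin: "finite {Q. g Q \<noteq> mat 1}" for P using g by (auto simp: local_family_def)
  have "a \<in> End_sheaf \<Lambda> U \<longleftrightarrow> (\<forall>P\<in>U. \<forall>x\<in>lat P (g P). a *v x \<in> lat P (g P))" for a
  proof
    assume a: "a \<in> End_sheaf \<Lambda> U"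
    show "\<forall>P\<in>U. \<forall>x\<in>lat P (g P). a *v x \<in> lat P (g P)"
    proof (intro ballI)
      fix P x assume P: "P \<in> U" and x: "x \<in> lat P (g P)"
      define V where "V = U \<inter> {P. x \<in> lat P (g P)}"
      have V: "zopen V" "V \<subseteq> U" using U finite_not_in_lat[OF fin] by (auto simp: V_def intro!: zopen_Int zopen_Collect)
      have "x \<in> lattice_sheaf g V" by (auto simp: lattice_sheaf_def V_def)
      then have "a *v x \<in> lattice_sheaf g V" using a V L unfolding End_sheaf_def by blast
      then show "a *v x \<in> lat P (g P)" using P x by (auto simp: lattice_sheaf_def V_def)
    qed
  next
    assume "\<forall>P\<in>U. \<forall>x\<in>lat P (g P). a *v x \<in> lat P (g P)"
    then show "a \<in> End_sheaf \<Lambda> U" using L by (auto simp: End_sheaf_def lattice_sheaf_def subset_iff)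
  qed
  then show ?thesis using lat_stable_iff[OF inv] by (auto simp: order_at_def)
qed

lemma maximal_order_iff:
  "maximal_order R \<longleftrightarrow> (\<exists>g. local_family g \<and> (\<forall>U. zopen U \<longrightarrow> R U = order_at g U))"
proof
  assume "maximal_order R"
  then obtain \<Lambda> where L: "plane_bundle \<Lambda>" "\<forall>U. zopen U \<longrightarrow> R U = End_sheaf \<Lambda> U" by (auto simp: maximal_order_def)
  obtain g where g: "local_family g" "\<And>U. zopen U \<Longrightarrow> \<Lambda> U = lattice_sheaf g U" using plane_bundleE[OF L(1)] by blast
  then show "\<exists>g. local_family g \<and> (\<forall>U. zopen U \<longrightarrow> R U = order_at g U)"
    using L(2) End_sheaf_lattice_sheaf[OF g(1) _ g(2)] by metis
next
  assume "\<exists>g. local_family g \<and> (\<forall>U. zopen U \<longrightarrow> R U = order_at g U)"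
  then obtain g where g: "local_family g" "\<forall>U. zopen U \<longrightarrow> R U = order_at g U" by blast
  then show "maximal_order R" unfolding maximal_order_def
    using plane_bundle_lattice_sheaf[OF g(1)] End_sheaf_lattice_sheaf[OF g(1)] by metis
qed

lemma stalk_order_at:
  assumes "local_family g" "\<And>U. zopen U \<Longrightarrow> R U = order_at g U"
  shows "stalk R P = {a. intmat P (matrix_conj (g P) a)}"
proof (intro equalityI subsetI)
  fix a assume "a \<in> stalk R P"
  then obtain U where "zopen U" "P \<in> U" "a \<in> R U" by (auto simp: stalk_def)
  then show "a \<in> {a. intmat P (matrix_conj (g P) a)}" using assms by (auto simp: order_at_def)
next
  fix a assume a: "a \<in> {a. intmat P (matrix_conj (g P) a)}"
  define U where "U = {Q. intmat Q (matrix_conj (g Q) a)}"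
  have "{Q. \<not> intmat Q (matrix_conj (g Q) a)} \<subseteq> {Q. g Q \<noteq> mat 1} \<union> {Q. \<not> intmat Q a}" by auto
  then have "finite {Q. \<not> intmat Q (matrix_conj (g Q) a)}"
    using assms(1) finite_not_intmat[of a] finite_subset by (auto simp: local_family_def)
  then have "zopen U" unfolding U_def by (rule zopen_Collect)
  moreover have "a \<in> R U" using \<open>zopen U\<close> assms(2) by (auto simp: order_at_def U_def)
  moreover have "P \<in> U" using a by (simp add: U_def)
  ultimately show "a \<in> stalk R P" by (auto simp: stalk_def)
qed

lemma invertible_bundle_div_sheaf: "invertible_bundle (div_sheaf B)"
  unfolding invertible_bundle_def vector_bundle_def
proof (intro conjI allI)
  show "module_sheaf (*) (div_sheaf B)"
    unfolding module_sheaf_def subsheaf_def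
    by (auto simp: div_sheaf_def intro: val_ge_add val_ge_mult0)
  fix P
  define f where "f = uniformizer P powi (- Poly_Mapping.lookup B P)"
  define U where "U = insert P ({Q. ord Q f = 0} \<inter> {Q. Poly_Mapping.lookup B Q = 0})"
  have f0: "f \<noteq> 0" and fP: "ord P f = - Poly_Mapping.lookup B P" by (auto simp: f_def ord_powi)
  have o: "ord Q f = - Poly_Mapping.lookup B Q" if "Q \<in> U" for Q using that fP by (auto simp: U_def)
  have "zopen U"
    unfolding U_def using finite_ord_support[OF f0] finite_lookup[of B]
    by (intro zopen_insert zopen_Int zopen_Collect)
  moreover have "div_sheaf B V = {\<Sum>i<1::nat. c i * f |c. \<forall>i<1. c i \<in> structure_sheaf V}" if V: "V \<subseteq> U" for V
  proof (intro equalityI subsetI)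
    fix x assume x: "x \<in> div_sheaf B V"
    have "val_ge Q 0 (x / f)" if "Q \<in> V" for Q
    proof -
      have "val_ge Q (ord Q f) x" using x that o[of Q] V by (auto simp: div_sheaf_def)
      then have "val_ge Q (0 - ord Q (inverse f)) x" using f0 by (simp add: ord_inverse)
      then show ?thesis using f0 val_ge_mult_iff[of "inverse f" Q 0 x] by (simp add: field_simps)
    qed
    then have "(\<Sum>i<1::nat. (x / f) * f) = x \<and> (\<forall>i<1::nat. x / f \<in> structure_sheaf V)" using f0 by (simp add: structure_sheaf_iff)
    then show "x \<in> {\<Sum>i<1::nat. c i * f |c. \<forall>i<1. c i \<in> structure_sheaf V}"
      by (intro CollectI exI[of _ "\<lambda>_. x / f"]) auto
  next
    fix x assume "x \<in> {\<Sum>i<1::nat. c i * f |c. \<forall>i<1. c i \<in> structure_sheaf V}"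
    then obtain b :: "nat \<Rightarrow> 'a ratfun" where b: "x = (\<Sum>i<1::nat. b i * f)" "\<forall>i<1. b i \<in> structure_sheaf V" by blast
    define c where "c = b 0"
    have c: "x = f * c" "c \<in> structure_sheaf V" using b by (simp_all add: c_def mult.commute)
    then show "x \<in> div_sheaf B V" using o V f0
      by (auto simp: div_sheaf_def structure_sheaf_iff val_ge_mult_iff subset_iff)
  qed
  ultimately show "\<exists>U e. zopen U \<and> P \<in> U \<and> (\<forall>c. (\<Sum>i<1::nat. c i * e i) = 0 \<longrightarrow> (\<forall>i<1. c i = 0)) \<and>
            (\<forall>V. zopen V \<and> V \<subseteq> U \<longrightarrow> div_sheaf B V = {\<Sum>i<1::nat. c i * e i |c. \<forall>i<1. c i \<in> structure_sheaf V})"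
    using f0 by (intro exI[of _ U] exI[of _ "\<lambda>_. f"] conjI) (simp_all add: U_def)
qed

section \<open>Completions\<close>

lemma limit_at_def': "limit_at P s = {\<lambda>n. h n + s n | h. h \<in> null_seqs P}"
  unfolding limit_at_def a_r_coset_def' by (auto simp: cauchy_ring_def)

lemma null_seqs_zero: "(\<lambda>n. 0) \<in> null_seqs P"
  by (simp add: null_seqs_def)

lemma null_seqs_add:
  assumes "s \<in> null_seqs P" "t \<in> null_seqs P" shows "(\<lambda>n. s n + t n) \<in> null_seqs P"
  unfolding null_seqs_def
proof (intro CollectI allI)
  fix N
  obtain M1 M2 where "\<forall>n\<ge>M1. val_ge P N (s n)" "\<forall>n\<ge>M2. val_ge P N (t n)"
    using assms unfolding null_seqs_def by blast
  then show "\<exists>M. \<forall>n\<ge>M. val_ge P N (s n + t n)"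
    by (intro exI[of _ "max M1 M2"]) (auto intro: val_ge_add)
qed

lemma null_seqs_uminus: "s \<in> null_seqs P \<Longrightarrow> (\<lambda>n. - s n) \<in> null_seqs P"
  by (simp add: null_seqs_def)

lemma limit_at_iff: "x \<in> limit_at P s \<longleftrightarrow> (\<lambda>n. x n - s n) \<in> null_seqs P"
proof
  assume "x \<in> limit_at P s"
  then obtain h where h: "h \<in> null_seqs P" "x = (\<lambda>n. h n + s n)" unfolding limit_at_def' by blast
  then have "(\<lambda>n. x n - s n) = h" by auto
  then show "(\<lambda>n. x n - s n) \<in> null_seqs P" using h by simp
next
  assume "(\<lambda>n. x n - s n) \<in> null_seqs P"
  then show "x \<in> limit_at P s"
    unfolding limit_at_def' by (intro CollectI exI[of _ "\<lambda>n. x n - s n"]) simp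
qed

lemma limit_at_self: "s \<in> limit_at P s"
  by (simp add: limit_at_iff null_seqs_zero)

lemma limit_at_eq_iff: "limit_at P s = limit_at P t \<longleftrightarrow> (\<lambda>n. s n - t n) \<in> null_seqs P"
proof
  assume "limit_at P s = limit_at P t"
  then have "s \<in> limit_at P t" using limit_at_self[of s P] by simp
  then show "(\<lambda>n. s n - t n) \<in> null_seqs P" by (simp add: limit_at_iff)
next
  have *: "limit_at P s \<subseteq> limit_at P t" if d: "(\<lambda>n. s n - t n) \<in> null_seqs P" for s t
  proof
    fix x assume "x \<in> limit_at P s"
    then have "(\<lambda>n. (x n - s n) + (s n - t n)) \<in> null_seqs P" using null_seqs_add d by (simp only: limit_at_iff)
    then show "x \<in> limit_at P t" by (simp add: limit_at_iff)
  qed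
  assume d: "(\<lambda>n. s n - t n) \<in> null_seqs P"
  have "(\<lambda>n. t n - s n) \<in> null_seqs P" using null_seqs_uminus[OF d] by simp
  then show "limit_at P s = limit_at P t" using * d by (intro equalityI)
qed

lemma cauchy_seqs_const [simp]: "(\<lambda>n. c) \<in> cauchy_seqs P"
  by (simp add: cauchy_seqs_def)

lemma cauchy_seqs_add:
  assumes "s \<in> cauchy_seqs P" "t \<in> cauchy_seqs P" shows "(\<lambda>n. s n + t n) \<in> cauchy_seqs P"
  unfolding cauchy_seqs_def
proof (intro CollectI allI)
  fix N
  obtain M1 M2 where *: "\<forall>m\<ge>M1. \<forall>n\<ge>M1. val_ge P N (s m - s n)" "\<forall>m\<ge>M2. \<forall>n\<ge>M2. val_ge P N (t m - t n)"
    using assms unfolding cauchy_seqs_def by blast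
  have "val_ge P N (s m + t m - (s n + t n))" if "m \<ge> max M1 M2" "n \<ge> max M1 M2" for m n
  proof -
    have "s m + t m - (s n + t n) = (s m - s n) + (t m - t n)" by simp
    then show ?thesis using * that by (metis max.bounded_iff val_ge_add)
  qed
  then show "\<exists>M. \<forall>m\<ge>M. \<forall>n\<ge>M. val_ge P N (s m + t m - (s n + t n))" by blast
qed

lemma ex_val_ge: "\<exists>B\<le>0. val_ge P B f"
  by (cases "f = 0") (auto simp: val_ge_iff intro: exI[of _ "min 0 (ord P f)"])

lemma cauchy_seqs_bounded:
  assumes "s \<in> cauchy_seqs P" obtains B where "B \<le> 0" "\<And>n. val_ge P B (s n)"
proof -
  obtain M where M: "\<forall>m\<ge>M. \<forall>n\<ge>M. val_ge P 0 (s m - s n)" using assms unfolding cauchy_seqs_def by blast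
  have "\<exists>B\<le>0. \<forall>n<k. val_ge P B (s n)" for k
  proof (induction k)
    case (Suc k)
    then obtain B where "B \<le> 0" "\<forall>n<k. val_ge P B (s n)" by blast
    moreover obtain C where "C \<le> 0" "val_ge P C (s k)" using ex_val_ge by blast
    ultimately show ?case
      by (intro exI[of _ "min B C"]) (auto simp: less_Suc_eq intro: val_ge_mono)
  qed auto
  then obtain B where B: "B \<le> 0" "\<forall>n<Suc M. val_ge P B (s n)" by blast
  have "val_ge P B (s n)" for n
  proof (cases "n < Suc M")
    case False
    then have "val_ge P 0 (s n - s M)" using M by simp
    then have "val_ge P B (s n - s M)" using B(1) val_ge_mono by blast
    moreover have "val_ge P B (s M)" using B by blast
    ultimately show ?thesis using val_ge_add[of P B "s n - s M" "s M"] by simp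
  qed (use B in blast)
  then show ?thesis using that B(1) by blast
qed

lemma null_seqs_mult:
  assumes "s \<in> null_seqs P" "\<And>n. val_ge P B (t n)"
  shows "(\<lambda>n. s n * t n) \<in> null_seqs P" "(\<lambda>n. t n * s n) \<in> null_seqs P"
proof -
  have "\<exists>M. \<forall>n\<ge>M. val_ge P N (s n * t n)" for N
  proof -
    obtain M where "\<forall>n\<ge>M. val_ge P (N - B) (s n)" using assms(1) unfolding null_seqs_def by blast
    then have "\<forall>n\<ge>M. val_ge P N (s n * t n)" using val_ge_mult[of P "N - B" _ B] assms(2) by fastforce
    then show ?thesis by blast
  qed
  then show "(\<lambda>n. s n * t n) \<in> null_seqs P" by (simp add: null_seqs_def)
  then show "(\<lambda>n. t n * s n) \<in> null_seqs P" by (simp add: mult.commute)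
qed

lemma cauchy_seqs_mult:
  assumes "s \<in> cauchy_seqs P" "t \<in> cauchy_seqs P" shows "(\<lambda>n. s n * t n) \<in> cauchy_seqs P"
proof -
  obtain B where B: "B \<le> 0" "\<And>n. val_ge P B (s n)" using cauchy_seqs_bounded[OF assms(1)] by blast
  obtain C where C: "C \<le> 0" "\<And>n. val_ge P C (t n)" using cauchy_seqs_bounded[OF assms(2)] by blast
  have "\<exists>M. \<forall>m\<ge>M. \<forall>n\<ge>M. val_ge P N (s m * t m - s n * t n)" for N
  proof -
    obtain M1 where M1: "\<forall>m\<ge>M1. \<forall>n\<ge>M1. val_ge P (N - C) (s m - s n)" using assms(1) unfolding cauchy_seqs_def by blast
    obtain M2 where M2: "\<forall>m\<ge>M2. \<forall>n\<ge>M2. val_ge P (N - B) (t m - t n)" using assms(2) unfolding cauchy_seqs_def by blast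
    have "val_ge P N (s m * t m - s n * t n)" if "m \<ge> max M1 M2" "n \<ge> max M1 M2" for m n
    proof -
      have "s m * t m - s n * t n = (s m - s n) * t m + s n * (t m - t n)" by (simp add: algebra_simps)
      moreover have "val_ge P (N - C + C) ((s m - s n) * t m)" using M1 that C by (intro val_ge_mult) auto
      moreover have "val_ge P (B + (N - B)) (s n * (t m - t n))" using M2 that B by (intro val_ge_mult) auto
      ultimately show ?thesis using val_ge_add by fastforce
    qed
    then show ?thesis by blast
  qed
  then show ?thesis by (simp add: cauchy_seqs_def)
qed

lemma null_imp_cauchy: assumes "s \<in> null_seqs P" shows "s \<in> cauchy_seqs P"
proof -
  have "\<exists>M. \<forall>m\<ge>M. \<forall>n\<ge>M. val_ge P N (s m - s n)" for N
    using assms val_ge_diff unfolding null_seqs_def by blast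
  then show ?thesis by (simp add: cauchy_seqs_def)
qed

lemma carrier_completion: "carrier (completion P) = limit_at P ` cauchy_seqs P"
  unfolding completion_def FactRing_def A_RCOSETS_def' limit_at_def by (auto simp: cauchy_ring_def)

lemma one_completion: "\<one>\<^bsub>completion P\<^esub> = embed P 1"
  by (simp add: completion_def FactRing_def limit_at_def) (simp add: cauchy_ring_def)

lemma zero_completion: "\<zero>\<^bsub>completion P\<^esub> = embed P 0"
  by (simp add: completion_def FactRing_def limit_at_def')

lemma add_completion: "limit_at P s \<oplus>\<^bsub>completion P\<^esub> limit_at P t = limit_at P (\<lambda>n. s n + t n)"
proof -
  have "limit_at P s \<oplus>\<^bsub>completion P\<^esub> limit_at P t = {\<lambda>n. a n + b n | a b. a \<in> limit_at P s \<and> b \<in> limit_at P t}"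
    by (auto simp: completion_def FactRing_def set_add_def' cauchy_ring_def)
  also have "\<dots> = limit_at P (\<lambda>n. s n + t n)"
  proof (intro equalityI subsetI)
    fix x assume "x \<in> {\<lambda>n. a n + b n | a b. a \<in> limit_at P s \<and> b \<in> limit_at P t}"
    then obtain a b where ab: "a \<in> limit_at P s" "b \<in> limit_at P t" and x: "x = (\<lambda>n. a n + b n)" by blast
    have "(\<lambda>n. (a n - s n) + (b n - t n)) \<in> null_seqs P"
      using ab by (intro null_seqs_add) (simp_all add: limit_at_iff)
    then show "x \<in> limit_at P (\<lambda>n. s n + t n)" by (simp add: limit_at_iff x algebra_simps)
  next
    fix x assume "x \<in> limit_at P (\<lambda>n. s n + t n)"
    then have "(\<lambda>n. x n - t n) \<in> limit_at P s" by (simp add: limit_at_iff algebra_simps)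
    then show "x \<in> {\<lambda>n. a n + b n | a b. a \<in> limit_at P s \<and> b \<in> limit_at P t}"
      using limit_at_self[of t P] by (intro CollectI exI[of _ "\<lambda>n. x n - t n"] exI[of _ t]) simp
  qed
  finally show ?thesis .
qed

lemma mult_completion:
  assumes "s \<in> cauchy_seqs P" "t \<in> cauchy_seqs P"
  shows "limit_at P s \<otimes>\<^bsub>completion P\<^esub> limit_at P t = limit_at P (\<lambda>n. s n * t n)"
proof -
  have "limit_at P s \<otimes>\<^bsub>completion P\<^esub> limit_at P t = (\<Union>a\<in>limit_at P s. \<Union>b\<in>limit_at P t. limit_at P (\<lambda>n. a n * b n))"
    by (simp add: completion_def FactRing_def rcoset_mult_def limit_at_def) (simp add: cauchy_ring_def)
  moreover have "limit_at P (\<lambda>n. a n * b n) = limit_at P (\<lambda>n. s n * t n)"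
    if ab: "a \<in> limit_at P s" "b \<in> limit_at P t" for a b
  proof -
    have h: "(\<lambda>n. a n - s n) \<in> null_seqs P" and k: "(\<lambda>n. b n - t n) \<in> null_seqs P"
      using ab by (simp_all add: limit_at_iff)
    have "a \<in> cauchy_seqs P" using cauchy_seqs_add[OF null_imp_cauchy[OF h] assms(1)] by simp
    then obtain B where B: "\<And>n. val_ge P B (a n)" using cauchy_seqs_bounded by blast
    obtain C where C: "\<And>n. val_ge P C (t n)" using cauchy_seqs_bounded[OF assms(2)] by blast
    have "(\<lambda>n. a n * (b n - t n) + (a n - s n) * t n) \<in> null_seqs P"
      by (rule null_seqs_add) (rule null_seqs_mult[OF k B] null_seqs_mult[OF h C])+
    moreover have "(\<lambda>n. a n * b n - s n * t n) = (\<lambda>n. a n * (b n - t n) + (a n - s n) * t n)"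
      by (simp add: algebra_simps)
    ultimately show ?thesis unfolding limit_at_eq_iff by simp
  qed
  moreover have "s \<in> limit_at P s" "t \<in> limit_at P t"
    by (rule limit_at_self)+
  ultimately show ?thesis by blast
qed

text \<open>Matrices over the completion are handled through sequences of matrices over the function
  field, where the matrix algebra of the library is available.\<close>

definition mcauchy :: "'a::field closed_point \<Rightarrow> (nat \<Rightarrow> 'a ratfun^2^2) \<Rightarrow> bool" where
  "mcauchy P A \<longleftrightarrow> (\<forall>i j. (\<lambda>n. A n $ i $ j) \<in> cauchy_seqs P)"

definition mlim :: "'a::field closed_point \<Rightarrow> (nat \<Rightarrow> 'a ratfun^2^2) \<Rightarrow> 'a completed^2^2" where
  "mlim P A = (\<chi> i j. limit_at P (\<lambda>n. A n $ i $ j))"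

lemma mlim_nth [simp]: "mlim P A $ i $ j = limit_at P (\<lambda>n. A n $ i $ j)"
  by (simp add: mlim_def)

lemma mcauchy_const [simp]: "mcauchy P (\<lambda>n. a)"
  by (simp add: mcauchy_def)

lemma mcauchy_mult: "mcauchy P A \<Longrightarrow> mcauchy P B \<Longrightarrow> mcauchy P (\<lambda>n. A n ** B n)"
  by (auto simp: mcauchy_def matrix_mult_nth_2 intro!: cauchy_seqs_add cauchy_seqs_mult)

lemma mcauchy_conj: "mcauchy P A \<Longrightarrow> mcauchy P (\<lambda>n. matrix_conj e (A n))"
  unfolding matrix_conj_def by (intro mcauchy_mult mcauchy_const)

lemma mat_mult_mlim:
  "mcauchy P A \<Longrightarrow> mcauchy P B \<Longrightarrow> mat_mult_at P (mlim P A) (mlim P B) = mlim P (\<lambda>n. A n ** B n)"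
  by (simp add: vec_eq_iff mat_mult_at_def matrix_mult_nth_2 mcauchy_def mult_completion add_completion)

lemma mats_at_eq: "mats_at P = {mlim P A | A. mcauchy P A}"
proof (intro equalityI subsetI)
  fix X assume "X \<in> mats_at P"
  then have "\<forall>i j. \<exists>s. s \<in> cauchy_seqs P \<and> X $ i $ j = limit_at P s"
    unfolding mats_at_def carrier_completion by blast
  then obtain s where s: "\<And>i j. s i j \<in> cauchy_seqs P" "\<And>i j. X $ i $ j = limit_at P (s i j)" by metis
  define A where "A n = (\<chi> i j. s i j n)" for n
  have "X = mlim P A" "mcauchy P A" using s by (simp_all add: vec_eq_iff mlim_def A_def mcauchy_def)
  then show "X \<in> {mlim P A | A. mcauchy P A}" by blast
qed (auto simp: mats_at_def carrier_completion mcauchy_def)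

lemma mat_one_mlim: "mat_one_at P = mlim P (\<lambda>n. mat 1)"
  by (simp add: vec_eq_iff mat_one_at_def mat_def one_completion zero_completion)

lemma mat_mult_at_assoc:
  assumes "X \<in> mats_at P" "Y \<in> mats_at P" "Z \<in> mats_at P"
  shows "mat_mult_at P (mat_mult_at P X Y) Z = mat_mult_at P X (mat_mult_at P Y Z)"
  using assms unfolding mats_at_eq by (auto simp: mat_mult_mlim mcauchy_mult matrix_mul_assoc)

lemma mat_mult_at_one:
  assumes "X \<in> mats_at P"
  shows "mat_mult_at P (mat_one_at P) X = X" "mat_mult_at P X (mat_one_at P) = X"
  using assms unfolding mats_at_eq mat_one_mlim by (auto simp: mat_mult_mlim)

lemma mat_mult_at_closed: "X \<in> mats_at P \<Longrightarrow> Y \<in> mats_at P \<Longrightarrow> mat_mult_at P X Y \<in> mats_at P"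
  unfolding mats_at_eq using mat_mult_mlim mcauchy_mult by blast

definition limits_of :: "'a::field closed_point \<Rightarrow> ('a ratfun^2^2 \<Rightarrow> bool) \<Rightarrow> ('a completed^2^2) set" where
  "limits_of P Q = {mlim P A | A. mcauchy P A \<and> (\<forall>n. Q (A n))}"

lemma limits_of_subset: "limits_of P Q \<subseteq> mats_at P"
  by (auto simp: limits_of_def mats_at_eq)

lemma complete_at_eq: "complete_at P R = limits_of P (\<lambda>a. a \<in> stalk R P)"
  by (simp add: complete_at_def limits_of_def mlim_def mcauchy_def)

definition stdmat :: "'a::field closed_point \<Rightarrow> nat \<Rightarrow> 'a ratfun^2^2 \<Rightarrow> bool" where
  "stdmat P d b \<longleftrightarrow> val_ge P 0 (b $ 1 $ 1) \<and> val_ge P (int d) (b $ 1 $ 2) \<and>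
     val_ge P (- int d) (b $ 2 $ 1) \<and> val_ge P 0 (b $ 2 $ 2)"

lemma scaled_integers_at:
  assumes "f \<noteq> 0"
  shows "(\<lambda>x. embed P f \<otimes>\<^bsub>completion P\<^esub> x) ` integers_at P = {limit_at P s | s. s \<in> cauchy_seqs P \<and> (\<forall>n. val_ge P (ord P f) (s n))}"
proof (intro equalityI subsetI)
  fix x assume "x \<in> (\<lambda>x. embed P f \<otimes>\<^bsub>completion P\<^esub> x) ` integers_at P"
  then obtain s where s: "s \<in> cauchy_seqs P" "\<forall>n. val_ge P 0 (s n)" "x = embed P f \<otimes>\<^bsub>completion P\<^esub> limit_at P s"
    unfolding integers_at_def by blast
  then have "x = limit_at P (\<lambda>n. f * s n)" by (simp add: mult_completion)
  moreover have "(\<lambda>n. f * s n) \<in> cauchy_seqs P" using s by (intro cauchy_seqs_mult) auto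
  moreover have "\<forall>n. val_ge P (ord P f) (f * s n)" using s assms by (simp add: val_ge_mult_iff)
  ultimately show "x \<in> {limit_at P s | s. s \<in> cauchy_seqs P \<and> (\<forall>n. val_ge P (ord P f) (s n))}" by blast
next
  fix x assume "x \<in> {limit_at P s | s. s \<in> cauchy_seqs P \<and> (\<forall>n. val_ge P (ord P f) (s n))}"
  then obtain s where s: "s \<in> cauchy_seqs P" "\<forall>n. val_ge P (ord P f) (s n)" "x = limit_at P s" by blast
  define t where "t n = inverse f * s n" for n
  have t: "t \<in> cauchy_seqs P" unfolding t_def using s by (intro cauchy_seqs_mult) auto
  have "s = (\<lambda>n. f * t n)" using assms by (simp add: t_def mult.assoc[symmetric])
  then have "x = embed P f \<otimes>\<^bsub>completion P\<^esub> limit_at P t" using s(3) t by (simp add: mult_completion)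
  moreover have "limit_at P t \<in> integers_at P"
    using t s assms unfolding integers_at_def by (auto simp: t_def val_ge_mult_iff ord_inverse)
  ultimately show "x \<in> (\<lambda>x. embed P f \<otimes>\<^bsub>completion P\<^esub> x) ` integers_at P" by blast
qed

lemma limits_of_entries:
  "{X. \<forall>i j. X $ i $ j \<in> {limit_at P s | s. s \<in> cauchy_seqs P \<and> (\<forall>n. val_ge P (k i j) (s n))}} =
    limits_of P (\<lambda>a. \<forall>i j. val_ge P (k i j) (a $ i $ j))" (is "?L = ?R")
proof (intro equalityI subsetI)
  fix X assume "X \<in> ?L"
  then have "\<forall>i j. \<exists>s. s \<in> cauchy_seqs P \<and> (\<forall>n. val_ge P (k i j) (s n)) \<and> X $ i $ j = limit_at P s"
    by blast
  then obtain s where s: "\<And>i j. s i j \<in> cauchy_seqs P" "\<And>i j n. val_ge P (k i j) (s i j n)"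
    "\<And>i j. X $ i $ j = limit_at P (s i j)" by metis
  define A where "A n = (\<chi> i j. s i j n)" for n
  have "X = mlim P A" "mcauchy P A" "\<forall>n i j. val_ge P (k i j) (A n $ i $ j)"
    using s by (simp_all add: vec_eq_iff mlim_def A_def mcauchy_def)
  then show "X \<in> ?R" unfolding limits_of_def by blast
qed (auto simp: limits_of_def mcauchy_def)

lemma integral_matrices_eq: "{A. \<forall>i j. A $ i $ j \<in> integers_at P} = limits_of P (intmat P)"
  using limits_of_entries[of P "\<lambda>i j. 0"] unfolding intmat_def[abs_def] integers_at_def .

lemma standard_order_eq:
  assumes "\<pi> \<noteq> 0" "ord P \<pi> = 1"
  shows "standard_order P \<pi> d = limits_of P (stdmat P d)"
proof -
  define k where "k = (\<lambda>(i::2) (j::2). if i = 1 \<and> j = 2 then int d else if i = 2 \<and> j = 1 then - int d else 0)"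
  have std: "stdmat P d = (\<lambda>a. \<forall>i j. val_ge P (k i j) (a $ i $ j))"
    by (rule ext) (auto simp: stdmat_def k_def forall_2)
  define T where "T m = {limit_at P s | s. s \<in> cauchy_seqs P \<and> (\<forall>n. val_ge P m (s n))}" for m
  have T0: "integers_at P = T 0" unfolding T_def integers_at_def ..
  have Tm: "(\<lambda>x. embed P (\<pi> powi m) \<otimes>\<^bsub>completion P\<^esub> x) ` T 0 = T m" for m
    using scaled_integers_at[of "\<pi> powi m" P] assms unfolding T0 by (simp add: ord_powi T_def)
  have "standard_order P \<pi> d = {X. \<forall>i j. X $ i $ j \<in> T (k i j)}"
    unfolding standard_order_def T0 Tm by (simp add: forall_2 k_def conj_assoc)
  then show ?thesis unfolding std T_def limits_of_entries .
qed

lemma conj_limits_of: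
  assumes e: "invertible e"
  shows "(\<lambda>A. mat_mult_at P (mat_mult_at P (mlim P (\<lambda>n. e)) A) (mlim P (\<lambda>n. matrix_inv e))) ` limits_of P Q
    = limits_of P (\<lambda>a. Q (matrix_conj e a))"
proof (intro equalityI subsetI)
  fix X assume "X \<in> (\<lambda>A. mat_mult_at P (mat_mult_at P (mlim P (\<lambda>n. e)) A) (mlim P (\<lambda>n. matrix_inv e))) ` limits_of P Q"
  then obtain A where A: "mcauchy P A" "\<forall>n. Q (A n)"
    "X = mat_mult_at P (mat_mult_at P (mlim P (\<lambda>n. e)) (mlim P A)) (mlim P (\<lambda>n. matrix_inv e))"
    unfolding limits_of_def by blast
  have "e ** a ** matrix_inv e = matrix_conj (matrix_inv e) a" for a using e by (simp add: matrix_conj_def invertible_matrix_inv)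
  then have X: "X = mlim P (\<lambda>n. matrix_conj (matrix_inv e) (A n))" using A by (simp add: mat_mult_mlim mcauchy_mult)
  moreover have "mcauchy P (\<lambda>n. matrix_conj (matrix_inv e) (A n))" by (rule mcauchy_conj) (rule A)
  ultimately show "X \<in> limits_of P (\<lambda>a. Q (matrix_conj e a))"
    unfolding limits_of_def using A(2) e by (intro CollectI exI[of _ "\<lambda>n. matrix_conj (matrix_inv e) (A n)"]) (simp add: conj_matrix_inv)
next
  fix X assume "X \<in> limits_of P (\<lambda>a. Q (matrix_conj e a))"
  then obtain A where A: "mcauchy P A" "\<forall>n. Q (matrix_conj e (A n))" "X = mlim P A" unfolding limits_of_def by blast
  have i: "e ** matrix_conj e a ** matrix_inv e = a" for a
    using conj_matrix_inv(1)[OF e, of a] e by (simp add: matrix_conj_def[of "matrix_inv e"] invertible_matrix_inv)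
  have "X = mat_mult_at P (mat_mult_at P (mlim P (\<lambda>n. e)) (mlim P (\<lambda>n. matrix_conj e (A n)))) (mlim P (\<lambda>n. matrix_inv e))"
    using A by (simp add: mat_mult_mlim mcauchy_mult mcauchy_conj i)
  moreover have "mlim P (\<lambda>n. matrix_conj e (A n)) \<in> limits_of P Q"
    unfolding limits_of_def using A mcauchy_conj by blast
  ultimately show "X \<in> (\<lambda>A. mat_mult_at P (mat_mult_at P (mlim P (\<lambda>n. e)) A) (mlim P (\<lambda>n. matrix_inv e))) ` limits_of P Q"
    by blast
qed

lemma at_distanceI:
  assumes e: "invertible e"
    and R: "stalk R P = {a. intmat P (matrix_conj e a)}" and R': "stalk R' P = {a. stdmat P d (matrix_conj e a)}"
  shows "at_distance P d (complete_at P R) (complete_at P R')"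
  unfolding at_distance_def
proof (intro exI conjI)
  show "uniformizer P \<noteq> 0" "ord P (uniformizer P) = 1" by simp_all
  show "mlim P (\<lambda>n. e) \<in> mats_at P" "mlim P (\<lambda>n. matrix_inv e) \<in> mats_at P" unfolding mats_at_eq by auto
  show "mat_mult_at P (mlim P (\<lambda>n. e)) (mlim P (\<lambda>n. matrix_inv e)) = mat_one_at P"
    "mat_mult_at P (mlim P (\<lambda>n. matrix_inv e)) (mlim P (\<lambda>n. e)) = mat_one_at P"
    by (simp_all add: mat_mult_mlim mat_one_mlim matrix_inv_inverse[OF e])
  show "complete_at P R = (\<lambda>A. mat_mult_at P (mat_mult_at P (mlim P (\<lambda>n. e)) A) (mlim P (\<lambda>n. matrix_inv e))) ` {A. \<forall>i j. A $ i $ j \<in> integers_at P}"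
    unfolding integral_matrices_eq conj_limits_of[OF e] complete_at_eq R by simp
  show "complete_at P R' = (\<lambda>A. mat_mult_at P (mat_mult_at P (mlim P (\<lambda>n. e)) A) (mlim P (\<lambda>n. matrix_inv e))) ` standard_order P (uniformizer P) d"
    unfolding standard_order_eq[of "uniformizer P" P, simplified] conj_limits_of[OF e] complete_at_eq R' by simp
qed

lemma smult_limits_std_iff:
  defines "C \<equiv> \<lambda>P k. mlim P (\<lambda>n. mat2 (uniformizer P ^ k) 0 0 (uniformizer P ^ k))"
  shows "(\<forall>X\<in>limits_of P (intmat P). mat_mult_at P (C P k) X \<in> limits_of P (stdmat P d)) \<longleftrightarrow> d \<le> k"
proof
  let ?u = "uniformizer P ^ k"
  assume *: "\<forall>X\<in>limits_of P (intmat P). mat_mult_at P (C P k) X \<in> limits_of P (stdmat P d)"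
  have "mlim P (\<lambda>n. mat2 0 1 0 0) \<in> limits_of P (intmat P)"
    unfolding limits_of_def by (intro CollectI exI[of _ "\<lambda>n. mat2 0 1 0 0"]) (auto simp: intmat_2)
  then have "mat_mult_at P (C P k) (mlim P (\<lambda>n. mat2 0 1 0 0)) \<in> limits_of P (stdmat P d)" using * by blast
  then have "mlim P (\<lambda>n. mat2 ?u 0 0 ?u ** mat2 0 1 0 0) \<in> limits_of P (stdmat P d)"
    by (simp add: C_def mat_mult_mlim)
  then obtain A where A: "\<forall>n. stdmat P d (A n)" "mlim P (\<lambda>n. mat2 ?u 0 0 ?u ** mat2 0 1 0 0) = mlim P A"
    unfolding limits_of_def by blast
  from A(2) have "mlim P (\<lambda>n. mat2 ?u 0 0 ?u ** mat2 0 1 0 0) $ 1 $ 2 = mlim P A $ 1 $ 2" by simp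
  then have "limit_at P (\<lambda>n. ?u) = limit_at P (\<lambda>n. A n $ 1 $ 2)" by (simp add: matrix_mult_nth_2)
  then have "(\<lambda>n. ?u - A n $ 1 $ 2) \<in> null_seqs P" by (simp add: limit_at_eq_iff)
  then obtain n where "val_ge P (int d) (?u - A n $ 1 $ 2)" unfolding null_seqs_def by blast
  moreover have "val_ge P (int d) (A n $ 1 $ 2)" using A(1) by (simp add: stdmat_def)
  ultimately have "val_ge P (int d) ?u" using val_ge_add by fastforce
  then show "d \<le> k" by (simp add: val_ge_iff ord_power)
next
  let ?u = "uniformizer P ^ k"
  assume dk: "d \<le> k"
  show "\<forall>X\<in>limits_of P (intmat P). mat_mult_at P (C P k) X \<in> limits_of P (stdmat P d)"
  proof
    fix X assume "X \<in> limits_of P (intmat P)"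
    then obtain A where A: "mcauchy P A" "\<forall>n. intmat P (A n)" "X = mlim P A" unfolding limits_of_def by blast
    have "mat_mult_at P (C P k) X = mlim P (\<lambda>n. mat2 ?u 0 0 ?u ** A n)"
      using A by (simp add: C_def mat_mult_mlim)
    moreover have "mcauchy P (\<lambda>n. mat2 ?u 0 0 ?u ** A n)" using A(1) by (intro mcauchy_mult) auto
    moreover have "stdmat P d (mat2 ?u 0 0 ?u ** A n)" for n
    proof -
      have "val_ge P m (?u * A n $ i $ j)" if "m \<le> int d" for i j m
      proof -
        have "val_ge P (m - ord P ?u) (A n $ i $ j)"
        proof (rule val_ge_mono)
          show "val_ge P 0 (A n $ i $ j)" using A(2) unfolding intmat_def by blast
          show "m - ord P ?u \<le> 0" using that dk by (simp add: ord_power)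
        qed
        then show ?thesis by (simp add: val_ge_mult_iff)
      qed
      then show ?thesis by (simp add: stdmat_def matrix_mult_nth_2)
    qed
    ultimately show "mat_mult_at P (C P k) X \<in> limits_of P (stdmat P d)" unfolding limits_of_def by blast
  qed
qed

text \<open>The distance is recovered from the two orders as the least \<open>k\<close> for which the \<open>k\<close>th power of
  the uniformizer multiplies the first one into the second one.\<close>

lemma at_distance_iff:
  defines "C \<equiv> \<lambda>P k. mlim P (\<lambda>n. mat2 (uniformizer P ^ k) 0 0 (uniformizer P ^ k))"
  assumes "at_distance P d M M'"
  shows "(\<forall>X\<in>M. mat_mult_at P (C P k) X \<in> M') \<longleftrightarrow> d \<le> k"
proof -
  obtain \<pi> g h where \<pi>: "\<pi> \<noteq> 0" "ord P \<pi> = 1" and g: "g \<in> mats_at P" and h: "h \<in> mats_at P"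
    and gh: "mat_mult_at P g h = mat_one_at P" and hg: "mat_mult_at P h g = mat_one_at P"
    and M: "M = (\<lambda>A. mat_mult_at P (mat_mult_at P g A) h) ` {A. \<forall>i j. A $ i $ j \<in> integers_at P}"
    and M': "M' = (\<lambda>A. mat_mult_at P (mat_mult_at P g A) h) ` standard_order P \<pi> d"
    using assms(2) unfolding at_distance_def by blast
  let ?c = "\<lambda>A. mat_mult_at P (mat_mult_at P g A) h"
  have C: "C P k \<in> mats_at P" by (auto simp: C_def mats_at_eq)
  have central: "mat_mult_at P (C P k) X = mat_mult_at P X (C P k)" if "X \<in> mats_at P" for X
  proof -
    have "mat2 u 0 0 u ** a = a ** mat2 u 0 0 u" for u :: "'a ratfun" and a
      by (rule mat2_eqI) (simp_all add: matrix_mult_nth_2 mult.commute)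
    then show ?thesis using that by (auto simp: C_def mats_at_eq mat_mult_mlim)
  qed
  have c: "mat_mult_at P (C P k) (?c X) = ?c (mat_mult_at P (C P k) X)" if X: "X \<in> mats_at P" for X
  proof -
    have "mat_mult_at P (C P k) (?c X) = mat_mult_at P (mat_mult_at P (mat_mult_at P (C P k) g) X) h"
      using C g X h by (simp add: mat_mult_at_assoc mat_mult_at_closed)
    also have "mat_mult_at P (C P k) g = mat_mult_at P g (C P k)" using central g by blast
    also have "mat_mult_at P (mat_mult_at P (mat_mult_at P g (C P k)) X) h = ?c (mat_mult_at P (C P k) X)"
      using C g X h by (simp add: mat_mult_at_assoc mat_mult_at_closed)
    finally show ?thesis .
  qed
  have inj: "X = Y" if "?c X = ?c Y" "X \<in> mats_at P" "Y \<in> mats_at P" for X Y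
  proof -
    have "mat_mult_at P (mat_mult_at P h (?c Z)) g = Z" if "Z \<in> mats_at P" for Z
    proof -
      have "mat_mult_at P (mat_mult_at P h (?c Z)) g = mat_mult_at P (mat_mult_at P (mat_mult_at P h g) Z) (mat_mult_at P h g)"
        using g h that by (simp add: mat_mult_at_assoc mat_mult_at_closed)
      then show ?thesis using that by (simp add: hg mat_mult_at_one)
    qed
    then show ?thesis using that by metis
  qed
  have "(\<forall>X\<in>M. mat_mult_at P (C P k) X \<in> M') \<longleftrightarrow>
      (\<forall>X\<in>limits_of P (intmat P). mat_mult_at P (C P k) X \<in> limits_of P (stdmat P d))"
  proof -
    have M: "M = ?c ` limits_of P (intmat P)" unfolding M integral_matrices_eq ..
    have M': "M' = ?c ` limits_of P (stdmat P d)" unfolding M' standard_order_eq[OF \<pi>] ..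
    have "mat_mult_at P (C P k) (?c X) \<in> M' \<longleftrightarrow> mat_mult_at P (C P k) X \<in> limits_of P (stdmat P d)"
      if "X \<in> limits_of P (intmat P)" for X
    proof -
      have X: "X \<in> mats_at P" using that limits_of_subset by blast
      show ?thesis
        unfolding c[OF X] M' using inj mat_mult_at_closed[OF C X] limits_of_subset[of P "stdmat P d"] by blast
    qed
    then show ?thesis unfolding M by blast
  qed
  then show ?thesis using smult_limits_std_iff[of P k d] unfolding C_def by blast
qed

lemma at_distance_unique:
  assumes "at_distance P d M M'" "at_distance P d' M M'"
  shows "d = d'"
  using at_distance_iff[OF assms(1)] at_distance_iff[OF assms(2)] by (meson order_refl order_antisym)

section \<open>The relative position of two lattices\<close>

lemma unimod_swap: "unimod P (mat2 0 1 1 0)"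
  by (rule unimod_mat2) auto

lemma unimod_diagonalization:
  fixes m :: "'a::field ratfun^2^2"
  assumes "invertible m"
  obtains k l x y where "unimod P k" "unimod P l" "x \<noteq> 0" "y \<noteq> 0" "m = k ** mat2 x 0 0 y ** l"
proof -
  define good where "good m \<longleftrightarrow> (\<exists>k l x y. unimod P k \<and> unimod P l \<and> x \<noteq> 0 \<and> y \<noteq> 0 \<and> m = k ** mat2 x 0 0 y ** l)" for m
  define w :: "'a ratfun^2^2" where "w = mat2 0 1 1 0"
  have w: "unimod P w" unfolding w_def by (rule unimod_swap)
  have ww: "w ** w = mat 1" unfolding w_def by (rule mat2_eqI) (simp_all add: matrix_mult_nth_2)
  have good_left: "good m" if gm: "good (w ** m)" for m
  proof -
    obtain k l x y where *: "unimod P k" "unimod P l" "x \<noteq> 0" "y \<noteq> 0" "w ** m = k ** mat2 x 0 0 y ** l"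
      using gm unfolding good_def by (elim exE conjE) (rule that)
    have "m = w ** (w ** m)" by (simp add: matrix_mul_assoc ww)
    then have "m = (w ** k) ** mat2 x 0 0 y ** l" unfolding *(5) by (simp add: matrix_mul_assoc)
    then show ?thesis unfolding good_def
      by (intro exI[of _ "w ** k"] exI[of _ l] exI[of _ x] exI[of _ y] conjI unimod_mult w *)
  qed
  have good_right: "good m" if gm: "good (m ** w)" for m
  proof -
    obtain k l x y where *: "unimod P k" "unimod P l" "x \<noteq> 0" "y \<noteq> 0" "m ** w = k ** mat2 x 0 0 y ** l"
      using gm unfolding good_def by (elim exE conjE) (rule that)
    have "m = (m ** w) ** w" by (simp add: matrix_mul_assoc[symmetric] ww)
    then have "m = k ** mat2 x 0 0 y ** (l ** w)" unfolding *(5) by (simp add: matrix_mul_assoc)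
    then show ?thesis unfolding good_def
      by (intro exI[of _ k] exI[of _ "l ** w"] exI[of _ x] exI[of _ y] conjI unimod_mult w *)
  qed
  define minimal where "minimal m i j \<longleftrightarrow> m $ i $ j \<noteq> 0 \<and> (\<forall>i' j'. val_ge P (ord P (m $ i $ j)) (m $ i' $ j'))"
    for m :: "'a ratfun^2^2" and i j :: 2
  have good11: "good m" if "invertible m" and min: "minimal m 1 1" for m
  proof -
    let ?a = "m $ 1 $ 1" and ?b = "m $ 1 $ 2" and ?c = "m $ 2 $ 1" and ?d = "m $ 2 $ 2"
    have a0: "?a \<noteq> 0" using min by (simp add: minimal_def)
    have int: "val_ge P 0 (m $ i $ j / ?a)" for i j
    proof -
      have "val_ge P (0 - ord P (inverse ?a)) (m $ i $ j)" using min a0 by (simp add: minimal_def ord_inverse)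
      then have "val_ge P 0 (inverse ?a * m $ i $ j)" using a0 by (subst val_ge_mult_iff) auto
      then show ?thesis by (simp add: divide_inverse mult.commute)
    qed
    define y where "y = ?d - ?c * ?b / ?a"
    define k where "k = mat2 1 0 (?c / ?a) 1"
    define l where "l = mat2 1 (?b / ?a) 0 1"
    have k: "unimod P k" unfolding k_def by (rule unimod_mat2) (simp_all add: int)
    have l: "unimod P l" unfolding l_def by (rule unimod_mat2) (simp_all add: int)
    have m: "m = k ** mat2 ?a 0 0 y ** l"
      by (rule mat2_eqI) (use a0 in \<open>simp_all add: matrix_mult_nth_2 k_def l_def y_def\<close>)
    have "y \<noteq> 0"
    proof
      assume "y = 0"
      have "det m = ?a * ?d - ?b * ?c" by (simp add: det_2)
      also have "\<dots> = ?a * y" using a0 by (simp add: y_def field_simps)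
      finally have "det m = 0" using \<open>y = 0\<close> by simp
      then show False using that(1) invertible_det_nz by blast
    qed
    then show ?thesis unfolding good_def
      by (intro exI[of _ k] exI[of _ l] exI[of _ ?a] exI[of _ y] conjI k l m a0)
  qed
  have inv: "invertible w" using w unimodD by blast
  have good12: "good m" if m: "invertible m" and min: "minimal m 1 2" for m
  proof -
    have "minimal (m ** w) 1 1" using min
      by (simp add: minimal_def matrix_mult_nth_2 forall_2 w_def)
    then show ?thesis using good11 good_right matrix_inv_mult(2)[OF m inv] by blast
  qed
  have "\<exists>i j. minimal m i j"
  proof -
    have "m \<noteq> 0"
    proof
      assume "m = 0"
      then have "det m = 0" by (simp add: det_2)
      then show False using assms invertible_det_nz by blast
    qed
    then have ne: "\<exists>i j. m $ i $ j \<noteq> 0" by (simp add: vec_eq_iff)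
    define S where "S = {(i, j). m $ i $ j \<noteq> 0}"
    have "finite S" "S \<noteq> {}" using ne by (auto simp: S_def intro: finite_subset[OF subset_UNIV])
    define f where "f p = ord P (m $ fst p $ snd p)" for p
    have "Min (f ` S) \<in> f ` S" using \<open>finite S\<close> \<open>S \<noteq> {}\<close> by (intro Min_in) auto
    then obtain p where "Min (f ` S) = f p" "p \<in> S" by (rule imageE)
    then have p: "p \<in> S" "\<forall>q\<in>S. f p \<le> f q"
      using Min_le[of "f ` S"] \<open>finite S\<close> by auto
    have "minimal m (fst p) (snd p)"
      unfolding minimal_def
    proof (intro conjI allI)
      show "m $ fst p $ snd p \<noteq> 0" using p(1) by (auto simp: S_def)
      show "val_ge P (ord P (m $ fst p $ snd p)) (m $ i' $ j')" for i' j'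
      proof (cases "m $ i' $ j' = 0")
        case False
        then have "(i', j') \<in> S" by (simp add: S_def)
        then have "f p \<le> f (i', j')" using p(2) by blast
        then show ?thesis using False by (simp add: val_ge_iff f_def)
      qed simp
    qed
    then show ?thesis by blast
  qed
  then obtain i j where min: "minimal m i j" by blast
  have "good m"
  proof (cases "i = 1")
    case True
    then show ?thesis using min assms good11 good12 exhaust_2[of j] by metis
  next
    case False
    then have "i = 2" using exhaust_2[of i] by blast
    then have "minimal (w ** m) 1 j" using min exhaust_2[of j]
      by (auto simp: minimal_def matrix_mult_nth_2 forall_2 w_def)
    moreover have "invertible (w ** m)" using matrix_inv_mult(2)[OF inv assms] .
    ultimately show ?thesis using good11 good12 good_left exhaust_2[of j] by metis
  qed
  then show ?thesis unfolding good_def by (elim exE conjE) (rule that)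
qed

lemma intmat_conj_diag:
  assumes "x \<noteq> 0" "y \<noteq> 0"
  shows "intmat P (matrix_conj (mat2 x 0 0 y) b) \<longleftrightarrow> val_ge P 0 (b $ 1 $ 1) \<and> val_ge P (ord P x - ord P y) (b $ 1 $ 2) \<and>
     val_ge P (ord P y - ord P x) (b $ 2 $ 1) \<and> val_ge P 0 (b $ 2 $ 2)"
proof -
  have "val_ge P 0 (y * b $ 1 $ 2 / x) \<longleftrightarrow> val_ge P (ord P x - ord P y) (b $ 1 $ 2)"
    using assms val_ge_mult_iff[of "y / x" P 0 "b $ 1 $ 2"] by (simp add: ord_divide)
  moreover have "val_ge P 0 (x * b $ 2 $ 1 / y) \<longleftrightarrow> val_ge P (ord P y - ord P x) (b $ 2 $ 1)"
    using assms val_ge_mult_iff[of "x / y" P 0 "b $ 2 $ 1"] by (simp add: ord_divide)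
  ultimately show ?thesis
    using assms by (simp add: matrix_conj_def matrix_inv_mat2 intmat_2 matrix_mult_nth_2 mult.commute)
qed

lemma relative_position:
  fixes g g' :: "'a::field ratfun^2^2"
  assumes g: "invertible g" and g': "invertible g'"
  obtains k d where "unimod P k" "\<And>a. intmat P (matrix_conj g' a) \<longleftrightarrow> stdmat P d (matrix_conj (g ** k) a)"
proof -
  have i: "invertible (matrix_inv g ** g')" using g g' by (simp add: matrix_inv_mult invertible_matrix_inv)
  obtain k l x y where *: "unimod P k" "unimod P l" "x \<noteq> 0" "y \<noteq> 0" "matrix_inv g ** g' = k ** mat2 x 0 0 y ** l"
    by (rule unimod_diagonalization[OF i])
  have "g' = (g ** matrix_inv g) ** g'" using g by (simp add: matrix_inv_inverse)
  also have "\<dots> = g ** (matrix_inv g ** g')" by (simp only: matrix_mul_assoc)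
  also have "\<dots> = ((g ** k) ** mat2 x 0 0 y) ** l" unfolding *(5) by (simp only: matrix_mul_assoc)
  finally have g'eq: "g' = ((g ** k) ** mat2 x 0 0 y) ** l" .
  have D: "invertible (mat2 x 0 0 y)" using * by (intro matrix_inv_mat2) auto
  have gk: "invertible (g ** k)" using matrix_inv_mult(2)[OF g] unimodD(1)[OF *(1)] by blast
  have matrix_conj': "intmat P (matrix_conj g' a) \<longleftrightarrow> intmat P (matrix_conj (mat2 x 0 0 y) (matrix_conj (g ** k) a))" for a
  proof -
    have "matrix_conj g' a = matrix_conj l (matrix_conj ((g ** k) ** mat2 x 0 0 y) a)"
      unfolding g'eq by (rule conj_mult) (use matrix_inv_mult(2)[OF gk D] unimodD(1)[OF *(2)] in auto)
    then show ?thesis using intmat_conj[OF *(2)] conj_mult[OF gk D] by simp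
  qed
  show ?thesis
  proof (cases "ord P x \<ge> ord P y")
    case True
    have "intmat P (matrix_conj g' a) \<longleftrightarrow> stdmat P (nat (ord P x - ord P y)) (matrix_conj (g ** k) a)" for a
      unfolding matrix_conj' stdmat_def intmat_conj_diag[OF *(3,4)] using True by simp
    then show ?thesis using that *(1) by blast
  next
    case False
    let ?w = "mat2 0 1 1 0 :: 'a ratfun^2^2"
    have w: "unimod P ?w" by (rule unimod_swap)
    have cw: "matrix_conj ?w b = mat2 (b $ 2 $ 2) (b $ 2 $ 1) (b $ 1 $ 2) (b $ 1 $ 1)" for b
      by (rule mat2_eqI) (simp_all add: matrix_conj_def matrix_inv_mat2 matrix_mult_nth_2)
    have "intmat P (matrix_conj g' a) \<longleftrightarrow> stdmat P (nat (ord P y - ord P x)) (matrix_conj (g ** k ** ?w) a)" for a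
      unfolding matrix_conj' stdmat_def intmat_conj_diag[OF *(3,4)] conj_mult[OF gk unimodD(1)[OF w]] cw
      using False by auto
    then show ?thesis using that[of "k ** ?w"] unimod_mult[OF *(1) w] by (simp add: matrix_mul_assoc)
  qed
qed

section \<open>Reduced bases\<close>

lemma to_fract_power: "to_fract (a ^ n) = to_fract a ^ n"
  by (induction n) (auto simp: to_fract_mult)

lemma ex_poly_with_zeros:
  fixes k :: "'a::field closed_point \<Rightarrow> int"
  assumes "finite B" "\<And>Q. Q \<in> B \<Longrightarrow> equation_of Q \<noteq> None"
  shows "\<exists>f. f \<noteq> 0 \<and> (\<forall>Q. Q \<notin> B \<longrightarrow> equation_of Q \<noteq> None \<longrightarrow> ord Q (to_fract f) = 0) \<and>
    (\<forall>Q\<in>B. k Q \<le> ord Q (to_fract f))"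
  using assms
proof (induction B rule: finite_induct)
  case empty
  then show ?case by (intro exI[of _ 1]) simp
next
  case (insert R B)
  then obtain f where f: "f \<noteq> 0" "\<forall>Q. Q \<notin> B \<longrightarrow> equation_of Q \<noteq> None \<longrightarrow> ord Q (to_fract f) = 0"
    "\<forall>Q\<in>B. k Q \<le> ord Q (to_fract f)" by auto
  obtain r where r: "equation_of R = Some r" using insert.prems[of R] by auto
  then have r0: "r \<noteq> 0" by (rule equation_of_SomeD)
  define f' where "f' = r ^ nat (k R) * f"
  have f'0: "f' \<noteq> 0" using f r0 by (simp add: f'_def)
  have o: "ord Q (to_fract f') = int (nat (k R)) * ord Q (to_fract r) + ord Q (to_fract f)" for Q
  proof -
    have "to_fract f' = to_fract r ^ nat (k R) * to_fract f"
      by (simp add: f'_def to_fract_mult to_fract_power)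
    then show ?thesis using r0 f(1) by (simp add: ord_mult ord_power)
  qed
  have "ord Q (to_fract f') = 0" if Q: "Q \<notin> insert R B" "equation_of Q \<noteq> None" for Q
  proof -
    obtain q where q: "equation_of Q = Some q" using Q(2) by (cases "equation_of Q") auto
    have "R \<noteq> Q" using Q by auto
    then have "ord Q (to_fract r) = 0" by (rule ord_equation_other[OF r q])
    then show ?thesis using f(2) Q by (simp add: o)
  qed
  moreover have "k Q \<le> ord Q (to_fract f')" if "Q \<in> insert R B" for Q
  proof (cases "Q = R")
    case True
    have "ord R (to_fract f) = 0" using f(2) insert.hyps r by simp
    then show ?thesis using True ord_equation_self[OF r] by (simp add: o)
  next
    case False
    then have Q: "Q \<in> B" using that by simp
    then obtain q where q: "equation_of Q = Some q" using insert.prems[of Q] by (cases "equation_of Q") auto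
    have "ord Q (to_fract r) = 0" by (rule ord_equation_other[OF r q]) (use False in simp)
    then show ?thesis using f(3) Q by (simp add: o)
  qed
  ultimately show ?case using f'0 by blast
qed

lemma ex_common_val_ge:
  fixes x :: "'i::finite \<Rightarrow> 'a::field ratfun"
  shows "\<exists>n. \<forall>i. val_ge P n (x i)"
proof -
  have "\<forall>i. \<exists>b. val_ge P b (x i)" using ex_val_ge by blast
  from choice[OF this] obtain b where b: "\<And>i. val_ge P (b i) (x i)" by blast
  have "val_ge P (Min (range b)) (x i)" for i by (rule val_ge_mono[OF b]) simp
  then show ?thesis by blast
qed

definition affine_sections :: "('a::field closed_point \<Rightarrow> 'a ratfun^2^2) \<Rightarrow> ('a ratfun^2) set" where
  "affine_sections g = {x. \<forall>P. equation_of P \<noteq> None \<longrightarrow> x \<in> lat P (g P)}"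

lemma affine_sections_add: "x \<in> affine_sections g \<Longrightarrow> y \<in> affine_sections g \<Longrightarrow> x + y \<in> affine_sections g"
  by (auto simp: affine_sections_def intro: lat_add)

lemma affine_sections_poly: "x \<in> affine_sections g \<Longrightarrow> to_fract f *s x \<in> affine_sections g"
  by (simp add: affine_sections_def lat_smult val_ge_poly)

lemma affine_sections_diff_poly:
  assumes "x \<in> affine_sections g" "y \<in> affine_sections g"
  shows "x - to_fract f *s y \<in> affine_sections g"
proof -
  have "x - to_fract f *s y = x + to_fract (- f) *s y"
    by (simp add: vec_eq_iff)
  then show ?thesis using affine_sections_add[OF assms(1) affine_sections_poly[OF assms(2)]] by (simp only:)
qed

lemma affine_sections_generate:
  fixes g :: "'a::field closed_point \<Rightarrow> 'a ratfun^2^2"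
  assumes g: "local_family g"
  shows "\<exists>f. f \<noteq> 0 \<and> to_fract f *s x \<in> affine_sections g \<and>
    (\<forall>P. equation_of P \<noteq> None \<longrightarrow> x \<in> lat P (g P) \<longrightarrow> ord P (to_fract f) = 0)"
proof -
  define B where "B = {P. equation_of P \<noteq> None \<and> x \<notin> lat P (g P)}"
  have "finite {P. x \<notin> lat P (g P)}" using g finite_not_in_lat by (auto simp: local_family_def)
  then have "finite B" unfolding B_def by (rule rev_finite_subset) auto
  have "\<exists>n. \<forall>i. val_ge P n ((matrix_inv (g P) *v x) $ i)" for P by (rule ex_common_val_ge)
  then obtain n where n: "\<And>P i. val_ge P (n P) ((matrix_inv (g P) *v x) $ i)" by metis
  obtain f where f: "f \<noteq> 0" "\<forall>Q. Q \<notin> B \<longrightarrow> equation_of Q \<noteq> None \<longrightarrow> ord Q (to_fract f) = 0"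
    "\<forall>Q\<in>B. - n Q \<le> ord Q (to_fract f)"
    using ex_poly_with_zeros[OF \<open>finite B\<close>, of "\<lambda>Q. - n Q"] by (auto simp: B_def)
  have "to_fract f *s x \<in> lat P (g P)" if P: "equation_of P \<noteq> None" for P
  proof (cases "P \<in> B")
    case True
    then have "val_ge P (0 - ord P (to_fract f)) ((matrix_inv (g P) *v x) $ i)" for i
      using f(3) by (intro val_ge_mono[OF n]) auto
    then show ?thesis using f(1)
      by (simp add: lat_def intvec_def matrix_vector_smult_2 val_ge_mult_iff)
  next
    case False
    then have "x \<in> lat P (g P)" using P by (simp add: B_def)
    then show ?thesis using P by (simp add: lat_smult val_ge_poly)
  qed
  then show ?thesis using f(1,2) by (intro exI[of _ f]) (auto simp: affine_sections_def B_def)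
qed

lemma affine_sections_denominator:
  fixes g :: "'a::field closed_point \<Rightarrow> 'a ratfun^2^2"
  assumes g: "local_family g"
  shows "\<exists>f. f \<noteq> 0 \<and> (\<forall>x\<in>affine_sections g. \<forall>i. \<exists>a. to_fract f * x $ i = to_fract a)"
proof -
  define B where "B = {P. equation_of P \<noteq> None \<and> g P \<noteq> mat 1}"
  have "finite {P. g P \<noteq> mat 1}" using g by (auto simp: local_family_def)
  then have "finite B" unfolding B_def by (rule rev_finite_subset) auto
  have "\<exists>n. \<forall>p. val_ge P n (g P $ fst p $ snd p)" for P by (rule ex_common_val_ge)
  then obtain n where n: "\<And>P p. val_ge P (n P) (g P $ fst p $ snd p)" by metis
  obtain f where f: "f \<noteq> 0" "\<forall>Q. Q \<notin> B \<longrightarrow> equation_of Q \<noteq> None \<longrightarrow> ord Q (to_fract f) = 0"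
    "\<forall>Q\<in>B. - n Q \<le> ord Q (to_fract f)"
    using ex_poly_with_zeros[OF \<open>finite B\<close>, of "\<lambda>Q. - n Q"] by (auto simp: B_def)
  have int: "val_ge P 0 (to_fract f * g P $ i $ j)" if P: "equation_of P \<noteq> None" for P i j
  proof (cases "P \<in> B")
    case True
    have "val_ge P (0 - ord P (to_fract f)) (g P $ i $ j)"
    proof (rule val_ge_mono)
      show "val_ge P (n P) (g P $ i $ j)" using n[of P "(i, j)"] by simp
      show "0 - ord P (to_fract f) \<le> n P" using bspec[OF f(3) True] by simp
    qed
    then show ?thesis using f(1) by (simp add: val_ge_mult_iff)
  next
    case False
    then have "g P = mat 1" using P by (simp add: B_def)
    then show ?thesis using val_ge_poly[OF P] by (simp add: mat_def)
  qed
  have "\<exists>a. to_fract f * x $ i = to_fract a" if x: "x \<in> affine_sections g" for x i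
  proof -
    have "val_ge P 0 (to_fract f * x $ i)" if P: "equation_of P \<noteq> None" for P
    proof -
      define y where "y = matrix_inv (g P) *v x"
      have y: "val_ge P 0 (y $ j)" for j using x P by (simp add: affine_sections_def lat_def intvec_def y_def)
      have "x = g P *v y"
        using g by (simp add: y_def matrix_vector_mul_assoc matrix_inv_inverse local_family_def)
      then have "to_fract f * x $ i = (to_fract f * g P $ i $ 1) * y $ 1 + (to_fract f * g P $ i $ 2) * y $ 2"
        by (simp add: matrix_vector_mult_nth_2 algebra_simps)
      then show ?thesis using int[OF P] y by (simp add: val_ge_add val_ge_mult0)
    qed
    then obtain a where "to_fract f * x $ i = to_fract a" using integral_finite_imp_poly by blast
    then show ?thesis by blast
  qed
  then show ?thesis using f(1) by blast
qed

definition vge :: "'a::field closed_point \<Rightarrow> 'a ratfun^2^2 \<Rightarrow> int \<Rightarrow> 'a ratfun^2 \<Rightarrow> bool" where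
  "vge P G n x \<longleftrightarrow> (\<forall>i. val_ge P n ((matrix_inv G *v x) $ i))"

lemma vge_add: "vge P G n x \<Longrightarrow> vge P G n y \<Longrightarrow> vge P G n (x + y)"
  by (auto simp: vge_def matrix_vector_right_distrib intro: val_ge_add)

lemma vge_smult_iff: "c \<noteq> 0 \<Longrightarrow> vge P G n (c *s x) \<longleftrightarrow> vge P G (n - ord P c) x"
  by (simp add: vge_def matrix_vector_smult_2 val_ge_mult_iff)

lemma vge_smult: "val_ge P m c \<Longrightarrow> vge P G n x \<Longrightarrow> vge P G (m + n) (c *s x)"
  by (simp add: vge_def matrix_vector_smult_2 val_ge_mult)

lemma vge_uminus: "vge P G n x \<Longrightarrow> vge P G n (- x)"
  using vge_smult[of P 0 "-1" G n x] by simp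

lemma vge_mono: "vge P G n x \<Longrightarrow> m \<le> n \<Longrightarrow> vge P G m x"
  by (auto simp: vge_def intro: val_ge_mono)

lemma lat_eq_vge: "lat P G = {x. vge P G 0 x}"
  by (simp add: lat_def vge_def intvec_def)

lemma ex_vector_norm:
  assumes G: "invertible G"
  shows "\<exists>N. \<forall>x. x \<noteq> 0 \<longrightarrow> (\<forall>n. vge P G n x \<longleftrightarrow> n \<le> N x)"
proof -
  have "\<exists>N. \<forall>n. vge P G n x \<longleftrightarrow> n \<le> N" if x: "x \<noteq> 0" for x
  proof -
    define y where "y = matrix_inv G *v x"
    have "x = G *v y" using G by (simp add: y_def matrix_vector_mul_assoc matrix_inv_inverse)
    then have "y \<noteq> 0" using x by auto
    then have ne: "y $ 1 \<noteq> 0 \<or> y $ 2 \<noteq> 0" by (auto simp: vec_eq_iff forall_2)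
    have v: "vge P G n x \<longleftrightarrow> val_ge P n (y $ 1) \<and> val_ge P n (y $ 2)" for n
      by (simp add: vge_def y_def forall_2)
    show ?thesis
    proof (cases "y $ 1 = 0 \<or> y $ 2 = 0")
      case True
      then show ?thesis using ne v by (auto simp: val_ge_iff)
    next
      case False
      then have "\<forall>n. vge P G n x \<longleftrightarrow> n \<le> min (ord P (y $ 1)) (ord P (y $ 2))" by (simp add: v val_ge_iff)
      then show ?thesis by blast
    qed
  qed
  then show ?thesis by metis
qed

lemma affine_sections_norm_bounded:
  fixes g :: "'a::field closed_point \<Rightarrow> 'a ratfun^2^2"
  assumes g: "local_family g" and I: "equation_of I = None"
  shows "\<exists>C. \<forall>x n. x \<in> affine_sections g \<longrightarrow> x \<noteq> 0 \<longrightarrow> vge I (g I) n x \<longrightarrow> n \<le> C"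
proof -
  obtain f where f: "f \<noteq> 0" "\<forall>x\<in>affine_sections g. \<forall>i. \<exists>a. to_fract f * x $ i = to_fract a"
    using affine_sections_denominator[OF g] by blast
  have "\<exists>e. \<forall>p. val_ge I e (g I $ fst p $ snd p)" by (rule ex_common_val_ge)
  then obtain e where e: "\<And>i j. val_ge I e (g I $ i $ j)" by (metis fst_conv snd_conv)
  have "n \<le> - ord I (to_fract f) - e" if x: "x \<in> affine_sections g" "x \<noteq> 0" "vge I (g I) n x" for x n
  proof -
    obtain i where i: "x $ i \<noteq> 0" using x(2) by (auto simp: vec_eq_iff)
    define y where "y = matrix_inv (g I) *v x"
    have y: "val_ge I n (y $ j)" for j using x(3) by (simp add: vge_def y_def)
    have "x = g I *v y"
      using g by (simp add: y_def matrix_vector_mul_assoc matrix_inv_inverse local_family_def)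
    then have "x $ i = g I $ i $ 1 * y $ 1 + g I $ i $ 2 * y $ 2"
      by (simp add: matrix_vector_mult_nth_2)
    then have "val_ge I (e + n) (x $ i)" using val_ge_mult[OF e y] by (simp only: val_ge_add)
    then have 1: "e + n \<le> ord I (x $ i)" using i by (simp add: val_ge_iff)
    obtain a where a: "to_fract f * x $ i = to_fract a" using f(2) x(1) by blast
    then have "a \<noteq> 0" using i f(1) by auto
    then have "ord I (to_fract f * x $ i) \<le> 0" using I by (simp add: a ord_to_fract ord_poly_infinity)
    then have "ord I (to_fract f) + ord I (x $ i) \<le> 0" using i f(1) by (simp add: ord_mult)
    then show ?thesis using 1 by simp
  qed
  then show ?thesis by blast
qed

text \<open>Successive minima: \<open>v\<^sub>1\<close> is a shortest nonzero vector, for the norm given by the lattice at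
  infinity, of the module of sections over the affine line, and \<open>v\<^sub>2\<close> is a shortest one
  independent of \<open>v\<^sub>1\<close>. As the norm is ultrametric and every function is the sum of a polynomial and
  of a function that vanishes at infinity, these two vectors generate the module and
  are orthogonal at infinity.\<close>

lemma reduced_basis:
  fixes g :: "'a::field closed_point \<Rightarrow> 'a ratfun^2^2"
  assumes g: "local_family g"
  obtains h a b where "invertible h" "a \<le> b"
    "\<forall>P. equation_of P \<noteq> None \<longrightarrow> lat P (g P) = lat P h"
    "\<forall>P. equation_of P = None \<longrightarrow> lat P (g P) =
       {x. val_ge P a ((matrix_inv h *v x) $ 1) \<and> val_ge P b ((matrix_inv h *v x) $ 2)}"
proof -
  obtain I :: "'a closed_point" where I: "equation_of I = None" using ex_infinity by blast
  let ?M = "affine_sections g" and ?v = "vge I (g I)"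
  have "invertible (g I)" using g by (simp add: local_family_def)
  then obtain N where N: "\<And>x n. x \<noteq> 0 \<Longrightarrow> ?v n x \<longleftrightarrow> n \<le> N x" using ex_vector_norm by metis
  obtain C where "\<forall>x n. x \<in> ?M \<longrightarrow> x \<noteq> 0 \<longrightarrow> ?v n x \<longrightarrow> n \<le> C"
    using affine_sections_norm_bounded[OF g I] by blast
  then have C: "N x \<le> C" if "x \<in> ?M" "x \<noteq> 0" for x using that N[of x "N x"] by blast
  have ex_max: "\<exists>v. Q v \<and> (\<forall>x. Q x \<longrightarrow> N x \<le> N v)" if Qx: "Q x" and QM: "\<And>x. Q x \<Longrightarrow> x \<in> ?M \<and> x \<noteq> 0" for Q x
  proof -
    have "\<exists>v. Q v \<and> (\<forall>y. Q y \<longrightarrow> nat (C - N v) \<le> nat (C - N y))"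
      by (rule ex_has_least_nat[of Q x "\<lambda>x. nat (C - N x)", OF Qx])
    then obtain v where v: "Q v" "\<forall>y. Q y \<longrightarrow> nat (C - N v) \<le> nat (C - N y)" by (elim exE conjE)
    have "N y \<le> N v" if "Q y" for y
    proof -
      have "nat (C - N v) \<le> nat (C - N y)" "N y \<le> C" "N v \<le> C" using v that C QM by blast+
      then show ?thesis by simp
    qed
    then show ?thesis using v(1) by blast
  qed
  have gen: "\<exists>f. f \<noteq> 0 \<and> to_fract f *s x \<in> ?M" for x using affine_sections_generate[OF g] by blast
  have smult_nz: "c *s x \<noteq> 0" if "c \<noteq> 0" "x \<noteq> 0" for c and x :: "'a ratfun^2" using that by simp
  obtain v1 where v1: "v1 \<in> ?M" "v1 \<noteq> 0" and max1: "\<And>x. x \<in> ?M \<Longrightarrow> x \<noteq> 0 \<Longrightarrow> N x \<le> N v1"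
  proof -
    obtain f where f: "f \<noteq> 0" "to_fract f *s vec2 1 0 \<in> ?M" using gen by blast
    have "vec2 1 0 \<noteq> (0 :: 'a ratfun^2)" by (metis vec2_nth(1) zero_index zero_neq_one)
    then have "to_fract f *s vec2 1 0 \<noteq> (0 :: 'a ratfun^2)" using f(1) by (intro smult_nz) simp_all
    then show ?thesis using ex_max[of "\<lambda>x. x \<in> ?M \<and> x \<noteq> 0"] f(2) that by blast
  qed
  define indep where "indep x \<longleftrightarrow> (\<forall>c. x \<noteq> c *s v1)" for x
  have indep_nz: "x \<noteq> 0" if "indep x" for x using that[unfolded indep_def, rule_format, of 0] by auto
  have "\<exists>x. indep x"
  proof (rule ccontr)
    assume "\<not> ?thesis"
    then obtain c d where c: "vec2 1 0 = c *s v1" and d: "vec2 0 1 = d *s v1" unfolding indep_def by blast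
    have "c * v1 $ 1 = 1" "c * v1 $ 2 = 0" using arg_cong[OF c, of "\<lambda>x. x $ 1"] arg_cong[OF c, of "\<lambda>x. x $ 2"] by auto
    then have "v1 $ 2 = 0" by auto
    moreover have "d * v1 $ 2 = 1" using arg_cong[OF d, of "\<lambda>x. x $ 2"] by auto
    ultimately show False by simp
  qed
  then obtain x0 where x0: "indep x0" by blast
  obtain v2 where v2: "v2 \<in> ?M" "indep v2" and max2: "\<And>x. x \<in> ?M \<Longrightarrow> indep x \<Longrightarrow> N x \<le> N v2"
  proof -
    obtain f where f: "f \<noteq> 0" "to_fract f *s x0 \<in> ?M" using gen by blast
    have "indep (to_fract f *s x0)" unfolding indep_def
    proof (intro allI notI)
      fix c assume "to_fract f *s x0 = c *s v1"
      then have "inverse (to_fract f) *s (to_fract f *s x0) = (inverse (to_fract f) * c) *s v1"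
        by (simp add: vector_smult_assoc)
      then have "x0 = (inverse (to_fract f) * c) *s v1" using f(1) by (simp add: vector_smult_assoc)
      then show False using x0 unfolding indep_def by blast
    qed
    then show ?thesis using ex_max[of "\<lambda>x. x \<in> ?M \<and> indep x"] f(2) that indep_nz by blast
  qed
  have v2nz: "v2 \<noteq> 0" using indep_nz v2(2) .
  have N21: "N v2 \<le> N v1" using max1[OF v2(1) v2nz] .
  have indepI: "indep (\<alpha> *s v1 + \<beta> *s v2)" if "\<beta> \<noteq> 0" for \<alpha> \<beta>
    unfolding indep_def
  proof (intro allI notI)
    fix c assume "\<alpha> *s v1 + \<beta> *s v2 = c *s v1"
    then have "\<beta> *s v2 = (c - \<alpha>) *s v1" by (simp add: vector_ssub_ldistrib algebra_simps vec_eq_iff)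
    then have "inverse \<beta> *s (\<beta> *s v2) = inverse \<beta> *s ((c - \<alpha>) *s v1)" by (rule arg_cong)
    then have "v2 = (inverse \<beta> * (c - \<alpha>)) *s v1"
      by (simp only: vector_smult_assoc left_inverse[OF that] vector_smult_lid)
    then show False using v2(2) unfolding indep_def by blast
  qed
  define e where "e i = (if i = 0 then v1 else v2)" for i :: nat
  define h where "h = basis_mat e"
  have hv: "h *v y = y $ 1 *s v1 + y $ 2 *s v2" for y
    by (rule vec2_eqI) (simp_all add: h_def basis_mat_def e_def matrix_vector_mult_nth_2 mult.commute)
  have "\<forall>c. (\<Sum>i<2::nat. c i *s e i) = 0 \<longrightarrow> (\<forall>i<2. c i = 0)"
  proof (intro allI impI)
    fix c :: "nat \<Rightarrow> 'a ratfun" and i :: nat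
    assume "(\<Sum>i<2. c i *s e i) = 0" and i: "i < 2"
    then have s: "c 0 *s v1 + c 1 *s v2 = 0" by (simp add: lessThan_2 e_def)
    have c1: "c 1 = 0" using indep_nz[OF indepI[of "c 1" "c 0"]] s by blast
    then have "c 0 *s v1 = 0" using s by simp
    then have "c 0 = 0" using v1(2) smult_nz by blast
    then show "c i = 0" using c1 i by (cases "i = 0") (auto simp: less_2_cases_iff)
  qed
  then have h: "invertible h" unfolding h_def by (rule iffD1[OF basis_mat_invertible_iff])
  have coords: "x = (matrix_inv h *v x) $ 1 *s v1 + (matrix_inv h *v x) $ 2 *s v2" for x
    using hv[of "matrix_inv h *v x"] h by (simp add: matrix_vector_mul_assoc matrix_inv_inverse)
  have hinv: "matrix_inv h *v (h *v y) = y" for y using h by (simp add: matrix_vector_mul_assoc matrix_inv_inverse)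
  have vN: "?v (m + N x) (c *s x)" if "val_ge I m c" "x \<noteq> 0" for m c x
    using vge_smult[OF that(1)] N[OF that(2)] by blast
  have polys: "\<exists>p q. \<alpha> = to_fract p \<and> \<beta> = to_fract q" if M: "\<alpha> *s v1 + \<beta> *s v2 \<in> ?M" for \<alpha> \<beta>
  proof -
    obtain p where p: "val_ge I 1 (\<alpha> - to_fract p)" using polynomial_part[OF I] by blast
    obtain q where q: "val_ge I 1 (\<beta> - to_fract q)" using polynomial_part[OF I] by blast
    define x where "x = (\<alpha> - to_fract p) *s v1 + (\<beta> - to_fract q) *s v2"
    have "x = (\<alpha> *s v1 + \<beta> *s v2 - to_fract p *s v1) - to_fract q *s v2"
      by (simp add: x_def vec_eq_iff algebra_simps)
    then have xM: "x \<in> ?M" using M v1(1) v2(1) by (simp add: affine_sections_diff_poly)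
    have v: "?v (1 + N v1) ((\<alpha> - to_fract p) *s v1)" "?v (1 + N v2) ((\<beta> - to_fract q) *s v2)"
      using vN p q v1(2) v2nz by blast+
    have \<beta>: "\<beta> - to_fract q = 0"
    proof (rule ccontr)
      assume "\<beta> - to_fract q \<noteq> 0"
      then have ix: "indep x" unfolding x_def by (rule indepI)
      have "?v (1 + N v2) x" unfolding x_def using v N21 by (intro vge_add vge_mono[OF v(1)]) auto
      then have "1 + N v2 \<le> N x" using N[OF indep_nz[OF ix]] by blast
      then show False using max2[OF xM ix] by simp
    qed
    have "\<alpha> - to_fract p = 0"
    proof (rule ccontr)
      assume "\<alpha> - to_fract p \<noteq> 0"
      note nz = this v1(2)
      have x: "x = (\<alpha> - to_fract p) *s v1" unfolding x_def \<beta> by simp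
      have xnz: "x \<noteq> 0" unfolding x by (rule smult_nz) (rule nz)+
      have "?v (1 + N v1) x" unfolding x by (rule v(1))
      then have "1 + N v1 \<le> N x" using N[OF xnz] by blast
      then show False using max1[OF xM xnz] by simp
    qed
    with \<beta> have "\<alpha> = to_fract p" "\<beta> = to_fract q" by simp_all
    then show ?thesis by blast
  qed
  have finite_part: "lat P (g P) = lat P h" if P: "equation_of P \<noteq> None" for P
  proof (intro equalityI subsetI)
    fix x assume x: "x \<in> lat P (g P)"
    obtain f where f: "f \<noteq> 0" "to_fract f *s x \<in> ?M" "ord P (to_fract f) = 0"
      using affine_sections_generate[OF g, of x] x P by blast
    let ?y = "matrix_inv h *v x"
    have "to_fract f *s x = (to_fract f * ?y $ 1) *s v1 + (to_fract f * ?y $ 2) *s v2"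
      using arg_cong[OF coords[of x], of "\<lambda>z. to_fract f *s z"] by (simp add: vector_add_ldistrib vector_smult_assoc)
    then obtain p q where "to_fract f * ?y $ 1 = to_fract p" "to_fract f * ?y $ 2 = to_fract q"
      using polys[of "to_fract f * ?y $ 1" "to_fract f * ?y $ 2"] f(2) by auto
    then have "val_ge P 0 (to_fract f * ?y $ 1)" "val_ge P 0 (to_fract f * ?y $ 2)"
      using val_ge_poly[OF P] by simp_all
    then have "val_ge P 0 (?y $ 1)" "val_ge P 0 (?y $ 2)" using f by (simp_all add: val_ge_mult_iff)
    then show "x \<in> lat P h" by (simp add: lat_def intvec_2)
  next
    fix x assume "x \<in> lat P h"
    then have "val_ge P 0 ((matrix_inv h *v x) $ 1)" "val_ge P 0 ((matrix_inv h *v x) $ 2)" by (simp_all add: lat_def intvec_2)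
    moreover have "v1 \<in> lat P (g P)" "v2 \<in> lat P (g P)" using v1(1) v2(1) P by (simp_all add: affine_sections_def)
    ultimately show "x \<in> lat P (g P)" by (subst coords) (intro lat_add lat_smult)
  qed
  have orth: "?v n (\<alpha> *s v1 + \<beta> *s v2) \<longleftrightarrow> val_ge I (n - N v1) \<alpha> \<and> val_ge I (n - N v2) \<beta>" for n \<alpha> \<beta>
  proof
    assume "val_ge I (n - N v1) \<alpha> \<and> val_ge I (n - N v2) \<beta>"
    then show "?v n (\<alpha> *s v1 + \<beta> *s v2)"
      using vN[of "n - N v1" \<alpha> v1] vN[of "n - N v2" \<beta> v2] v1(2) v2nz by (simp add: vge_add)
  next
    assume x: "?v n (\<alpha> *s v1 + \<beta> *s v2)"
    have \<beta>: "val_ge I (n - N v2) \<beta>"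
    proof (rule ccontr)
      assume "\<not> val_ge I (n - N v2) \<beta>"
      then have b0: "\<beta> \<noteq> 0" and lt: "ord I \<beta> < n - N v2" by (auto simp: val_ge_def)
      define \<gamma> where "\<gamma> = inverse \<beta> * \<alpha>"
      have "\<beta> * \<gamma> = \<alpha>" using b0 by (simp add: \<gamma>_def mult.assoc[symmetric])
      then have "\<alpha> *s v1 + \<beta> *s v2 = \<beta> *s (\<gamma> *s v1 + v2)"
        by (simp add: vector_add_ldistrib vector_smult_assoc)
      then have "?v n (\<beta> *s (\<gamma> *s v1 + v2))" using x by (simp only:)
      then have "?v (n - ord I \<beta>) (\<gamma> *s v1 + v2)" using vge_smult_iff[OF b0] by blast
      then have y: "?v (1 + N v2) (\<gamma> *s v1 + v2)" by (rule vge_mono) (use lt in simp)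
      obtain p where p: "val_ge I 1 (\<gamma> - to_fract p)" using polynomial_part[OF I] by blast
      have "?v (1 + N v1) ((\<gamma> - to_fract p) *s v1)" using vN[OF p v1(2)] .
      then have "?v (1 + N v2) (- ((\<gamma> - to_fract p) *s v1))" using N21 by (intro vge_uminus) (rule vge_mono, auto)
      then have "?v (1 + N v2) ((\<gamma> *s v1 + v2) + - ((\<gamma> - to_fract p) *s v1))" using y by (rule vge_add[rotated])
      moreover have "(\<gamma> *s v1 + v2) + - ((\<gamma> - to_fract p) *s v1) = to_fract p *s v1 + 1 *s v2"
        by (simp add: vec_eq_iff algebra_simps)
      ultimately have z: "?v (1 + N v2) (to_fract p *s v1 + 1 *s v2)" by (simp only:)
      have iz: "indep (to_fract p *s v1 + 1 *s v2)" by (rule indepI) simp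
      have "to_fract p *s v1 + 1 *s v2 \<in> ?M" using v1(1) v2(1) by (simp add: affine_sections_add affine_sections_poly)
      from max2[OF this iz] show False using N[OF indep_nz[OF iz]] z by force
    qed
    have "?v n (\<beta> *s v2)" using vN[OF \<beta> v2nz] by simp
    then have "?v n ((\<alpha> *s v1 + \<beta> *s v2) + - (\<beta> *s v2))" by (rule vge_add[OF x vge_uminus])
    then have a: "?v n (\<alpha> *s v1)" by simp
    have "val_ge I (n - N v1) \<alpha>"
    proof (cases "\<alpha> = 0")
      case False
      then have "n - ord I \<alpha> \<le> N v1" using a N[OF v1(2)] by (simp add: vge_smult_iff)
      then show ?thesis using False by (simp add: val_ge_iff)
    qed simp
    then show "val_ge I (n - N v1) \<alpha> \<and> val_ge I (n - N v2) \<beta>" using \<beta> by blast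
  qed
  have "lat P (g P) = {x. val_ge P (- N v1) ((matrix_inv h *v x) $ 1) \<and> val_ge P (- N v2) ((matrix_inv h *v x) $ 2)}"
    if "equation_of P = None" for P
  proof -
    have P: "P = I" by (rule equation_of_inject2) (simp add: that I)
    have "?v 0 x \<longleftrightarrow> val_ge I (- N v1) ((matrix_inv h *v x) $ 1) \<and> val_ge I (- N v2) ((matrix_inv h *v x) $ 2)" for x
      using orth[of 0 "(matrix_inv h *v x) $ 1" "(matrix_inv h *v x) $ 2"] coords[of x] by simp
    then show ?thesis unfolding P lat_eq_vge by blast
  qed
  then show ?thesis using that[OF h, of "- N v1" "- N v2"] finite_part N21 by simp
qed

section \<open>Eichler orders from local data\<close>

definition level_order :: "('a::field) divisor \<Rightarrow> ('a closed_point \<Rightarrow> 'a ratfun^2^2) \<Rightarrow> 'a order_sheaf" where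
  "level_order D e U = {a. \<forall>P\<in>U. intmat P (matrix_conj (e P) a) \<and>
     val_ge P (Poly_Mapping.lookup D P) (matrix_conj (e P) a $ 1 $ 2)}"

lemma intmat_and_stdmat:
  "intmat P b \<and> stdmat P d b \<longleftrightarrow> intmat P b \<and> val_ge P (int d) (b $ 1 $ 2)"
  by (auto simp: intmat_2 stdmat_def intro: val_ge_mono)

lemma eichler_order_iff:
  fixes D :: "('a::field) divisor"
  assumes "effective D"
  shows "eichler_order_of_level D E \<longleftrightarrow>
    (\<exists>e. local_family e \<and> (\<forall>U. zopen U \<longrightarrow> E U = level_order D e U))"
proof
  assume "eichler_order_of_level D E"
  then obtain R R' where R: "maximal_order R" and R': "maximal_order R'"
    and E: "\<And>U. zopen U \<Longrightarrow> E U = R U \<inter> R' U"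
    and dist: "\<And>P. \<exists>d. Poly_Mapping.lookup D P = int d \<and> at_distance P d (complete_at P R) (complete_at P R')"
    unfolding eichler_order_of_level_def by blast
  obtain g where g: "local_family g" and Rg: "\<And>U. zopen U \<Longrightarrow> R U = order_at g U" using R maximal_order_iff by metis
  obtain g' where g': "local_family g'" and Rg': "\<And>U. zopen U \<Longrightarrow> R' U = order_at g' U" using R' maximal_order_iff by metis
  have inv: "invertible (g P)" "invertible (g' P)" for P using g g' by (auto simp: local_family_def)
  have "\<forall>P. \<exists>k. unimod P k \<and> (\<forall>a. intmat P (matrix_conj (g' P) a) \<longleftrightarrow> stdmat P (nat (Poly_Mapping.lookup D P)) (matrix_conj (g P ** k) a))"
  proof
    fix P
    obtain k d where k: "unimod P k" "\<And>a. intmat P (matrix_conj (g' P) a) \<longleftrightarrow> stdmat P d (matrix_conj (g P ** k) a)"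
      using relative_position[OF inv] by blast
    have gk: "invertible (g P ** k)" using matrix_inv_mult(2)[OF inv(1) unimodD(1)[OF k(1)]] .
    have "at_distance P d (complete_at P R) (complete_at P R')"
    proof (rule at_distanceI[OF gk])
      show "stalk R P = {a. intmat P (matrix_conj (g P ** k) a)}"
        unfolding conj_mult[OF inv(1) unimodD(1)[OF k(1)]] intmat_conj[OF k(1)]
        by (rule stalk_order_at[OF g]) (rule Rg)
      show "stalk R' P = {a. stdmat P d (matrix_conj (g P ** k) a)}"
        unfolding k(2)[symmetric] by (rule stalk_order_at[OF g']) (rule Rg')
    qed
    then have "Poly_Mapping.lookup D P = int d" using dist[of P] at_distance_unique by blast
    then show "\<exists>k. unimod P k \<and> (\<forall>a. intmat P (matrix_conj (g' P) a) \<longleftrightarrow> stdmat P (nat (Poly_Mapping.lookup D P)) (matrix_conj (g P ** k) a))"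
      using k by auto
  qed
  from choice[OF this] obtain k where k: "\<And>P. unimod P (k P)"
    "\<And>P a. intmat P (matrix_conj (g' P) a) \<longleftrightarrow> stdmat P (nat (Poly_Mapping.lookup D P)) (matrix_conj (g P ** k P) a)"
    by blast
  define e where "e P = (if Poly_Mapping.lookup D P = 0 then g P else g P ** k P)" for P
  have gk: "invertible (g P ** k P)" for P using matrix_inv_mult(2)[OF inv(1) unimodD(1)[OF k(1)]] .
  have conj_gk: "intmat P (matrix_conj (g P ** k P) a) \<longleftrightarrow> intmat P (matrix_conj (g P) a)" for P a
    unfolding conj_mult[OF inv(1) unimodD(1)[OF k(1)]] intmat_conj[OF k(1)] ..
  have "{P. e P \<noteq> mat 1} \<subseteq> {P. g P \<noteq> mat 1} \<union> {P. Poly_Mapping.lookup D P \<noteq> 0}"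
    by (auto simp: e_def)
  moreover have "finite ({P. g P \<noteq> mat 1} \<union> {P. Poly_Mapping.lookup D P \<noteq> 0})"
    using g by (simp add: local_family_def)
  ultimately have "finite {P. e P \<noteq> mat 1}" by (rule finite_subset)
  then have "local_family e" using inv gk by (simp add: local_family_def e_def)
  moreover have "E U = level_order D e U" if U: "zopen U" for U
  proof -
    have D0: "Poly_Mapping.lookup D P \<ge> 0" for P using assms by (simp add: effective_def div_le_def)
    have "(intmat P (matrix_conj (g P) a) \<and> intmat P (matrix_conj (g' P) a)) \<longleftrightarrow>
        intmat P (matrix_conj (e P) a) \<and> val_ge P (Poly_Mapping.lookup D P) (matrix_conj (e P) a $ 1 $ 2)" for P a
    proof -
      have *: "(intmat P (matrix_conj (g P) a) \<and> intmat P (matrix_conj (g' P) a)) \<longleftrightarrow>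
         intmat P (matrix_conj (g P ** k P) a) \<and> val_ge P (Poly_Mapping.lookup D P) (matrix_conj (g P ** k P) a $ 1 $ 2)"
        unfolding k(2) conj_gk[symmetric] intmat_and_stdmat using D0 by simp
      show ?thesis
      proof (cases "Poly_Mapping.lookup D P = 0")
        case True
        then show ?thesis unfolding * e_def using conj_gk by (auto simp: intmat_2)
      next
        case False
        then show ?thesis unfolding * e_def by simp
      qed
    qed
    then show ?thesis unfolding E[OF U] Rg[OF U] Rg'[OF U] by (auto simp: order_at_def level_order_def)
  qed
  ultimately show "\<exists>e. local_family e \<and> (\<forall>U. zopen U \<longrightarrow> E U = level_order D e U)" by blast
next
  assume "\<exists>e. local_family e \<and> (\<forall>U. zopen U \<longrightarrow> E U = level_order D e U)"
  then obtain e where e: "local_family e" and E: "\<And>U. zopen U \<Longrightarrow> E U = level_order D e U" by blast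
  have inv: "invertible (e P)" for P using e by (auto simp: local_family_def)
  define d where "d P = nat (Poly_Mapping.lookup D P)" for P
  have D: "Poly_Mapping.lookup D P = int (d P)" for P using assms by (simp add: effective_def div_le_def d_def)
  define x where "x P = uniformizer P ^ d P" for P
  define e' where "e' P = e P ** mat2 (x P) 0 0 1" for P
  have i': "invertible (mat2 (x P) 0 0 1)" for P by (rule matrix_inv_mat2) (simp add: x_def)
  have inv': "invertible (e' P)" for P unfolding e'_def using matrix_inv_mult(2)[OF inv i'] .
  have e'1: "e' P = e P" if "d P = 0" for P
  proof -
    have "mat2 (x P) 0 0 1 = mat 1" by (rule mat2_eqI) (simp_all add: that x_def)
    then show ?thesis by (simp add: e'_def)
  qed
  have "{P. e' P \<noteq> mat 1} \<subseteq> {P. e P \<noteq> mat 1} \<union> {P. Poly_Mapping.lookup D P \<noteq> 0}"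
    using e'1 by (auto simp: D)
  moreover have "finite ({P. e P \<noteq> mat 1} \<union> {P. Poly_Mapping.lookup D P \<noteq> 0})"
    using e by (simp add: local_family_def)
  ultimately have "finite {P. e' P \<noteq> mat 1}" by (rule finite_subset)
  then have e': "local_family e'" using inv' by (simp add: local_family_def)
  have std: "intmat P (matrix_conj (e' P) a) \<longleftrightarrow> stdmat P (d P) (matrix_conj (e P) a)" for P a
    unfolding e'_def conj_mult[OF inv i'] by (subst intmat_conj_diag) (auto simp: stdmat_def x_def ord_power)
  have "maximal_order (order_at e)" "maximal_order (order_at e')"
    using e e' unfolding maximal_order_iff by blast+
  moreover have "E U = order_at e U \<inter> order_at e' U" if "zopen U" for U
    unfolding E[OF that] level_order_def order_at_def std D using intmat_and_stdmat by blast
  moreover have "at_distance P (d P) (complete_at P (order_at e)) (complete_at P (order_at e'))" for P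
  proof (rule at_distanceI[OF inv])
    show "stalk (order_at e) P = {a. intmat P (matrix_conj (e P) a)}" by (rule stalk_order_at[OF e]) simp
    have "stalk (order_at e') P = {a. intmat P (matrix_conj (e' P) a)}" by (rule stalk_order_at[OF e']) simp
    then show "stalk (order_at e') P = {a. stdmat P (d P) (matrix_conj (e P) a)}" unfolding std .
  qed
  ultimately show "eichler_order_of_level D E" unfolding eichler_order_of_level_def D by blast
qed

section \<open>Splitting\<close>

lemma divisor_with_values:
  assumes "finite {P. f P \<noteq> 0}" obtains B :: "('a::field) divisor" where "\<And>P. Poly_Mapping.lookup B P = f P"
  using assms lookup_Abs_poly_mapping by metis

definition infinity_diag :: "int \<Rightarrow> int \<Rightarrow> 'a::field closed_point \<Rightarrow> 'a ratfun^2^2" where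
  "infinity_diag a b P = (if equation_of P = None
     then mat2 (to_fract [:0, 1:] powi - a) 0 0 (to_fract [:0, 1:] powi - b) else mat 1)"

lemma infinity_diag_eq:
  obtains x y where "infinity_diag a b P = mat2 x 0 0 y" "x \<noteq> 0" "y \<noteq> 0"
    "ord P x = (if equation_of P = None then a else 0)" "ord P y = (if equation_of P = None then b else 0)"
proof (cases "equation_of P = None")
  case True
  show ?thesis
    by (rule that[of "to_fract [:0, 1:] powi - a" "to_fract [:0, 1:] powi - b"])
      (use True in \<open>simp_all add: infinity_diag_def ord_powi ord_variable_infinity del: power_int_minus\<close>)
next
  case False
  have "mat 1 = mat2 1 0 0 (1::'a ratfun)" by (rule mat2_eqI) simp_all
  then show ?thesis using that[of 1 1] False by (simp add: infinity_diag_def)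
qed

lemma invertible_infinity_diag: "invertible (infinity_diag a b P)"
proof -
  obtain x y where "infinity_diag a b P = mat2 x 0 0 y" "x \<noteq> 0" "y \<noteq> 0" by (rule infinity_diag_eq)
  then show ?thesis using matrix_inv_mat2(2)[of x y 0 0] by simp
qed

lemma conj_diag_iff:
  assumes "x \<noteq> 0" "y \<noteq> 0"
  shows "val_ge P m (matrix_conj (mat2 x 0 0 y) b $ 1 $ 2) \<longleftrightarrow> val_ge P (m + ord P x - ord P y) (b $ 1 $ 2)"
    and "val_ge P m (matrix_conj (mat2 x 0 0 y) b $ 2 $ 1) \<longleftrightarrow> val_ge P (m + ord P y - ord P x) (b $ 2 $ 1)"
    and "matrix_conj (mat2 x 0 0 y) b $ 1 $ 1 = b $ 1 $ 1" "matrix_conj (mat2 x 0 0 y) b $ 2 $ 2 = b $ 2 $ 2"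
proof -
  have c: "matrix_conj (mat2 x 0 0 y) b = mat2 (b $ 1 $ 1) (y / x * b $ 1 $ 2) (x / y * b $ 2 $ 1) (b $ 2 $ 2)"
    by (rule mat2_eqI) (use assms in \<open>simp_all add: matrix_conj_def matrix_inv_mat2 matrix_mult_nth_2\<close>)
  show "val_ge P m (matrix_conj (mat2 x 0 0 y) b $ 1 $ 2) \<longleftrightarrow> val_ge P (m + ord P x - ord P y) (b $ 1 $ 2)"
    unfolding c mat2_nth using assms by (subst val_ge_mult_iff) (auto simp: ord_divide algebra_simps)
  show "val_ge P m (matrix_conj (mat2 x 0 0 y) b $ 2 $ 1) \<longleftrightarrow> val_ge P (m + ord P y - ord P x) (b $ 2 $ 1)"
    unfolding c mat2_nth using assms by (subst val_ge_mult_iff) (auto simp: ord_divide algebra_simps)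
qed (use assms in \<open>simp_all add: matrix_conj_def matrix_inv_mat2 matrix_mult_nth_2\<close>)

lemma split_orderI:
  fixes h :: "'a::field ratfun^2^2"
  assumes h: "invertible h" and S: "finite S" "finite S'"
    and E: "\<And>U. zopen U \<Longrightarrow> E U = {a. \<forall>P\<in>U. intmat P (matrix_conj (h ** infinity_diag \<alpha> \<beta> P) a) \<and>
      (P \<in> S \<longrightarrow> val_ge P 1 (matrix_conj (h ** infinity_diag \<alpha> \<beta> P) a $ 1 $ 2)) \<and>
      (P \<in> S' \<longrightarrow> val_ge P 1 (matrix_conj (h ** infinity_diag \<alpha> \<beta> P) a $ 2 $ 1))}"
  shows "split_order E"
proof -
  obtain I :: "'a closed_point" where I: "equation_of I = None" using ex_infinity by blast
  define m where "m P = (if P \<in> S then 1 else 0) + (if P = I then \<alpha> - \<beta> else 0)" for P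
  define m' where "m' P = (if P \<in> S' then 1 else 0) + (if P = I then \<beta> - \<alpha> else 0)" for P
  have "{P. - m P \<noteq> 0} \<subseteq> insert I S" "{P. - m' P \<noteq> 0} \<subseteq> insert I S'" by (auto simp: m_def m'_def)
  then have fin: "finite {P. - m P \<noteq> 0}" "finite {P. - m' P \<noteq> 0}" using S by (meson finite_insert finite_subset)+
  obtain B where B: "\<And>P. Poly_Mapping.lookup B P = - m P" using divisor_with_values[OF fin(1)] by blast
  obtain B' where B': "\<And>P. Poly_Mapping.lookup B' P = - m' P" using divisor_with_values[OF fin(2)] by blast
  define St :: "'a closed_point set \<Rightarrow> ('a ratfun^2^2) set" where "St U = {A. A $ 1 $ 1 \<in> structure_sheaf U \<and> A $ 1 $ 2 \<in> div_sheaf B U \<and>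
            A $ 2 $ 1 \<in> div_sheaf B' U \<and> A $ 2 $ 2 \<in> structure_sheaf U}" for U
  have loc: "(intmat P (matrix_conj (h ** infinity_diag \<alpha> \<beta> P) a) \<and>
      (P \<in> S \<longrightarrow> val_ge P 1 (matrix_conj (h ** infinity_diag \<alpha> \<beta> P) a $ 1 $ 2)) \<and>
      (P \<in> S' \<longrightarrow> val_ge P 1 (matrix_conj (h ** infinity_diag \<alpha> \<beta> P) a $ 2 $ 1))) \<longleftrightarrow>
      val_ge P 0 (matrix_conj h a $ 1 $ 1) \<and> val_ge P (m P) (matrix_conj h a $ 1 $ 2) \<and>
      val_ge P (m' P) (matrix_conj h a $ 2 $ 1) \<and> val_ge P 0 (matrix_conj h a $ 2 $ 2)" (is "?A \<longleftrightarrow> ?B") for P a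
  proof -
    obtain x y where xy: "infinity_diag \<alpha> \<beta> P = mat2 x 0 0 y" "x \<noteq> 0" "y \<noteq> 0"
      "ord P x = (if equation_of P = None then \<alpha> else 0)" "ord P y = (if equation_of P = None then \<beta> else 0)"
      by (rule infinity_diag_eq)
    have eq: "matrix_conj (h ** infinity_diag \<alpha> \<beta> P) a = matrix_conj (mat2 x 0 0 y) (matrix_conj h a)"
      using conj_mult[OF h invertible_infinity_diag] xy(1) by metis
    have PI: "equation_of P = None \<longleftrightarrow> P = I" using I equation_of_inject2[of P I] by auto
    have 12: "val_ge P n (matrix_conj (mat2 x 0 0 y) (matrix_conj h a) $ 1 $ 2) \<longleftrightarrow> val_ge P (n + (if P = I then \<alpha> - \<beta> else 0)) (matrix_conj h a $ 1 $ 2)" for n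
      unfolding conj_diag_iff(1)[OF xy(2,3)] xy(4,5) PI by (simp add: add_diff_eq)
    have 21: "val_ge P n (matrix_conj (mat2 x 0 0 y) (matrix_conj h a) $ 2 $ 1) \<longleftrightarrow> val_ge P (n + (if P = I then \<beta> - \<alpha> else 0)) (matrix_conj h a $ 2 $ 1)" for n
      unfolding conj_diag_iff(2)[OF xy(2,3)] xy(4,5) PI by (simp add: add_diff_eq)
    have up: "val_ge P (0 + j) f \<and> (c \<longrightarrow> val_ge P (1 + j) f) \<longleftrightarrow> val_ge P ((if c then 1 else 0) + j) f" for j f c
      by (auto intro: val_ge_mono)
    show ?thesis
      unfolding eq intmat_2 12 21 conj_diag_iff(3,4)[OF xy(2,3)] m_def m'_def up[symmetric] by blast
  qed
  have "E U = (\<lambda>A. h ** A ** matrix_inv h) ` St U" if U: "zopen U" for U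
  proof (intro equalityI subsetI)
    fix a assume "a \<in> E U"
    then have "matrix_conj h a \<in> St U"
      unfolding E[OF U] loc by (simp add: St_def div_sheaf_def B B')
    moreover have "a = h ** matrix_conj h a ** matrix_inv h"
      using conj_matrix_inv(1)[OF h, of a] h by (simp add: matrix_conj_def[of "matrix_inv h"] invertible_matrix_inv)
    ultimately show "a \<in> (\<lambda>A. h ** A ** matrix_inv h) ` St U" by blast
  next
    fix a assume "a \<in> (\<lambda>A. h ** A ** matrix_inv h) ` St U"
    then obtain A where A: "A \<in> St U" "a = h ** A ** matrix_inv h" by blast
    have "matrix_conj h a = A"
      using conj_matrix_inv(2)[OF h, of A] h by (simp add: A(2) matrix_conj_def[of "matrix_inv h"] invertible_matrix_inv)
    then show "a \<in> E U" using A(1)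
      unfolding E[OF U] loc by (simp add: St_def div_sheaf_def B B')
  qed
  then show ?thesis unfolding split_order_def St_def
    using h invertible_bundle_div_sheaf by blast
qed

definition wedge :: "'b::comm_ring_1^2^2 \<Rightarrow> 'b \<Rightarrow> 'b \<Rightarrow> 'b" where
  "wedge b x y = x * (b $ 2 $ 1 * x + b $ 2 $ 2 * y) - y * (b $ 1 $ 1 * x + b $ 1 $ 2 * y)"

lemma conj_mat2_wedge:
  fixes p q r s :: "'b::field"
  assumes "p * s - q * r \<noteq> 0"
  shows "matrix_conj (mat2 p q r s) b $ 1 $ 2 = - inverse (p * s - q * r) * wedge b q s"
    "matrix_conj (mat2 p q r s) b $ 2 $ 1 = inverse (p * s - q * r) * wedge b p r"
proof -
  define D where "D = p * s - q * r"
  have "D \<noteq> 0" using assms by (simp add: D_def)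
  then show "matrix_conj (mat2 p q r s) b $ 1 $ 2 = - inverse (p * s - q * r) * wedge b q s"
    "matrix_conj (mat2 p q r s) b $ 2 $ 1 = inverse (p * s - q * r) * wedge b p r"
    unfolding matrix_conj_def matrix_inv_mat2[OF assms] D_def[symmetric]
    by (simp_all add: matrix_mult_nth_2 wedge_def divide_inverse algebra_simps)
qed

lemma unimod_det:
  assumes "unimod P (mat2 p q r s)"
  shows "p * s - q * r \<noteq> 0" "ord P (p * s - q * r) = 0"
proof -
  let ?k = "mat2 p q r s"
  have inv: "invertible ?k" using assms unimodD by blast
  have d: "det ?k = p * s - q * r" by (simp add: det_2)
  show nz: "p * s - q * r \<noteq> 0" using inv invertible_det_nz d by metis
  have det_int: "val_ge P 0 (det A)" if "intmat P A" for A :: "'a ratfun^2^2"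
    using that by (simp add: det_2 intmat_2 val_ge_diff val_ge_mult0)
  have "det ?k * det (matrix_inv ?k) = 1"
    using matrix_inv_inverse(2)[OF inv] det_mul by (metis det_I)
  then have nz': "det (matrix_inv ?k) \<noteq> 0" and "ord P (det ?k * det (matrix_inv ?k)) = 0"
    by auto
  then have "ord P (det ?k) + ord P (det (matrix_inv ?k)) = 0" using nz d by (simp add: ord_mult)
  moreover have "ord P (det ?k) \<ge> 0" "ord P (det (matrix_inv ?k)) \<ge> 0"
    using det_int unimodD(2,3)[OF assms] nz nz' d by (metis val_ge_iff)+
  ultimately show "ord P (p * s - q * r) = 0" using d by simp
qed

lemma unimod_wedge:
  assumes "unimod P (mat2 p q r s)"
  shows "val_ge P m (matrix_conj (mat2 p q r s) b $ 1 $ 2) \<longleftrightarrow> val_ge P m (wedge b q s)"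
    "val_ge P m (matrix_conj (mat2 p q r s) b $ 2 $ 1) \<longleftrightarrow> val_ge P m (wedge b p r)"
  using unimod_det[OF assms] conj_mat2_wedge[OF unimod_det(1)[OF assms], of b]
  by (simp_all add: val_ge_mult_iff ord_inverse)

fun line_condition :: "'a::field closed_point \<Rightarrow> 'a option \<Rightarrow> 'a ratfun^2^2 \<Rightarrow> bool" where
  "line_condition P None b \<longleftrightarrow> val_ge P 1 (b $ 2 $ 1)"
| "line_condition P (Some c) b \<longleftrightarrow> val_ge P 1 (wedge b (to_fract [:c:]) 1)"

lemma val_ge_cong:
  assumes "val_ge P m (x - y)" shows "val_ge P m x \<longleftrightarrow> val_ge P m y"
  using val_ge_add[OF assms, of y] val_ge_diff[OF _ assms, of x] by auto

lemma wedge_cong: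
  assumes "intmat P b" "val_ge P 0 x" "val_ge P 0 y" "val_ge P 1 (x - y)"
  shows "val_ge P 1 (wedge b x 1) \<longleftrightarrow> val_ge P 1 (wedge b y 1)"
proof (rule val_ge_cong)
  have "wedge b x 1 - wedge b y 1 = (x - y) * (b $ 2 $ 1 * (x + y) + b $ 2 $ 2 - b $ 1 $ 1)"
    by (simp add: wedge_def algebra_simps)
  moreover have "val_ge P 0 (b $ 2 $ 1 * (x + y) + b $ 2 $ 2 - b $ 1 $ 1)"
    using assms by (intro val_ge_diff val_ge_add val_ge_mult0) (auto simp: intmat_2)
  ultimately show "val_ge P 1 (wedge b x 1 - wedge b y 1)" using assms(4) val_ge_mult0' by metis
qed

text \<open>At a rational point the residue field is the field of constants, so that the line in the
  fibre that defines a neighbour of the lattice is spanned by \<open>(1, 0)\<close> or by \<open>(c, 1)\<close> with a constant \<open>c\<close>.\<close>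

lemma ex_line_condition:
  assumes P: "point_degree P = 1" and k: "unimod P k"
  obtains \<tau> where "\<And>b. intmat P b \<Longrightarrow> val_ge P 1 (matrix_conj k b $ 1 $ 2) \<longleftrightarrow> line_condition P \<tau> b"
proof -
  obtain p q r s where kk: "k = mat2 p q r s" using mat2_collapse by blast
  have u: "unimod P (mat2 p q r s)" using k kk by simp
  note det = unimod_det[OF u]
  have int: "val_ge P 0 p" "val_ge P 0 q" "val_ge P 0 r" "val_ge P 0 s"
    using unimodD(2)[OF u] by (auto simp: intmat_2)
  have w: "val_ge P 1 (matrix_conj k b $ 1 $ 2) \<longleftrightarrow> val_ge P 1 (wedge b q s)" for b
    unfolding kk by (rule unimod_wedge[OF u])
  show ?thesis
  proof (cases "val_ge P 1 s")
    case True
    have nq: "\<not> val_ge P 1 q"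
    proof
      assume "val_ge P 1 q"
      then have "val_ge P 1 (p * s - q * r)" using True int by (intro val_ge_diff val_ge_mult0 val_ge_mult0')
      then show False using det by (simp add: val_ge_iff)
    qed
    then have q0: "q \<noteq> 0" "ord P q = 0" using int by (auto simp: val_ge_def)
    have "val_ge P 1 (wedge b q s) \<longleftrightarrow> line_condition P None b" if b: "intmat P b" for b
    proof -
      have "wedge b q s - q * q * b $ 2 $ 1 = s * (q * b $ 2 $ 2 - (b $ 1 $ 1 * q + b $ 1 $ 2 * s))"
        by (simp add: wedge_def algebra_simps)
      moreover have "val_ge P 1 (s * (q * b $ 2 $ 2 - (b $ 1 $ 1 * q + b $ 1 $ 2 * s)))"
        using b int True by (intro val_ge_mult0' val_ge_diff val_ge_add val_ge_mult0) (auto simp: intmat_2)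
      ultimately have "val_ge P 1 (wedge b q s) \<longleftrightarrow> val_ge P 1 (q * q * b $ 2 $ 1)"
        by (intro val_ge_cong) (simp only:)
      then show ?thesis using q0 by (simp add: val_ge_mult_iff ord_mult)
    qed
    then show ?thesis using w that by blast
  next
    case False
    then have s0: "s \<noteq> 0" "ord P s = 0" using int by (auto simp: val_ge_def)
    have x: "val_ge P 0 (q / s)" using int s0 by (simp add: divide_inverse val_ge_mult0' val_ge_iff ord_inverse)
    then obtain c where c: "val_ge P 1 (q / s - to_fract [:c:])" using residue_at_rational_point[OF P] by blast
    have "val_ge P 1 (wedge b q s) \<longleftrightarrow> line_condition P (Some c) b" if b: "intmat P b" for b
    proof -
      have "wedge b q s = s * s * wedge b (q / s) 1"
        using s0 by (simp add: wedge_def field_simps)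
      then have "val_ge P 1 (wedge b q s) \<longleftrightarrow> val_ge P 1 (wedge b (q / s) 1)"
        using s0 by (simp add: val_ge_mult_iff ord_mult)
      then show ?thesis using wedge_cong[OF b x _ c] by simp
    qed
    then show ?thesis using w that by blast
  qed
qed

lemma unimod_upper: "val_ge P 0 f \<Longrightarrow> unimod P (mat2 1 f 0 1)"
  by (rule unimod_mat2) auto

definition twist :: "nat \<Rightarrow> 'a::field closed_point \<Rightarrow> 'a poly \<Rightarrow> 'a ratfun" where
  "twist n P f = (if equation_of P = None then to_fract [:0, 1:] powi - int n * to_fract f else to_fract f)"

lemma val_ge_twist:
  assumes "equation_of P = None"
  shows "val_ge P m (to_fract [:0, 1:] powi - int n * to_fract f) \<longleftrightarrow> f = 0 \<or> m \<le> int n - int (degree f)"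
proof -
  have "to_fract [:0, 1::'a:] powi - int n \<noteq> 0" by (simp add: power_int_not_zero del: power_int_minus)
  then show ?thesis using assms
    by (subst val_ge_mult_iff) (auto simp: ord_powi ord_variable_infinity val_ge_poly_infinity simp del: power_int_minus)
qed

lemma twist_integral: "degree f \<le> n \<Longrightarrow> val_ge P 0 (twist n P f)"
  by (simp add: twist_def val_ge_twist val_ge_poly)

lemma twist_value_infinity:
  assumes P: "equation_of P = None" and f: "degree f \<le> n" "coeff f n = c"
  shows "val_ge P 1 (twist n P f - to_fract [:c:])"
proof -
  let ?T = "to_fract [:0, 1::'a:]"
  define r where "r = f - monom c n"
  have "coeff r n = 0" using f by (simp add: r_def)
  moreover have "degree r \<le> n" unfolding r_def using f by (intro degree_diff_le) (auto simp: degree_monom_le)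
  ultimately have r: "r = 0 \<or> degree r < n" by (metis le_neq_implies_less leading_coeff_0_iff)
  have "monom c n = [:0, 1:] ^ n * [:c:]" by (simp add: monom_altdef)
  then have "to_fract f = to_fract r + ?T ^ n * to_fract [:c:]"
    unfolding r_def by (metis add.commute add_diff_cancel_left' diff_add_cancel to_fract_add to_fract_mult to_fract_power)
  moreover have "?T powi - int n * ?T ^ n = 1" by (simp add: power_int_minus)
  ultimately have "?T powi - int n * to_fract f = ?T powi - int n * to_fract r + to_fract [:c:]"
    by (simp only: distrib_left mult.assoc[symmetric] mult_1_left)
  then have "twist n P f - to_fract [:c:] = ?T powi - int n * to_fract r" using P by (simp add: twist_def)
  then show ?thesis using r val_ge_twist[OF P, of 1 n r] by auto
qed

lemma twist_value_finite:
  "equation_of P = Some [:- \<alpha>, 1:] \<Longrightarrow> poly f \<alpha> = c \<Longrightarrow> val_ge P 1 (twist n P f - to_fract [:c:])"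
  by (simp add: twist_def val_ge_linear_point)

lemma ex_interpolating_poly:
  assumes P: "point_degree P = 1" and Q: "point_degree Q = 1" and PQ: "P \<noteq> Q" and n: "n \<ge> 1"
  shows "\<exists>f. degree f \<le> n \<and> val_ge P 1 (twist n P f - to_fract [:c:]) \<and> val_ge Q 1 (twist n Q f - to_fract [:d:])"
proof -
  have mixed: "\<exists>f. degree f \<le> n \<and> val_ge P 1 (twist n P f - to_fract [:c:]) \<and> val_ge Q 1 (twist n Q f - to_fract [:d:])"
    if P: "equation_of P = None" and Q: "equation_of Q = Some [:- \<alpha>, 1:]" for P Q and c d \<alpha> :: 'a
  proof -
    define f where "f = monom c n + [:d - c * \<alpha> ^ n:]"
    have deg: "degree f \<le> n" unfolding f_def by (intro degree_add_le) (auto simp: degree_monom_le)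
    have "coeff f n = c" using n by (cases n) (simp_all add: f_def)
    then have "val_ge P 1 (twist n P f - to_fract [:c:])" by (rule twist_value_infinity[OF P deg])
    moreover have "val_ge Q 1 (twist n Q f - to_fract [:d:])"
      by (rule twist_value_finite[OF Q]) (simp add: f_def poly_monom)
    ultimately show ?thesis using deg by blast
  qed
  from P show ?thesis
  proof (cases P rule: rational_point_cases)
    case 1
    from Q show ?thesis
    proof (cases Q rule: rational_point_cases)
      assume "equation_of Q = None"
      then show ?thesis using 1 PQ equation_of_inject2[of P Q] by simp
    next
      fix \<beta> assume "equation_of Q = Some [:- \<beta>, 1:]"
      then show ?thesis using mixed[OF 1] by blast
    qed
  next
    case (2 \<alpha>)
    from Q show ?thesis
    proof (cases Q rule: rational_point_cases)
      case 1
      then show ?thesis using mixed[OF 1 2] by blast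
    next
      fix \<beta> assume \<beta>: "equation_of Q = Some [:- \<beta>, 1:]"
      have ne: "\<alpha> - \<beta> \<noteq> 0" using 2 \<beta> PQ equation_of_inject2[of P Q] by auto
      define m where "m = (c - d) / (\<alpha> - \<beta>)"
      define f where "f = [:c - \<alpha> * m, m:]"
      have m: "(\<alpha> - \<beta>) * m = c - d" using ne by (simp add: m_def)
      have "poly f \<alpha> = c" by (simp add: f_def)
      moreover have "poly f \<beta> = d" using m by (simp add: f_def algebra_simps)
      moreover have "degree f \<le> n" using n by (simp add: f_def)
      ultimately show ?thesis using twist_value_finite[OF 2] twist_value_finite[OF \<beta>] by blast
    qed
  qed
qed

lemma lat_infinity_diag:
  fixes h :: "'a::field ratfun^2^2"
  assumes h: "invertible h"
  shows "lat P (h ** infinity_diag a b P) = (if equation_of P = None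
    then {x. val_ge P a ((matrix_inv h *v x) $ 1) \<and> val_ge P b ((matrix_inv h *v x) $ 2)} else lat P h)"
proof (cases "equation_of P = None")
  case True
  obtain x y where xy: "infinity_diag a b P = mat2 x 0 0 y" "x \<noteq> 0" "y \<noteq> 0"
    "ord P x = (if equation_of P = None then a else 0)" "ord P y = (if equation_of P = None then b else 0)"
    by (rule infinity_diag_eq)
  have inv: "invertible (mat2 x 0 0 y)" using invertible_infinity_diag[of a b P] xy(1) by simp
  have "matrix_inv (h ** mat2 x 0 0 y) *v z = vec2 (inverse x * (matrix_inv h *v z) $ 1) (inverse y * (matrix_inv h *v z) $ 2)" for z
  proof -
    have "matrix_inv (h ** mat2 x 0 0 y) *v z = matrix_inv (mat2 x 0 0 y) *v (matrix_inv h *v z)"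
      by (simp add: matrix_inv_mult(1)[OF h inv] matrix_vector_mul_assoc)
    then show ?thesis
      by (intro vec2_eqI) (use xy in \<open>simp_all add: matrix_inv_mat2 matrix_vector_mult_nth_2[of "mat2 _ _ _ _"] divide_inverse\<close>)
  qed
  then show ?thesis using True xy by (simp add: lat_def intvec_2 val_ge_mult_iff ord_inverse)
next
  case False
  then show ?thesis by (simp only: infinity_diag_def if_False matrix_mul_rid)
qed

lemma level_order_split:
  fixes e :: "'a::field closed_point \<Rightarrow> 'a ratfun^2^2"
  assumes e: "local_family e" and E: "\<And>U. zopen U \<Longrightarrow> E U = level_order D e U"
    and P: "point_degree P\<^sub>1 = 1" "point_degree P\<^sub>2 = 1" "P\<^sub>1 \<noteq> P\<^sub>2"
    and D: "\<And>P. Poly_Mapping.lookup D P \<noteq> 0 \<Longrightarrow> Poly_Mapping.lookup D P = 1 \<and> (P = P\<^sub>1 \<or> P = P\<^sub>2)"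
  shows "split_order E"
proof -
  obtain h a b where h: "invertible h" and ab: "a \<le> b"
    and fin: "\<forall>P. equation_of P \<noteq> None \<longrightarrow> lat P (e P) = lat P h"
    and inf: "\<forall>P. equation_of P = None \<longrightarrow> lat P (e P) =
       {x. val_ge P a ((matrix_inv h *v x) $ 1) \<and> val_ge P b ((matrix_inv h *v x) $ 2)}"
    by (rule reduced_basis[OF e]) (rule that)
  let ?\<delta> = "infinity_diag a b"
  define G where "G P = h ** ?\<delta> P" for P
  have G: "invertible (G P)" for P unfolding G_def by (rule matrix_inv_mult(2)[OF h invertible_infinity_diag])
  have ei: "invertible (e P)" for P using e by (simp add: local_family_def)
  define k where "k P = matrix_inv (G P) ** e P" for P
  have k: "unimod P (k P)" for P
  proof -
    have "lat P (G P) = lat P (e P)" unfolding G_def lat_infinity_diag[OF h] using fin inf by simp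
    then show ?thesis unfolding k_def using lat_eq_iff[OF G ei] by blast
  qed
  have conj_e: "matrix_conj (e P) x = matrix_conj (k P) (matrix_conj (G P) x)" for P x
  proof -
    have "e P = G P ** k P" by (simp add: k_def matrix_mul_assoc matrix_inv_inverse[OF G])
    then show ?thesis using conj_mult[OF G unimodD(1)[OF k]] by simp
  qed
  have "\<forall>P. \<exists>\<tau>. point_degree P = 1 \<longrightarrow> (\<forall>b. intmat P b \<longrightarrow> (val_ge P 1 (matrix_conj (k P) b $ 1 $ 2) \<longleftrightarrow> line_condition P \<tau> b))"
    using ex_line_condition[OF _ k] by metis
  from choice[OF this] obtain \<tau> where \<tau>: "\<And>P b. point_degree P = 1 \<Longrightarrow> intmat P b \<Longrightarrow>
      val_ge P 1 (matrix_conj (k P) b $ 1 $ 2) \<longleftrightarrow> line_condition P (\<tau> P) b" by blast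
  define S where "S = {P. Poly_Mapping.lookup D P = 1}"
  have S12: "S \<subseteq> {P\<^sub>1, P\<^sub>2}"
  proof
    fix P assume "P \<in> S"
    then have "Poly_Mapping.lookup D P \<noteq> 0" by (simp add: S_def)
    from D[OF this] show "P \<in> {P\<^sub>1, P\<^sub>2}" by blast
  qed
  have E': "E U = {x. \<forall>P\<in>U. intmat P (matrix_conj (G P) x) \<and> (P \<in> S \<longrightarrow> line_condition P (\<tau> P) (matrix_conj (G P) x))}"
    if U: "zopen U" for U
  proof -
    have "intmat P (matrix_conj (e P) x) \<and> val_ge P (Poly_Mapping.lookup D P) (matrix_conj (e P) x $ 1 $ 2) \<longleftrightarrow>
       intmat P (matrix_conj (G P) x) \<and> (P \<in> S \<longrightarrow> line_condition P (\<tau> P) (matrix_conj (G P) x))" for P x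
    proof (cases "P \<in> S")
      case True
      then have "point_degree P = 1" using S12 P by auto
      then show ?thesis using True \<tau> unfolding conj_e intmat_conj[OF k] by (auto simp: S_def)
    next
      case False
      then have "Poly_Mapping.lookup D P = 0" using D by (auto simp: S_def)
      moreover have "intmat P (matrix_conj (e P) x) \<longleftrightarrow> intmat P (matrix_conj (G P) x)"
        unfolding conj_e by (rule intmat_conj[OF k])
      ultimately show ?thesis using False by (auto simp: intmat_2)
    qed
    then show ?thesis unfolding E[OF U] level_order_def by blast
  qed
  define n where "n = nat (b - a)"
  have ba: "a - b = - int n" using ab by (simp add: n_def)
  show ?thesis
  proof (cases "\<exists>f. degree f \<le> n \<and> (\<forall>P\<in>S. \<forall>c. \<tau> P = Some c \<longrightarrow> val_ge P 1 (twist n P f - to_fract [:c:]))")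
    case True
    then obtain f where f: "degree f \<le> n"
      "\<And>P c. P \<in> S \<Longrightarrow> \<tau> P = Some c \<Longrightarrow> val_ge P 1 (twist n P f - to_fract [:c:])" by blast
    define h' where "h' = h ** mat2 1 (to_fract f) 0 1"
    define u where "u P = mat2 1 (twist n P f) 0 1" for P
    have u: "unimod P (u P)" for P unfolding u_def by (rule unimod_upper[OF twist_integral[OF f(1)]])
    have h': "invertible h'" unfolding h'_def by (rule matrix_inv_mult(2)[OF h]) (rule matrix_inv_mat2, simp)
    have Gu: "h' ** ?\<delta> P = G P ** u P" for P
    proof -
      have "mat2 1 (to_fract f) 0 1 ** ?\<delta> P = ?\<delta> P ** u P"
      proof (cases "equation_of P = None")
        case True
        have T: "to_fract [:0, 1::'a:] \<noteq> 0" by simp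
        have eq: "to_fract [:0, 1::'a:] powi - a * (to_fract [:0, 1:] powi - int n * to_fract f) = to_fract f * to_fract [:0, 1:] powi - b"
        proof -
          have "to_fract [:0, 1::'a:] powi - a * to_fract [:0, 1:] powi - int n = to_fract [:0, 1:] powi (- a + - int n)"
            by (rule power_int_add[symmetric]) (simp add: T)
          also have "- a + - int n = - b" using ba by simp
          finally show ?thesis unfolding mult.assoc[symmetric] by (simp only: mult.commute)
        qed
        have "mat2 1 F 0 1 ** mat2 x 0 0 y = mat2 x (F * y) 0 y" "mat2 x 0 0 y ** mat2 1 F 0 1 = mat2 x (x * F) 0 y"
          for x y F :: "'a ratfun"
          by (rule mat2_eqI; simp add: matrix_mult_nth_2)+
        then show ?thesis using True eq by (simp only: infinity_diag_def u_def twist_def simp_thms if_True)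
      next
        case False
        then show ?thesis
          by (simp only: infinity_diag_def u_def twist_def if_False matrix_mul_lid matrix_mul_rid)
      qed
      then show ?thesis unfolding h'_def G_def by (metis matrix_mul_assoc)
    qed
    have conj_h': "matrix_conj (h' ** ?\<delta> P) x = matrix_conj (u P) (matrix_conj (G P) x)" for P x
      unfolding Gu by (rule conj_mult[OF G unimodD(1)[OF u]])
    have loc: "intmat P (matrix_conj (G P) x) \<and> (P \<in> S \<longrightarrow> line_condition P (\<tau> P) (matrix_conj (G P) x)) \<longleftrightarrow>
       intmat P (matrix_conj (h' ** ?\<delta> P) x) \<and> (P \<in> {P\<in>S. \<tau> P \<noteq> None} \<longrightarrow> val_ge P 1 (matrix_conj (h' ** ?\<delta> P) x $ 1 $ 2)) \<and>
       (P \<in> {P\<in>S. \<tau> P = None} \<longrightarrow> val_ge P 1 (matrix_conj (h' ** ?\<delta> P) x $ 2 $ 1))" for P x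
    proof -
      let ?b = "matrix_conj (G P) x"
      have "line_condition P (\<tau> P) ?b \<longleftrightarrow> (\<tau> P \<noteq> None \<longrightarrow> val_ge P 1 (matrix_conj (u P) ?b $ 1 $ 2)) \<and>
          (\<tau> P = None \<longrightarrow> val_ge P 1 (matrix_conj (u P) ?b $ 2 $ 1))" if i: "intmat P ?b" and PS: "P \<in> S"
      proof (cases "\<tau> P")
        case None
        then show ?thesis unfolding u_def unimod_wedge(2)[OF u[unfolded u_def]] by (simp add: wedge_def)
      next
        case (Some c)
        have "val_ge P 1 (wedge ?b (twist n P f) 1) \<longleftrightarrow> val_ge P 1 (wedge ?b (to_fract [:c:]) 1)"
          using f(2)[OF PS Some] by (intro wedge_cong[OF i twist_integral[OF f(1)]]) simp_all
        then show ?thesis using Some unfolding u_def unimod_wedge(1)[OF u[unfolded u_def]] by simp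
      qed
      then show ?thesis unfolding conj_h' intmat_conj[OF u] by blast
    qed
    show ?thesis
    proof (rule split_orderI[OF h'])
      show "finite {P\<in>S. \<tau> P \<noteq> None}" "finite {P\<in>S. \<tau> P = None}"
        using S12 by (auto intro: finite_subset[of _ "{P\<^sub>1, P\<^sub>2}"])
    qed (simp only: E' loc)
  next
    case False
    have S_eq: "S = {P\<^sub>1, P\<^sub>2}" and \<tau>12: "\<exists>c\<^sub>1 c\<^sub>2. \<tau> P\<^sub>1 = Some c\<^sub>1 \<and> \<tau> P\<^sub>2 = Some c\<^sub>2 \<and> c\<^sub>1 \<noteq> c\<^sub>2 \<and> n = 0"
    proof -
      have const: "val_ge Q 1 (twist 0 Q [:c:] - to_fract [:c:])" for Q c by (simp add: twist_def)
      have n0: "n = 0"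
      proof (rule ccontr)
        assume "n \<noteq> 0"
        then obtain f where "degree f \<le> n" "val_ge P\<^sub>1 1 (twist n P\<^sub>1 f - to_fract [:the (\<tau> P\<^sub>1):])"
          "val_ge P\<^sub>2 1 (twist n P\<^sub>2 f - to_fract [:the (\<tau> P\<^sub>2):])"
          using ex_interpolating_poly[OF P, of n] by (metis One_nat_def Suc_leI neq0_conv)
        then show False using False S12 by fastforce
      qed
      have nc: "\<exists>P\<in>S. \<exists>d. \<tau> P = Some d \<and> d \<noteq> c" for c
      proof (rule ccontr)
        assume *: "\<not> ?thesis"
        have "degree [:c:] \<le> n \<and> (\<forall>P\<in>S. \<forall>d. \<tau> P = Some d \<longrightarrow> val_ge P 1 (twist n P [:c:] - to_fract [:d:]))"
          using * const n0 by auto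
        then show False using False by blast
      qed
      obtain Q d where Q: "Q \<in> S" "\<tau> Q = Some d" using nc[of 0] by blast
      obtain R d' where R: "R \<in> S" "\<tau> R = Some d'" "d' \<noteq> d" using nc[of d] by blast
      have "Q \<noteq> R" using Q R by auto
      then have "Q = P\<^sub>1 \<and> R = P\<^sub>2 \<or> Q = P\<^sub>2 \<and> R = P\<^sub>1" using Q(1) R(1) S12 by auto
      then show "S = {P\<^sub>1, P\<^sub>2}" "\<exists>c\<^sub>1 c\<^sub>2. \<tau> P\<^sub>1 = Some c\<^sub>1 \<and> \<tau> P\<^sub>2 = Some c\<^sub>2 \<and> c\<^sub>1 \<noteq> c\<^sub>2 \<and> n = 0"
        using Q R S12 n0 by auto
    qed
    then obtain c\<^sub>1 c\<^sub>2 where c: "\<tau> P\<^sub>1 = Some c\<^sub>1" "\<tau> P\<^sub>2 = Some c\<^sub>2" "c\<^sub>1 \<noteq> c\<^sub>2" and n0: "n = 0" by blast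
    define w where "w = mat2 (to_fract [:c\<^sub>2:]) (to_fract [:c\<^sub>1:]) 1 1"
    have det: "to_fract [:c\<^sub>2:] * 1 - to_fract [:c\<^sub>1:] * 1 = to_fract [:c\<^sub>2 - c\<^sub>1:]"
      by (simp add: to_fract_diff[symmetric] del: to_fract_diff)
    have w: "unimod P w" for P
      unfolding w_def using c(3) by (intro unimod_mat2) (simp_all only: det, simp_all)
    define h' where "h' = h ** w"
    have h': "invertible h'" unfolding h'_def by (rule matrix_inv_mult(2)[OF h unimodD(1)[OF w]])
    have Gw: "h' ** ?\<delta> P = G P ** w" for P
    proof -
      have "b = a" using ba n0 by simp
      then have "w ** ?\<delta> P = ?\<delta> P ** w"
        by (cases "equation_of P = None")
          (auto simp: infinity_diag_def matrix_mult_nth_2 mult.commute intro!: mat2_eqI)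
      then show ?thesis unfolding h'_def G_def by (metis matrix_mul_assoc)
    qed
    have conj_h': "matrix_conj (h' ** ?\<delta> P) x = matrix_conj w (matrix_conj (G P) x)" for P x
      unfolding Gw by (rule conj_mult[OF G unimodD(1)[OF w]])
    have loc: "intmat P (matrix_conj (G P) x) \<and> (P \<in> S \<longrightarrow> line_condition P (\<tau> P) (matrix_conj (G P) x)) \<longleftrightarrow>
       intmat P (matrix_conj (h' ** ?\<delta> P) x) \<and> (P \<in> {P\<^sub>1} \<longrightarrow> val_ge P 1 (matrix_conj (h' ** ?\<delta> P) x $ 1 $ 2)) \<and>
       (P \<in> {P\<^sub>2} \<longrightarrow> val_ge P 1 (matrix_conj (h' ** ?\<delta> P) x $ 2 $ 1))" for P x
      unfolding conj_h' intmat_conj[OF w] S_eq using c P(3)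
      unfolding w_def unimod_wedge[OF w[unfolded w_def]] by auto
    show ?thesis
      by (rule split_orderI[OF h']) (simp_all only: E' loc finite.intros)
  qed
qed

section \<open>Non-split orders\<close>

lemma split_order_idempotent:
  fixes E :: "'a::field order_sheaf"
  assumes "split_order E"
  obtains a where "a \<in> E UNIV" "a ** a = a" "a \<noteq> 0" "a \<noteq> mat 1"
proof -
  from assms obtain g :: "'a ratfun^2^2" and L L' where g: "invertible g"
    and L: "invertible_bundle L" "invertible_bundle L'"
    and E: "\<And>U. zopen U \<Longrightarrow> E U = (\<lambda>A. g ** A ** matrix_inv g) `
        {A. A $ 1 $ 1 \<in> structure_sheaf U \<and> A $ 1 $ 2 \<in> L U \<and>
            A $ 2 $ 1 \<in> L' U \<and> A $ 2 $ 2 \<in> structure_sheaf U}"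
    unfolding split_order_def by blast
  define A :: "'a ratfun^2^2" where "A = mat2 1 0 0 0"
  define a where "a = g ** A ** matrix_inv g"
  have L0: "0 \<in> M UNIV" if "invertible_bundle M" for M :: "'a closed_point set \<Rightarrow> 'a ratfun set"
    using that zopen_UNIV unfolding invertible_bundle_def vector_bundle_def module_sheaf_def by blast
  have "A \<in> {A. A $ 1 $ 1 \<in> structure_sheaf UNIV \<and> A $ 1 $ 2 \<in> L UNIV \<and>
            A $ 2 $ 1 \<in> L' UNIV \<and> A $ 2 $ 2 \<in> structure_sheaf UNIV}"
    using L0[OF L(1)] L0[OF L(2)] by (simp add: A_def structure_sheaf_iff)
  then have aE: "a \<in> E UNIV" unfolding E[OF zopen_UNIV] a_def by (rule imageI)
  have a: "a = matrix_conj (matrix_inv g) A" using g by (simp add: a_def matrix_conj_def invertible_matrix_inv)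
  have gi: "invertible (matrix_inv g)" using invertible_matrix_inv(1)[OF g] .
  have "A ** A = A" unfolding A_def by (rule mat2_eqI) (simp_all add: matrix_mult_nth_2)
  then have "a ** a = a" using conj_product[OF gi, of A A] a by simp
  moreover have A: "matrix_conj g a = A" unfolding a by (rule conj_matrix_inv(2)[OF g])
  moreover have "a \<noteq> 0"
  proof
    assume "a = 0"
    then have "A = 0" using A by (auto simp: matrix_conj_def vec_eq_iff matrix_matrix_mult_def)
    then show False by (metis A_def mat2_nth(1) zero_index zero_neq_one)
  qed
  moreover have "a \<noteq> mat 1"
  proof
    assume "a = mat 1"
    then have "A = mat 1" using A matrix_inv_inverse(1)[OF g] by (simp add: matrix_conj_def)
    then have "A $ 2 $ 2 = 1" by simp
    then show False by (simp add: A_def)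
  qed
  ultimately show ?thesis using that aE by blast
qed

lemma level_order_not_split:
  fixes e :: "'a::field closed_point \<Rightarrow> 'a ratfun^2^2"
  assumes D: "effective D" and split: "\<forall>E. eichler_order_of_level D E \<longrightarrow> split_order E"
    and e: "\<And>P. unimod P (e P)" "finite {P. e P \<noteq> mat 1}"
  obtains A :: "'a^2^2" and a :: "'a ratfun^2^2" where "a = (\<chi> i j. to_fract [:A $ i $ j:])" "a ** a = a" "a \<noteq> 0" "a \<noteq> mat 1"
    "\<forall>P. val_ge P (Poly_Mapping.lookup D P) (matrix_conj (e P) a $ 1 $ 2)"
proof -
  have "local_family e" using e unimodD(1) by (auto simp: local_family_def)
  then have "split_order (level_order D e)" using split eichler_order_iff[OF D] by blast
  then obtain a where a: "a \<in> level_order D e UNIV" "a ** a = a" "a \<noteq> 0" "a \<noteq> mat 1"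
    by (rule split_order_idempotent)
  have "intmat P a" for P using a(1) intmat_conj[OF e(1)] by (auto simp: level_order_def)
  then have "\<forall>i j. \<exists>c. a $ i $ j = to_fract [:c:]"
    using global_function_constant unfolding intmat_def by metis
  then obtain A where A: "\<And>i j. a $ i $ j = to_fract [:A i j:]" by metis
  show ?thesis
  proof (rule that[of a "\<chi> i j. A i j"])
    show "a = (\<chi> i j. to_fract [:(\<chi> i j. A i j) $ i $ j:])" using A by (simp add: vec_eq_iff)
    show "\<forall>P. val_ge P (Poly_Mapping.lookup D P) (matrix_conj (e P) a $ 1 $ 2)"
      using a(1) by (simp add: level_order_def)
  qed (rule a(2-4))+
qed

lemma idempotent_scalar:
  fixes a :: "'b::field^2^2"
  assumes "a ** a = a" "a $ 1 $ 2 = 0" "a $ 2 $ 1 = 0" "a $ 1 $ 1 = a $ 2 $ 2"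
  shows "a = 0 \<or> a = mat 1"
proof -
  have "(a ** a) $ 1 $ 1 = a $ 1 $ 1" using assms by simp
  then have "a $ 1 $ 1 * a $ 1 $ 1 = a $ 1 $ 1" unfolding matrix_mult_nth_2 using assms(2) by simp
  then have "a $ 1 $ 1 = 0 \<or> a $ 1 $ 1 = 1" by simp
  then show ?thesis using assms by (auto intro!: mat2_eqI)
qed

lemma not_split_of_nonconstant_line:
  fixes D :: "('a::field) divisor"
  assumes D: "effective D" and \<theta>: "val_ge P 0 \<theta>" "\<And>c. \<not> val_ge P (Poly_Mapping.lookup D P) (\<theta> - to_fract [:c:])"
    and split: "\<forall>E. eichler_order_of_level D E \<longrightarrow> split_order E"
  shows False
proof -
  define d where "d = Poly_Mapping.lookup D P"
  have d: "d \<ge> 1" using \<theta>(1) \<theta>(2)[of 0] val_ge_mono[of P 0 \<theta> d] by (force simp: d_def)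
  define e where "e Q = (if Q = P then mat2 1 \<theta> 0 1 else mat 1)" for Q
  have eu: "unimod Q (e Q)" for Q using unimod_upper[OF \<theta>(1)] by (simp add: e_def)
  have "{Q. e Q \<noteq> mat 1} \<subseteq> {P}" by (auto simp: e_def)
  then have fin: "finite {Q. e Q \<noteq> mat 1}" using finite_subset by blast
  obtain A :: "'a^2^2" and a where a: "a = (\<chi> i j. to_fract [:A $ i $ j:])" "a ** a = a" "a \<noteq> 0" "a \<noteq> mat 1"
    and cond': "\<forall>P. val_ge P (Poly_Mapping.lookup D P) (matrix_conj (e P) a $ 1 $ 2)"
    by (rule level_order_not_split[OF D split eu fin]) (rule that)
  note cond = cond'[rule_format]
  have aA: "a $ i $ j = to_fract [:A $ i $ j:]" for i j by (simp add: a(1))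
  have ai: "val_ge P 0 (a $ i $ j)" for i j by (simp add: aA)
  have wedge: "val_ge P d (wedge a \<theta> 1)"
    using cond[of P] unimod_wedge(1)[OF unimod_upper[OF \<theta>(1)]] by (simp add: e_def d_def)
  have indep: "x = 0 \<and> y = 0" if "val_ge P d (to_fract [:x:] * \<theta> + to_fract [:y:])" for x y
  proof -
    have x: "x = 0"
    proof (rule ccontr)
      assume x0: "x \<noteq> 0"
      have "to_fract [:x:] * (\<theta> - to_fract [:- y / x:]) = to_fract [:x:] * \<theta> - to_fract ([:x:] * [:- y / x:])"
        by (simp only: right_diff_distrib to_fract_mult)
      also have "to_fract ([:x:] * [:- y / x:]) = - to_fract [:y:]" using x0 by (simp flip: to_fract_uminus)
      finally have "val_ge P d (to_fract [:x:] * (\<theta> - to_fract [:- y / x:]))" using that by simp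
      then have "val_ge P d (\<theta> - to_fract [:- y / x:])" using x0 by (simp add: val_ge_mult_iff)
      then show False using \<theta>(2) by (simp add: d_def)
    qed
    then have "val_ge P d (to_fract [:y:])" using that by simp
    then have "y = 0" using val_ge_mono[OF _ d] val_ge_1_const_iff by blast
    then show ?thesis using x by blast
  qed
  define l where "l = a $ 2 $ 1 * \<theta> + a $ 2 $ 2"
  define m where "m = a $ 1 $ 1 * \<theta> + a $ 1 $ 2"
  have li: "val_ge P 0 l" unfolding l_def using \<theta>(1) ai by (intro val_ge_add val_ge_mult0)
  have w: "val_ge P d (\<theta> * l - m)" using wedge by (simp add: wedge_def l_def m_def)
  have "(a ** a) $ 2 $ 1 * \<theta> + (a ** a) $ 2 $ 2 = l" using a(2) by (simp add: l_def)
  then have "a $ 2 $ 1 * m + a $ 2 $ 2 * l = l" by (simp add: matrix_mult_nth_2 l_def m_def algebra_simps)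
  then have "l * l - l = a $ 2 $ 1 * (\<theta> * l - m)" by (simp add: l_def algebra_simps)
  then have "val_ge P d (l * l - l)" using val_ge_mult0[OF ai w] by simp
  then have ll: "val_ge P d (l * (l - 1))" by (simp add: algebra_simps)
  have "val_ge P d l \<or> val_ge P d (l - 1)"
  proof (cases "val_ge P 1 l")
    case True
    have "\<not> val_ge P 1 (l - 1)"
    proof
      assume "val_ge P 1 (l - 1)"
      with True have "val_ge P 1 (l - (l - 1))" by (rule val_ge_diff)
      then show False by (simp add: val_ge_iff)
    qed
    moreover have "val_ge P 0 (l - 1)" using li by (intro val_ge_diff) auto
    ultimately have "l - 1 \<noteq> 0" "ord P (l - 1) = 0" by (auto simp: val_ge_def)
    then show ?thesis using ll val_ge_mult_iff[of "l - 1" P d l] by (simp add: mult.commute)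
  next
    case False
    then have "l \<noteq> 0" "ord P l = 0" using li by (auto simp: val_ge_def)
    then show ?thesis using ll val_ge_mult_iff[of l P d "l - 1"] by simp
  qed
  then show False
  proof
    assume l: "val_ge P d l"
    then have "A $ 2 $ 1 = 0 \<and> A $ 2 $ 2 = 0" using indep by (simp add: l_def aA)
    moreover have "val_ge P d m"
      using val_ge_diff[OF val_ge_mult0[OF \<theta>(1) l] w] by simp
    then have "A $ 1 $ 1 = 0 \<and> A $ 1 $ 2 = 0" using indep by (simp add: m_def aA)
    ultimately have "a = 0" by (intro mat2_eqI) (simp_all add: aA)
    then show False using a by blast
  next
    assume l: "val_ge P d (l - 1)"
    have minus_1: "to_fract [:c - 1:] = to_fract [:c:] - 1" for c :: 'a
      by (metis diff_pCons diff_zero one_pCons to_fract_1 to_fract_diff)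
    have "l - 1 = to_fract [:A $ 2 $ 1:] * \<theta> + to_fract [:A $ 2 $ 2 - 1:]"
      by (simp add: l_def aA minus_1)
    then have 2: "A $ 2 $ 1 = 0 \<and> A $ 2 $ 2 - 1 = 0" using indep l by metis
    have "val_ge P d (\<theta> * (l - 1) - (\<theta> * l - m))"
      using val_ge_diff[OF val_ge_mult0[OF \<theta>(1) l] w] by simp
    moreover have "\<theta> * (l - 1) - (\<theta> * l - m) = to_fract [:A $ 1 $ 1 - 1:] * \<theta> + to_fract [:A $ 1 $ 2:]"
      by (simp add: m_def aA minus_1 algebra_simps)
    ultimately have "A $ 1 $ 1 - 1 = 0 \<and> A $ 1 $ 2 = 0" using indep by metis
    then have "a = mat 1" using 2 by (intro mat2_eqI) (simp_all add: aA one_pCons[symmetric])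
    then show False using a by blast
  qed
qed

lemma not_split_of_three_points:
  fixes D :: "('a::field) divisor"
  assumes D: "effective D" and P: "P \<noteq> Q" "P \<noteq> R" "Q \<noteq> R"
    and lookup: "Poly_Mapping.lookup D P \<ge> 1" "Poly_Mapping.lookup D Q \<ge> 1" "Poly_Mapping.lookup D R \<ge> 1"
    and split: "\<forall>E. eichler_order_of_level D E \<longrightarrow> split_order E"
  shows False
proof -
  define e where "e S = (if S = Q then mat2 0 1 1 0 else if S = R then mat2 1 1 0 1 else mat 1 :: 'a ratfun^2^2)" for S
  have eu: "unimod S (e S)" for S by (auto simp: e_def intro: unimod_swap unimod_upper)
  have "{S. e S \<noteq> mat 1} \<subseteq> {Q, R}" by (auto simp: e_def)
  then have fin: "finite {S. e S \<noteq> mat 1}" using finite_subset by blast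
  obtain A :: "'a^2^2" and a where a: "a = (\<chi> i j. to_fract [:A $ i $ j:])" "a ** a = a" "a \<noteq> 0" "a \<noteq> mat 1"
    and cond': "\<forall>P. val_ge P (Poly_Mapping.lookup D P) (matrix_conj (e P) a $ 1 $ 2)"
    by (rule level_order_not_split[OF D split eu fin]) (rule that)
  note cond = cond'[rule_format]
  have aA: "a $ i $ j = to_fract [:A $ i $ j:]" for i j by (simp add: a(1))
  have cond1: "val_ge S 1 (matrix_conj (e S) a $ 1 $ 2)" if "Poly_Mapping.lookup D S \<ge> 1" for S
    using cond that by (rule val_ge_mono)
  have "val_ge P 1 (a $ 1 $ 2)" using cond1[OF lookup(1)] P by (simp add: e_def)
  then have 12: "A $ 1 $ 2 = 0" by (simp add: aA)
  have "val_ge Q 1 (wedge a 1 0)"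
    using cond1[OF lookup(2)] unimod_wedge(1)[OF unimod_swap, of Q 1 a] by (simp add: e_def)
  then have 21: "A $ 2 $ 1 = 0" by (simp add: wedge_def aA)
  have "val_ge R 1 (wedge a 1 1)"
    using cond1[OF lookup(3)] P unimod_wedge(1)[OF unimod_upper[of R 1]] by (simp add: e_def)
  moreover have "wedge a 1 1 = to_fract [:A $ 2 $ 2 - A $ 1 $ 1:]"
    using 12 21 by (simp add: wedge_def aA to_fract_diff[symmetric] del: to_fract_diff)
  ultimately have "A $ 2 $ 2 = A $ 1 $ 1" by simp
  then have "a = 0 \<or> a = mat 1" using a(2) 12 21 by (intro idempotent_scalar) (simp_all add: aA)
  then show False using a by blast
qed

lemma rational_points: "\<exists>P Q :: 'a::field closed_point. P \<noteq> Q \<and> point_degree P = 1 \<and> point_degree Q = 1"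
proof -
  obtain P :: "'a closed_point" where P: "equation_of P = None" using ex_infinity by blast
  obtain Q :: "'a closed_point" where Q: "equation_of Q = Some [:- 0, 1:]" using ex_linear_point by blast
  have "P \<noteq> Q" using P Q by auto
  then show ?thesis using P Q by (intro exI[of _ P] exI[of _ Q]) (simp add: point_degree_def)
qed

lemma all_split_imp_level:
  fixes D :: "('a::field) divisor"
  assumes D: "effective D" and split: "\<forall>E. eichler_order_of_level D E \<longrightarrow> split_order E"
  shows "Poly_Mapping.lookup D P \<noteq> 0 \<Longrightarrow> Poly_Mapping.lookup D P = 1 \<and> point_degree P = 1"
proof -
  assume nz: "Poly_Mapping.lookup D P \<noteq> 0"
  have "Poly_Mapping.lookup D P \<ge> 0" using D by (simp add: effective_def div_le_def)
  then have ge1: "Poly_Mapping.lookup D P \<ge> 1" using nz by simp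
  have deg: "point_degree P = 1"
  proof (rule ccontr)
    assume deg: "point_degree P \<noteq> 1"
    then obtain p where p: "equation_of P = Some p" by (cases "equation_of P") (auto simp: point_degree_def)
    have dp: "degree p > 1" using deg p equation_of_SomeD(5)[OF p] by (simp add: point_degree_def)
    have "\<not> val_ge P (Poly_Mapping.lookup D P) (to_fract [:0, 1:] - to_fract [:c:])" for c
    proof
      assume "val_ge P (Poly_Mapping.lookup D P) (to_fract [:0, 1:] - to_fract [:c:])"
      then have "val_ge P 1 (to_fract ([:0, 1:] - [:c:]))" using val_ge_mono[OF _ ge1] by (simp only: to_fract_diff)
      then have "val_ge P 1 (to_fract [:- c, 1:])" by simp
      then have "ord_poly P [:- c, 1:] \<noteq> 0" by (simp add: val_ge_iff ord_to_fract)
      then have "p dvd [:- c, 1:]" using ord_poly_eq_0_iff[OF p, of "[:- c, 1:]"] by simp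
      then have "degree p \<le> degree [:- c, 1:]" by (rule dvd_imp_degree_le) simp
      then show False using dp by simp
    qed
    moreover have "val_ge P 0 (to_fract [:0, 1:])" by (rule val_ge_poly) (simp add: p)
    ultimately show False using not_split_of_nonconstant_line[OF D _ _ split] by blast
  qed
  moreover have "Poly_Mapping.lookup D P = 1"
  proof (rule ccontr)
    assume "Poly_Mapping.lookup D P \<noteq> 1"
    then have ge2: "Poly_Mapping.lookup D P \<ge> 2" using ge1 by simp
    have "\<not> val_ge P (Poly_Mapping.lookup D P) (uniformizer P - to_fract [:c:])" for c
    proof
      assume "val_ge P (Poly_Mapping.lookup D P) (uniformizer P - to_fract [:c:])"
      then have v: "val_ge P 2 (uniformizer P - to_fract [:c:])" by (rule val_ge_mono[OF _ ge2])
      have "val_ge P 1 (uniformizer P - (uniformizer P - to_fract [:c:]))"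
        by (intro val_ge_diff val_ge_mono[OF v]) (auto simp: val_ge_iff)
      then have "c = 0" by simp
      then show False using v by (simp add: val_ge_iff)
    qed
    moreover have "val_ge P 0 (uniformizer P)" by (simp add: val_ge_iff)
    ultimately show False using not_split_of_nonconstant_line[OF D _ _ split] by blast
  qed
  ultimately show "Poly_Mapping.lookup D P = 1 \<and> point_degree P = 1" by blast
qed

theorem theorem1p2:
  fixes D :: "('a::{field,finite}) divisor"
  assumes "effective D"
  shows "(\<forall>E. eichler_order_of_level D E \<longrightarrow> split_order E) \<longleftrightarrow>
    (\<exists>P\<^sub>1 P\<^sub>2. P\<^sub>1 \<noteq> P\<^sub>2 \<and> point_degree P\<^sub>1 = 1 \<and> point_degree P\<^sub>2 = 1 \<and>
       div_le D (Poly_Mapping.single P\<^sub>1 1 + Poly_Mapping.single P\<^sub>2 1))"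
proof
  assume split: "\<forall>E. eichler_order_of_level D E \<longrightarrow> split_order E"
  let ?l = "Poly_Mapping.lookup D"
  note level = all_split_imp_level[OF assms split]
  have three: "P = Q \<or> P = R \<or> Q = R" if "?l P \<noteq> 0" "?l Q \<noteq> 0" "?l R \<noteq> 0" for P Q R
    using not_split_of_three_points[OF assms _ _ _ _ _ _ split, of P Q R] level that by fastforce
  have "\<exists>P Q. P \<noteq> Q \<and> point_degree P = 1 \<and> point_degree Q = 1 \<and> (\<forall>R. ?l R \<noteq> 0 \<longrightarrow> R = P \<or> R = Q)"
  proof (cases "\<exists>P Q. P \<noteq> Q \<and> ?l P \<noteq> 0 \<and> ?l Q \<noteq> 0")
    case True
    then obtain P Q where PQ: "P \<noteq> Q" "?l P \<noteq> 0" "?l Q \<noteq> 0" by blast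
    then have "\<forall>R. ?l R \<noteq> 0 \<longrightarrow> R = P \<or> R = Q" using three by metis
    then show ?thesis using PQ level by blast
  next
    case no_two: False
    obtain P Q :: "'a closed_point" where PQ: "P \<noteq> Q" "point_degree P = 1" "point_degree Q = 1"
      using rational_points by blast
    show ?thesis
    proof (cases "\<exists>R. ?l R \<noteq> 0")
      case True
      then obtain R where R: "?l R \<noteq> 0" by blast
      then have "\<forall>S. ?l S \<noteq> 0 \<longrightarrow> S = R" "point_degree R = 1" using no_two level by blast+
      then show ?thesis using PQ by metis
    next
      case False
      then show ?thesis using PQ by blast
    qed
  qed
  then obtain P Q where PQ: "P \<noteq> Q" "point_degree P = 1" "point_degree Q = 1" "\<And>R. ?l R \<noteq> 0 \<Longrightarrow> R = P \<or> R = Q"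
    by blast
  have "?l R \<le> Poly_Mapping.lookup (Poly_Mapping.single P 1 + Poly_Mapping.single Q 1) R" for R
  proof (cases "?l R = 0")
    case True
    then show ?thesis by (simp add: lookup_add lookup_single when_def)
  next
    case False
    then show ?thesis using level[OF False] PQ(4)[OF False] by (auto simp: lookup_add lookup_single when_def)
  qed
  then show "\<exists>P\<^sub>1 P\<^sub>2. P\<^sub>1 \<noteq> P\<^sub>2 \<and> point_degree P\<^sub>1 = 1 \<and> point_degree P\<^sub>2 = 1 \<and>
       div_le D (Poly_Mapping.single P\<^sub>1 1 + Poly_Mapping.single P\<^sub>2 1)"
    using PQ unfolding div_le_def by blast
next
  assume "\<exists>P\<^sub>1 P\<^sub>2. P\<^sub>1 \<noteq> P\<^sub>2 \<and> point_degree P\<^sub>1 = 1 \<and> point_degree P\<^sub>2 = 1 \<and>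
       div_le D (Poly_Mapping.single P\<^sub>1 1 + Poly_Mapping.single P\<^sub>2 1)"
  then obtain P\<^sub>1 P\<^sub>2 where P: "point_degree P\<^sub>1 = 1" "point_degree P\<^sub>2 = 1" "P\<^sub>1 \<noteq> P\<^sub>2"
    and le: "div_le D (Poly_Mapping.single P\<^sub>1 1 + Poly_Mapping.single P\<^sub>2 1)" by blast
  have D: "Poly_Mapping.lookup D P = 1 \<and> (P = P\<^sub>1 \<or> P = P\<^sub>2)" if "Poly_Mapping.lookup D P \<noteq> 0" for P
  proof -
    have "0 \<le> Poly_Mapping.lookup D P" using assms by (simp add: effective_def div_le_def)
    moreover have "Poly_Mapping.lookup D P \<le> (if P = P\<^sub>1 then 1 else 0) + (if P = P\<^sub>2 then 1 else 0)"
      using le[unfolded div_le_def, rule_format, of P] by (simp add: lookup_add lookup_single when_def)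
    ultimately show ?thesis using that P(3) by (auto split: if_splits)
  qed
  show "\<forall>E. eichler_order_of_level D E \<longrightarrow> split_order E"
  proof (intro allI impI)
    fix E assume "eichler_order_of_level D E"
    then have "\<exists>e. local_family e \<and> (\<forall>U. zopen U \<longrightarrow> E U = level_order D e U)"
      by (rule iffD1[OF eichler_order_iff[OF assms]])
    then obtain e where e: "local_family e" and E: "\<forall>U. zopen U \<longrightarrow> E U = level_order D e U"
      by (elim exE conjE)
    show "split_order E"
    proof (rule level_order_split[OF e _ P])
      show "E U = level_order D e U" if "zopen U" for U using E that by simp
    qed (rule D)
  qed
qed

end
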